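(* Let $n\ge 1$ and let $\chi$ be a (nonzero) complex character of the symmetric group $S_n$, with associated symbol $(\mathfrak a(\chi)\mid\mathfrak b(\chi))$ as defined in the context. If $(\mathfrak a(\chi)\mid\mathfrak b(\chi))$ is not the Frobenius symbol of a partition of $n$, then $\chi$ is not irreducible.
   Context: Frobenius symbols. For sequences $a=(a_1,\dots,a_k)$, $b=(b_1,\dots,b_k)$ write $(a\mid b)=(a_1,\dots,a_k\mid b_1,\dots,b_k)$. If the $a_i,b_i$ are integers with $a_1>\dots>a_k\ge 0$ and $b_1>\dots>b_k\ge 0$, then $(a\mid b)$ is the Frobenius symbol of the unique partition $\lambda$ of $\sum_{i=1}^k(a_i+b_i+1)$ with $\lambda_i=a_i+i$ and $\lambda'_i=b_i+i$ for $1\le i\le k$ ($\lambda'$ is the conjugate partition); otherwise $(a\mid b)$ is not the Frobenius symbol of a partition. Convention. If $\nu=(\nu_1,\dots,\nu_l)$ is a partition of some $m\le n$ and $\chi$ is a character of $S_n$, then $\chi([\nu_1,\dots,\nu_l])$ is the value of $\chi$ on permutations of cycle type $(\nu_1,\dots,\nu_l,1,\dots,1)$ with $n-m$ appended $1$'s. Definition of $\mathfrak h(\chi)$ and $\mathfrak d(\chi)$. For any (nonzero) character $\chi$ of $S_n$, define sequences $\mathfrak h(\chi)=(\mathfrak h_1,\dots,\mathfrak h_{\mathfrak k})$ and $\mathfrak d(\chi)=(\mathfrak d_1,\dots,\mathfrak d_{\mathfrak k+1})$, with $\mathfrak k=\mathfrak k(\chi)$, recursively: 1) $\mathfrak d_1=\chi(1)$;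 $\mathfrak h_1$ is the first element of the sequence $n,n-1,\dots,1$ with $\chi([\mathfrak h_1])\ne 0$; $\mathfrak d_2=\chi([\mathfrak h_1])$. 2) Given $\mathfrak h_1,\dots,\mathfrak h_{u-1}$ and $\mathfrak d_1,\dots,\mathfrak d_u$ with $u\ge 2$: (a) if $\sum_{i=1}^{u-1}\mathfrak h_i=n$ or $\mathfrak h_{u-1}\le 2$, then $\mathfrak k=u-1$ and the process stops; (b) if $\sum_{i=1}^{u-1}\mathfrak h_i<n$ and $\mathfrak h_{u-1}>2$, put $n_u=\min\{\mathfrak h_{u-1}-2,\ n-\sum_{i=1}^{u-1}\mathfrak h_i\}$, let $\mathfrak h_u$ be the first element of $n_u,n_u-1,\dots,1$ with $\chi([\mathfrak h_1,\dots,\mathfrak h_u])\neq 0$, and let $\mathfrak d_{u+1}=\chi([\mathfrak h_1,\dots,\mathfrak h_u])$. Definition of $\mathfrak c(\chi)$. For $i=1,\dots,\mathfrak k$, $$\mathfrak c_i=\frac{\binom{n-\sum_{j=1}^{i-1}\mathfrak h_j}{2}\,\chi([\mathfrak h_1,\dots,\mathfrak h_{i-1},2])}{\mathfrak d_i},$$ with the convention $\mathfrak c_{\mathfrak k}=0$ if $\mathfrak h_{\mathfrak k}=1$. Definition of the symbol. With $\binom{x}{2}=x(x-1)/2$, define $\mathfrak a(\chi)=(\mathfrak a_1,\dots,\mathfrak a_{\mathfrak k})$ (rational numbers) by $\mathfrak a_{\mathfrak k}=\frac{1}{\mathfrak h_{\mathfrak k}}\left(\mathfrak c_{\mathfrak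 k}+\binom{\mathfrak h_{\mathfrak k}}{2}\right)$ and, for $i=\mathfrak k-1,\mathfrak k-2,\dots,1$, $$\mathfrak a_i=\mathfrak a_{i+1}+\frac{1}{\mathfrak h_i}\left[\mathfrak c_i-\mathfrak c_{i+1}-\binom{\mathfrak a_{i+1}+1}{2}+\binom{\mathfrak h_{i+1}-\mathfrak a_{i+1}}{2}+\binom{\mathfrak h_i-\mathfrak h_{i+1}+1}{2}+(\mathfrak h_{i+1}-\mathfrak a_{i+1}-1)(\mathfrak h_i-\mathfrak h_{i+1})\right].$$ Define $\mathfrak b(\chi)=(\mathfrak b_1,\dots,\mathfrak b_{\mathfrak k})$ by $\mathfrak b_i=\mathfrak h_i-\mathfrak a_i-1$. *)

theory Defs
  imports
    "HOL-Algebra.Sym_Groups"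
    "HOL-Combinatorics.Orbits"
    "HOL-Library.Multiset"
    "Jordan_Normal_Form.VS_Connect"
begin

section \<open>Complex characters of the symmetric group\<close>

definition representation :: "nat \<Rightarrow> nat \<Rightarrow> ((nat \<Rightarrow> nat) \<Rightarrow> complex mat) \<Rightarrow> bool" where
  "representation n d \<rho> \<longleftrightarrow> \<rho> \<in> hom (sym_group n) (units_of (ring_mat TYPE(complex) d ()))"

definition invariant_subspace ::
    "nat \<Rightarrow> nat \<Rightarrow> ((nat \<Rightarrow> nat) \<Rightarrow> complex mat) \<Rightarrow> complex vec set \<Rightarrow> bool" where
  "invariant_subspace n d \<rho> W \<longleftrightarrow>
     VectorSpace.subspace class_ring W (module_vec TYPE(complex) d) \<and>
     (\<forall>p \<in> carrier (sym_group n). \<forall>w \<in> W. \<rho> p *\<^sub>v w \<in> W)"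

definition irreducible_representation ::
    "nat \<Rightarrow> nat \<Rightarrow> ((nat \<Rightarrow> nat) \<Rightarrow> complex mat) \<Rightarrow> bool" where
  "irreducible_representation n d \<rho> \<longleftrightarrow>
     representation n d \<rho> \<and> d \<noteq> 0 \<and>
     (\<forall>W. invariant_subspace n d \<rho> W \<longrightarrow> W = {0\<^sub>v d} \<or> W = carrier_vec d)"

definition mat_trace :: "'a :: comm_monoid_add mat \<Rightarrow> 'a" where
  "mat_trace A = (\<Sum>i<dim_row A. A $$ (i, i))"

text \<open>Only the restriction of \<open>\<chi>\<close> to \<open>carrier (sym_group n)\<close> matters. Since \<open>d = 0\<close> is allowed
  in \<open>is_character\<close>, the zero function is a character in this sense.\<close>

definition affords ::
    "nat \<Rightarrow> ((nat \<Rightarrow> nat) \<Rightarrow> complex mat) \<Rightarrow> ((nat \<Rightarrow> nat) \<Rightarrow> complex) \<Rightarrow> bool" where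
  "affords n \<rho> \<chi> \<longleftrightarrow> (\<forall>p \<in> carrier (sym_group n). \<chi> p = mat_trace (\<rho> p))"

definition is_character :: "nat \<Rightarrow> ((nat \<Rightarrow> nat) \<Rightarrow> complex) \<Rightarrow> bool" where
  "is_character n \<chi> \<longleftrightarrow> (\<exists>d \<rho>. representation n d \<rho> \<and> affords n \<rho> \<chi>)"

definition irreducible_character :: "nat \<Rightarrow> ((nat \<Rightarrow> nat) \<Rightarrow> complex) \<Rightarrow> bool" where
  "irreducible_character n \<chi> \<longleftrightarrow> (\<exists>d \<rho>. irreducible_representation n d \<rho> \<and> affords n \<rho> \<chi>)"


section \<open>Values on cycle types\<close>

definition cycle_type :: "nat \<Rightarrow> (nat \<Rightarrow> nat) \<Rightarrow> nat multiset" where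
  "cycle_type n p = image_mset card (mset_set (orbit p ` {1..n}))"

text \<open>\<open>char_at n \<chi> \<nu>\<close> is the value \<open>\<chi>([\<nu>\<^sub>1, \<dots>, \<nu>\<^sub>l])\<close>, the list being padded with ones; it is
  meant for lists of positive numbers with sum at most \<open>n\<close>. As characters are class functions,
  the choice of the permutation is irrelevant.\<close>

definition char_at :: "nat \<Rightarrow> ((nat \<Rightarrow> nat) \<Rightarrow> complex) \<Rightarrow> nat list \<Rightarrow> complex" where
  "char_at n \<chi> \<nu> =
     \<chi> (SOME p. p \<in> carrier (sym_group n) \<and>
               cycle_type n p = mset \<nu> + replicate_mset (n - sum_list \<nu>) 1)"


section \<open>The symbol of a character\<close>

text \<open>\<open>h_step n \<chi> hs\<close> looks for the next element after \<open>hs = [\<hh>\<^sub>1, \<dots>, \<hh>\<^sub>u\<^sub>-\<^sub>1]\<close>, searching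
  \<open>n\<^sub>u, n\<^sub>u - 1, \<dots>, 1\<close> in this order, where the bound is \<open>n\<close> for \<open>u = 1\<close>.\<close>

definition h_bound :: "nat \<Rightarrow> nat list \<Rightarrow> nat" where
  "h_bound n hs = (if hs = [] then n else min (last hs - 2) (n - sum_list hs))"

definition h_step :: "nat \<Rightarrow> ((nat \<Rightarrow> nat) \<Rightarrow> complex) \<Rightarrow> nat list \<Rightarrow> nat option" where
  "h_step n \<chi> hs = find (\<lambda>h. char_at n \<chi> (hs @ [h]) \<noteq> 0) (rev [1..<Suc (h_bound n hs)])"

lemma h_step_SomeD:
  assumes "h_step n \<chi> hs = Some h"
  shows "1 \<le> h" "h \<le> h_bound n hs"
proof -
  have "h \<in> set (rev [1..<Suc (h_bound n hs)])"
    using assms unfolding h_step_def find_Some_iff by (metis nth_mem)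
  then show "1 \<le> h" "h \<le> h_bound n hs" by auto
qed

text \<open>The case \<open>None\<close> does not occur for nonzero characters and \<open>n \<ge> 1\<close>: the last candidate
  \<open>h = 1\<close> does not change the padded cycle type, and \<open>char_at n \<chi> hs \<noteq> 0\<close> holds throughout.\<close>

function h_from :: "nat \<Rightarrow> ((nat \<Rightarrow> nat) \<Rightarrow> complex) \<Rightarrow> nat list \<Rightarrow> nat list" where
  "h_from n \<chi> hs =
     (if hs \<noteq> [] \<and> (sum_list hs = n \<or> last hs \<le> 2) then hs
      else case h_step n \<chi> hs of None \<Rightarrow> hs | Some h \<Rightarrow> h_from n \<chi> (hs @ [h]))"
  by pat_completeness auto
termination
proof (relation "measure (\<lambda>(n, \<chi>, hs). n - sum_list hs)", goal_cases)
  case (2 n \<chi> hs h)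
  then show ?case
    using h_step_SomeD[of n \<chi> hs h] by (auto simp: h_bound_def split: if_splits)
qed simp

declare h_from.simps [simp del]

definition h_seq :: "nat \<Rightarrow> ((nat \<Rightarrow> nat) \<Rightarrow> complex) \<Rightarrow> nat list" where
  "h_seq n \<chi> = h_from n \<chi> []"

text \<open>List positions start from \<open>0\<close>, so \<open>d_seq n \<chi> ! i\<close>, \<open>h_seq n \<chi> ! i\<close> and \<open>c_seq n \<chi> ! i\<close> are
  \<open>\<dd>\<^sub>i\<^sub>+\<^sub>1\<close>, \<open>\<hh>\<^sub>i\<^sub>+\<^sub>1\<close> and \<open>\<cc>\<^sub>i\<^sub>+\<^sub>1\<close>.\<close>

definition d_seq :: "nat \<Rightarrow> ((nat \<Rightarrow> nat) \<Rightarrow> complex) \<Rightarrow> complex list" where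
  "d_seq n \<chi> = map (\<lambda>i. char_at n \<chi> (take i (h_seq n \<chi>))) [0..<Suc (length (h_seq n \<chi>))]"

definition c_seq :: "nat \<Rightarrow> ((nat \<Rightarrow> nat) \<Rightarrow> complex) \<Rightarrow> complex list" where
  "c_seq n \<chi> =
     (let hs = h_seq n \<chi> in
      map (\<lambda>i. if Suc i = length hs \<and> hs ! i = 1 then 0
               else of_nat ((n - sum_list (take i hs)) choose 2)
                      * char_at n \<chi> (take i hs @ [2]) / d_seq n \<chi> ! i)
        [0..<length hs])"

text \<open>The backward recursion for \<open>\<aa>\<close>, on the lists of all \<open>\<hh>\<^sub>i\<close> and all \<open>\<cc>\<^sub>i\<close>.\<close>

fun a_rec :: "complex list \<Rightarrow> complex list \<Rightarrow> complex list" where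
  "a_rec [h] [c] = [1 / h * (c + (h gchoose 2))]"
| "a_rec (h # h' # hs) (c # c' # cs) =
     (let as = a_rec (h' # hs) (c' # cs); a' = hd as in
      (a' + 1 / h *
         (c - c' - ((a' + 1) gchoose 2) + ((h' - a') gchoose 2) + ((h - h' + 1) gchoose 2)
          + (h' - a' - 1) * (h - h'))) # as)"
| "a_rec _ _ = []"

definition a_seq :: "nat \<Rightarrow> ((nat \<Rightarrow> nat) \<Rightarrow> complex) \<Rightarrow> complex list" where
  "a_seq n \<chi> = a_rec (map of_nat (h_seq n \<chi>)) (c_seq n \<chi>)"

definition b_seq :: "nat \<Rightarrow> ((nat \<Rightarrow> nat) \<Rightarrow> complex) \<Rightarrow> complex list" where
  "b_seq n \<chi> = map2 (\<lambda>h a. of_nat h - a - 1) (h_seq n \<chi>) (a_seq n \<chi>)"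


section \<open>Frobenius symbols\<close>

definition is_partition :: "nat list \<Rightarrow> nat \<Rightarrow> bool" where
  "is_partition \<mu> n \<longleftrightarrow> sorted_wrt (\<ge>) \<mu> \<and> 0 \<notin> set \<mu> \<and> sum_list \<mu> = n"

text \<open>The parts \<open>\<mu>\<^sub>i\<close> and \<open>\<mu>'\<^sub>i\<close> of a partition and of its conjugate, for \<open>i \<ge> 1\<close>.\<close>

definition part :: "nat list \<Rightarrow> nat \<Rightarrow> nat" where
  "part \<mu> i = (if 1 \<le> i \<and> i \<le> length \<mu> then \<mu> ! (i - 1) else 0)"

definition conjugate_part :: "nat list \<Rightarrow> nat \<Rightarrow> nat" where
  "conjugate_part \<mu> i = card {j. 1 \<le> j \<and> j \<le> length \<mu> \<and> i \<le> part \<mu> j}"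

definition is_frobenius_symbol :: "complex list \<Rightarrow> complex list \<Rightarrow> nat list \<Rightarrow> bool" where
  "is_frobenius_symbol a b \<mu> \<longleftrightarrow>
     (\<exists>a' b' :: nat list.
        a = map of_nat a' \<and> b = map of_nat b' \<and> length a' = length b' \<and>
        sorted_wrt (>) a' \<and> sorted_wrt (>) b' \<and>
        is_partition \<mu> (\<Sum>i<length a'. a' ! i + b' ! i + 1) \<and>
        (\<forall>i\<in>{1..length a'}. part \<mu> i = a' ! (i - 1) + i \<and> conjugate_part \<mu> i = b' ! (i - 1) + i))"

end

theory Submission
  imports Defs "Jordan_Normal_Form.Spectral_Radius"
begin

text \<open>
  Let \<open>\<chi>\<close> be irreducible. Call \<open>X\<^sub>v(\<nu>)\<close>, for \<open>v \<in> \<nat>\<^sup>n\<close>, the coefficient of \<open>x\<^sup>v\<close> in the product of the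
  Vandermonde determinant and the power sums \<open>p\<^sub>k\<close>, \<open>k \<in> \<nu>\<close> (Frobenius' formula). Multiplication by
  \<open>p\<^sub>k\<close> and its adjoint satisfy the Heisenberg relations, and so
  \<open>\<Sum>\<^sub>v X\<^sub>v(\<mu>) X\<^sub>v(\<nu>) = n! z\<^sub>\<mu> \<delta>\<^sub>\<mu>\<^sub>\<nu>\<close>. As \<open>X\<^sub>v\<close> is a signed sum of permutation characters on words, the
  scalar products \<open>m\<^sub>v\<close> of \<open>\<chi>\<close> and \<open>X\<^sub>v\<close> are integers. Now \<open>n! \<chi> = \<Sum>\<^sub>v m\<^sub>v X\<^sub>v\<close> and Schur's lemma yield
  \<open>\<Sum>\<^sub>v m\<^sub>v\<^sup>2 = n!\<close>. Since the \<open>m\<^sub>v\<close> are alternating in \<open>v\<close>, only one \<open>S\<^sub>n\<close>-orbit of vectors contributes, so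
  \<open>\<chi>\<close> is a multiple of a single \<open>X\<^sub>v\<close>. The set of entries of \<open>v\<close> is the Maya diagram of a partition; by
  the Murnaghan--Nakayama rule the \<open>\<hh>\<^sub>i\<close> are its principal hook lengths, the \<open>\<cc>\<^sub>i\<close> are the content sums
  of the successively stripped partitions, and the recursion for \<open>\<aa>\<close> solves for its Frobenius symbol.
\<close>

section \<open>Frobenius' formula in terms of alternating functions\<close>

text \<open>Exponent vectors are never sorted: a partition is represented by all arrangements of its
  bead positions, and the sign rule \<open>alternating\<close> takes the place of sorting. Hence the
  factor n! in every scalar product, and hence no leg-length signs when a principal hook is
  stripped: a bead moves without changing its index. The number of variables has to be at least n,
  since the power-sum products of a degree above the number of variables are linearly dependent and
  cannot be orthogonal with nonzero norms. In the proof this appears as the degree bound of the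
  Heisenberg relation. The factor between \<chi> and X_v can stay an unspecified nonzero number,
  because the h_i depend only on which values vanish and the c_i only on quotients of values. The
  search for h_i may start at h_(i-1) - 2 because arm and leg both drop strictly from one principal
  hook to the next. Length and content sum determine a hook: for fixed length h the content sum is
  linear in the arm, with slope h. This is the origin of the divisions by h_i in the
  recursion.\<close>

lemma sum_card_le_sum: "finite S \<Longrightarrow> \<Sum>{..<card S} \<le> \<Sum>(S :: nat set)"
proof (induction rule: finite_linorder_max_induct)
  case (insert b A)
  have "card A \<le> b" using insert.hyps card_mono[of "{..<b}" A] by auto
  then show ?case using insert by (auto simp: lessThan_Suc)
qed simp

context fixes N :: nat
begin

section \<open>Exponent vectors and multiplication by power sums\<close>

definition nonneg :: "(nat \<Rightarrow> int) \<Rightarrow> bool" where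
  "nonneg v \<longleftrightarrow> (\<forall>i<N. 0 \<le> v i)"

definition add_at :: "nat \<Rightarrow> int \<Rightarrow> (nat \<Rightarrow> int) \<Rightarrow> nat \<Rightarrow> int" where
  "add_at i k v = v(i := v i + k)"

definition alternating :: "((nat \<Rightarrow> int) \<Rightarrow> int) \<Rightarrow> bool" where
  "alternating u \<longleftrightarrow> (\<forall>v w. w permutes {..<N} \<longrightarrow> u (v \<circ> w) = sign w * u v)"

text \<open>The coefficient of x^v in the Vandermonde determinant. In terms of beads it is the empty
  partition, with the positions 0, ..., N - 1 occupied.\<close>

definition vacuum :: "(nat \<Rightarrow> int) \<Rightarrow> int" where
  "vacuum v = (\<Sum>w | w permutes {..<N}. if \<forall>i<N. v i = int (w i) then sign w else 0)"

text \<open>Multiplication by the power sum p_k, seen on coefficients. What is lowered is the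
  argument; the degree of the function goes up. Negative k is allowed, for use in
  \<open>raise\<close>.\<close>

definition lower :: "int \<Rightarrow> ((nat \<Rightarrow> int) \<Rightarrow> int) \<Rightarrow> (nat \<Rightarrow> int) \<Rightarrow> int" where
  "lower k u v = (\<Sum>i<N. u (add_at i (-k) v))"

text \<open>The adjoint of \<open>lower k\<close> with respect to sums over nonnegative vectors. The
  cut-off by \<open>nonneg\<close> produces the Heisenberg commutator: without it the two operators
  would commute by \<open>lower_commute\<close>.\<close>

definition raise :: "int \<Rightarrow> ((nat \<Rightarrow> int) \<Rightarrow> int) \<Rightarrow> (nat \<Rightarrow> int) \<Rightarrow> int" where
  "raise k u v = (if nonneg v then lower (-k) u v else 0)"

definition frob_char :: "nat multiset \<Rightarrow> (nat \<Rightarrow> int) \<Rightarrow> int" where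
  "frob_char \<nu> = fold_mset (\<lambda>k. lower (int k)) vacuum \<nu>"

text \<open>The degree of the Vandermonde determinant, which is the least degree of a nonzero
  alternating polynomial.\<close>

definition degree0 :: int where "degree0 = (\<Sum>i<N. int i)"

lemma add_at_commute: "add_at i k (add_at j l v) = add_at j l (add_at i k v)"
  by (auto simp: add_at_def fun_eq_iff)

lemma add_at_add: "add_at i k (add_at i l v) = add_at i (k + l) v"
  by (auto simp: add_at_def fun_eq_iff)

lemma lower_commute: "lower k (lower l u) = lower l (lower k u)"
proof
  fix v
  show "lower k (lower l u) v = lower l (lower k u) v"
    unfolding lower_def by (subst sum.swap) (simp add: add_at_commute)
qed

interpretation lower_fold: comp_fun_commute "\<lambda>k. lower (int k)"
  by unfold_locales (auto simp: fun_eq_iff lower_commute)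

lemma frob_char_empty [simp]: "frob_char {#} = vacuum"
  by (simp add: frob_char_def)

lemma frob_char_add [simp]: "frob_char (add_mset k \<nu>) = lower (int k) (frob_char \<nu>)"
  by (simp add: frob_char_def)

lemma alternating_perm:
  "alternating u \<Longrightarrow> w permutes {..<N} \<Longrightarrow> u (v \<circ> w) = sign w * u v"
  by (auto simp: alternating_def)

text \<open>Exchanging two positions with equal entries fixes \<open>v\<close> but changes the
  sign.\<close>

lemma alternating_not_inj:
  assumes "alternating u" and "\<not> inj_on v {..<N}"
  shows "u v = 0"
proof -
  from assms(2) obtain i j where ij: "i < N" "j < N" "i \<noteq> j" "v i = v j"
    by (auto simp: inj_on_def)
  have "v \<circ> transpose i j = v"
    using ij by (auto simp: fun_eq_iff transpose_def)
  moreover have "u (v \<circ> transpose i j) = sign (transpose i j) * u v"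
    using ij by (intro alternating_perm[OF assms(1)] permutes_swap_id) auto
  ultimately show ?thesis using ij by (simp add: sign_swap_id)
qed

text \<open>The weight depends on the entry and not on its index, so it follows the permutation.
  Weight 1 gives \<open>lower\<close>; weight x - N serves for content sums.\<close>

lemma alternating_weighted:
  assumes "alternating u"
  shows "alternating (\<lambda>v. \<Sum>i<N. f (v i) * u (add_at i k v))"
  unfolding alternating_def
proof safe
  fix v w assume w: "w permutes {..<N}"
  have "add_at i k (v \<circ> w) = add_at (w i) k v \<circ> w" for i
    using permutes_inj[OF w] by (auto simp: add_at_def fun_eq_iff inj_eq)
  then have "(\<Sum>i<N. f ((v \<circ> w) i) * u (add_at i k (v \<circ> w)))
      = (\<Sum>i<N. f (v (w i)) * (sign w * u (add_at (w i) k v)))"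
    by (simp add: alternating_perm[OF assms w])
  also have "\<dots> = (\<Sum>i<N. f (v i) * (sign w * u (add_at i k v)))"
    using sum.permute[OF w, of "\<lambda>i. f (v i) * (sign w * u (add_at i k v))"] by (simp add: o_def)
  finally show "(\<Sum>i<N. f ((v \<circ> w) i) * u (add_at i k (v \<circ> w)))
      = sign w * (\<Sum>i<N. f (v i) * u (add_at i k v))"
    by (simp add: sum_distrib_left mult_ac)
qed

lemma alternating_lower: "alternating u \<Longrightarrow> alternating (lower k u)"
  using alternating_weighted[of u "\<lambda>_. 1" "-k"] by (simp add: lower_def[abs_def])

lemma nonneg_perm: "w permutes {..<N} \<Longrightarrow> nonneg (v \<circ> w) \<longleftrightarrow> nonneg v"
  unfolding nonneg_def
  by (metis comp_apply lessThan_iff permutes_in_image permutes_inverses(1))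

lemma alternating_raise:
  assumes "alternating u" shows "alternating (raise k u)"
  using alternating_lower[OF assms, of "-k"]
  by (auto simp: alternating_def raise_def nonneg_perm)

lemma alternating_vacuum: "alternating vacuum"
  unfolding alternating_def
proof safe
  fix v w assume w: "w permutes {..<N}"
  have eq: "(\<forall>i<N. v (w i) = int (p i)) \<longleftrightarrow> (\<forall>i<N. v i = int ((p \<circ> inv' w) i))" for p
  proof safe
    fix i assume "\<forall>i<N. v (w i) = int (p i)" "i < N"
    then show "v i = int ((p \<circ> inv' w) i)"
      using permutes_in_image[OF permutes_inv[OF w], of i] permutes_inverses[OF w] by auto
  next
    fix i assume "\<forall>i<N. v i = int ((p \<circ> inv' w) i)" "i < N"
    then show "v (w i) = int (p i)"
      using permutes_in_image[OF w, of i] permutes_inverses[OF w] by auto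
  qed
  have "vacuum (v \<circ> w) = (\<Sum>p | p permutes {..<N}.
      if \<forall>i<N. v i = int ((p \<circ> inv' w) i) then sign (p \<circ> inv' w) * sign w else 0)"
    unfolding vacuum_def
  proof (intro sum.cong refl)
    fix p assume "p \<in> {p. p permutes {..<N}}"
    then have "sign p = sign (p \<circ> inv' w) * sign w"
      using w permutes_imp_permutation[of "{..<N}"]
      by (simp add: sign_compose sign_inverse permutation_inverse mult.assoc)
    then show "(if \<forall>i<N. (v \<circ> w) i = int (p i) then sign p else 0) =
      (if \<forall>i<N. v i = int ((p \<circ> inv' w) i) then sign (p \<circ> inv' w) * sign w else 0)"
      using eq[of p] by simp
  qed
  also have "\<dots> = (\<Sum>p | p permutes {..<N}.
      if \<forall>i<N. v i = int (p i) then sign p * sign w else 0)"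
    by (rule sum.reindex_bij_witness[of _ "\<lambda>p. p \<circ> w" "\<lambda>p. p \<circ> inv' w"])
       (use w in \<open>auto simp: permutes_inv permutes_compose comp_assoc permutes_inv_o\<close>)
  finally show "vacuum (v \<circ> w) = sign w * vacuum v"
    unfolding vacuum_def sum_distrib_left by (simp add: if_distrib mult.commute cong: if_cong)
qed

lemma alternating_frob_char: "alternating (frob_char \<nu>)"
  by (induction \<nu>) (auto intro: alternating_vacuum alternating_lower)

lemma vacuum_nonzeroD:
  assumes "vacuum v \<noteq> 0"
  obtains w where "w permutes {..<N}" "\<And>i. i < N \<Longrightarrow> v i = int (w i)"
proof -
  have "\<exists>w. w permutes {..<N} \<and> (\<forall>i<N. v i = int (w i))"
  proof (rule ccontr)
    assume "\<nexists>w. w permutes {..<N} \<and> (\<forall>i<N. v i = int (w i))"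
    then have "vacuum v = 0" unfolding vacuum_def by (intro sum.neutral) auto
    with assms show False by simp
  qed
  then show ?thesis using that by blast
qed

lemma vacuum_perm:
  assumes w: "w permutes {..<N}" and v: "\<And>i. i < N \<Longrightarrow> v i = int (w i)"
  shows "vacuum v = sign w"
proof -
  have "vacuum v = (\<Sum>p\<in>{w}. if \<forall>i<N. v i = int (p i) then sign p else 0)"
    unfolding vacuum_def
  proof (rule sum.mono_neutral_right)
    show "\<forall>p\<in>{w. w permutes {..<N}} - {w}. (if \<forall>i<N. v i = int (p i) then sign p else 0) = 0"
    proof safe
      fix p assume p: "p permutes {..<N}"
        "(if \<forall>i<N. v i = int (p i) then sign p else 0) \<noteq> 0"
      have "p x = w x" for x
      proof (cases "x < N")
        case True then show ?thesis using p v[of x] by (auto split: if_splits)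
      next
        case False then show ?thesis using p(1) w by (simp add: permutes_def)
      qed
      then show "p = w" by blast
    qed
  qed (use w in \<open>auto simp: finite_permutations\<close>)
  then show ?thesis using v by auto
qed

lemma sum_perm_int: "w permutes {..<N} \<Longrightarrow> (\<Sum>i<N. int (w i)) = degree0"
  unfolding degree0_def using sum.permute[of w "{..<N}" int] by (simp add: o_def)

lemma sum_add_at: "i < N \<Longrightarrow> (\<Sum>j<N. add_at i k v j) = (\<Sum>j<N. v j) + k"
  unfolding add_at_def
  by (simp add: sum.remove[of "{..<N}" i])

lemma vacuum_degree: "vacuum v \<noteq> 0 \<Longrightarrow> (\<Sum>i<N. v i) = degree0"
  by (elim vacuum_nonzeroD) (simp add: sum_perm_int)

lemma not_nonnegI: "j < N \<Longrightarrow> v j < 0 \<Longrightarrow> \<not> nonneg v"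
  by (auto simp: nonneg_def intro!: exI[of _ j])

lemma nonneg_add_at_neg:
  assumes "nonneg (add_at i (- int k) v)"
  shows "nonneg v"
  unfolding nonneg_def
proof safe
  fix j assume "j < N"
  then have "0 \<le> add_at i (- int k) v j" using assms by (simp add: nonneg_def)
  then show "0 \<le> v j" by (simp add: add_at_def split: if_splits)
qed

lemma frob_char_nonneg: "frob_char \<nu> v \<noteq> 0 \<Longrightarrow> nonneg v"
proof (induction \<nu> arbitrary: v)
  case empty
  then show ?case by (auto simp: nonneg_def elim!: vacuum_nonzeroD)
next
  case (add k \<nu>)
  then obtain i where "i < N" "frob_char \<nu> (add_at i (- int k) v) \<noteq> 0"
    by (auto simp: lower_def elim: sum.not_neutral_contains_not_neutral)
  with add.IH[of "add_at i (- int k) v"] show ?case by (auto dest: nonneg_add_at_neg)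
qed

lemma sum_nonneg_inj:
  assumes "nonneg v" "inj_on v {..<N}"
  shows "(\<Sum>i<N. v i) = int (\<Sum>((\<lambda>i. nat (v i)) ` {..<N}))" "card ((\<lambda>i. nat (v i)) ` {..<N}) = N"
proof -
  have inj: "inj_on (\<lambda>i. nat (v i)) {..<N}"
    using assms by (auto simp: inj_on_def nonneg_def eq_nat_nat_iff)
  then show "card ((\<lambda>i. nat (v i)) ` {..<N}) = N" by (simp add: card_image)
  show "(\<Sum>i<N. v i) = int (\<Sum>((\<lambda>i. nat (v i)) ` {..<N}))"
    using assms(1) by (simp add: sum.reindex[OF inj] nonneg_def)
qed

lemma degree0_le_sum:
  assumes "nonneg v" "inj_on v {..<N}"
  shows "degree0 \<le> (\<Sum>i<N. v i)"
proof -
  have "degree0 = int (\<Sum>{..<N})" by (simp add: degree0_def)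
  also have "\<dots> \<le> int (\<Sum>((\<lambda>i. nat (v i)) ` {..<N}))"
    using sum_card_le_sum[of "(\<lambda>i. nat (v i)) ` {..<N}"] sum_nonneg_inj(2)[OF assms]
    by (intro of_nat_mono) simp
  finally show ?thesis using sum_nonneg_inj(1)[OF assms] by simp
qed

text \<open>If z were missing, then z and the entries of v would be N + 1 distinct naturals, with
  sum at least 0 + ... + N.\<close>

lemma small_in_range:
  assumes "nonneg v" "inj_on v {..<N}" "0 \<le> z" "(\<Sum>i<N. v i) < degree0 + int N - z"
  shows "z \<in> v ` {..<N}"
proof (rule ccontr)
  let ?S = "(\<lambda>i. nat (v i)) ` {..<N}"
  assume z: "z \<notin> v ` {..<N}"
  have "nat z \<notin> ?S" using z assms(1,3) by (force simp: nonneg_def)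
  then have "\<Sum>{..<Suc N} \<le> nat z + \<Sum>?S"
    using sum_card_le_sum[of "insert (nat z) ?S"] sum_nonneg_inj(2)[OF assms(1,2)] by simp
  moreover have "int (\<Sum>{..<Suc N}) = degree0 + int N" by (simp add: degree0_def)
  ultimately have "degree0 + int N \<le> z + int (\<Sum>?S)" using assms(3) by linarith
  then show False using assms(4) sum_nonneg_inj(1)[OF assms(1,2)] by simp
qed

text \<open>The Heisenberg relation. It holds only in low degree, where \<open>v\<close> takes all the values
  below \<open>k\<close>.\<close>

lemma raise_lower:
  assumes u: "alternating u" "\<And>v. u v \<noteq> 0 \<Longrightarrow> nonneg v" and "h > 0" "k > 0"
    and deg: "(\<Sum>i<N. v i) \<le> degree0 + int N - int k"
  shows "raise (int k) (lower (int h) u) v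
       = lower (int h) (raise (int k) u) v + (if h = k then int k * u v else 0)"
proof (cases "nonneg v \<and> inj_on v {..<N}")
  case False
  have "raise (int k) (lower (int h) u) v = 0" "lower (int h) (raise (int k) u) v = 0" "u v = 0"
    if "\<not> inj_on v {..<N}"
    using that by (intro alternating_not_inj alternating_raise alternating_lower u(1); assumption)+
  moreover have "lower (int h) (raise (int k) u) v = 0" if "\<not> nonneg v"
    unfolding lower_def raise_def using that nonneg_add_at_neg by (intro sum.neutral) auto
  moreover have "u v = 0" "raise (int k) (lower (int h) u) v = 0" if "\<not> nonneg v"
    using that u(2) by (auto simp: raise_def)
  ultimately have "raise (int k) (lower (int h) u) v = 0" "lower (int h) (raise (int k) u) v = 0" "u v = 0"
    using False by argo+
  then show ?thesis by simp
next
  case True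
  have range: "z \<in> v ` {..<N}" if "0 \<le> z" "z < int k" for z
    using True deg that by (intro small_in_range) auto
  have nonneg_j: "nonneg (add_at j (- int h) v) \<longleftrightarrow> int h \<le> v j" if "j < N" for j
    using True that by (auto simp: nonneg_def add_at_def)
  \<comment> \<open>For \<open>v j < h\<close> entry j becomes negative unless the same entry is
    raised again, so only i = j survives. These j are exactly those which the cut-off removes from
    \<open>lower (raise u)\<close>; their terms make up the commutator.\<close>
  have diag: "(\<Sum>i<N. u (add_at i (int k) (add_at j (- int h) v))) = u (add_at j (int k - int h) v)"
    if "j < N" "v j < int h" for j
  proof -
    have "(\<Sum>i<N. u (add_at i (int k) (add_at j (- int h) v)))
        = (\<Sum>i\<in>{j}. u (add_at i (int k) (add_at j (- int h) v)))"
    proof (rule sum.mono_neutral_right)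
      show "\<forall>i\<in>{..<N} - {j}. u (add_at i (int k) (add_at j (- int h) v)) = 0"
      proof
        fix i assume "i \<in> {..<N} - {j}"
        then have "\<not> nonneg (add_at i (int k) (add_at j (- int h) v))"
          using that by (intro not_nonnegI[of j]) (auto simp: add_at_def)
        then show "u (add_at i (int k) (add_at j (- int h) v)) = 0" using u(2) by blast
      qed
    qed (use that in auto)
    then show ?thesis by (simp add: add_at_add)
  qed
  have "raise (int k) (lower (int h) u) v
      = (\<Sum>j<N. \<Sum>i<N. u (add_at i (int k) (add_at j (- int h) v)))"
  proof -
    have "raise (int k) (lower (int h) u) v
        = (\<Sum>i<N. \<Sum>j<N. u (add_at j (- int h) (add_at i (int k) v)))"
      using True by (simp add: raise_def lower_def)
    also have "\<dots> = (\<Sum>j<N. \<Sum>i<N. u (add_at j (- int h) (add_at i (int k) v)))"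
      by (rule sum.swap)
    finally show ?thesis by (simp only: add_at_commute[of _ "- int h" _ "int k"])
  qed
  also have "\<dots> = (\<Sum>j<N. raise (int k) u (add_at j (- int h) v)
        + (if v j < int h then u (add_at j (int k - int h) v) else 0))"
  proof (rule sum.cong[OF refl])
    fix j assume "j \<in> {..<N}"
    then have j: "j < N" by simp
    show "(\<Sum>i<N. u (add_at i (int k) (add_at j (- int h) v)))
        = raise (int k) u (add_at j (- int h) v) + (if v j < int h then u (add_at j (int k - int h) v) else 0)"
    proof (cases "v j < int h")
      case True
      then show ?thesis using diag[OF j] nonneg_j[OF j] by (simp add: raise_def)
    next
      case False
      then show ?thesis using nonneg_j[OF j] by (simp add: raise_def lower_def)
    qed
  qed
  also have "\<dots> = lower (int h) (raise (int k) u) v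
        + (\<Sum>j<N. if v j < int h then u (add_at j (int k - int h) v) else 0)"
    by (simp add: sum.distrib lower_def)
  also have "(\<Sum>j<N. if v j < int h then u (add_at j (int k - int h) v) else 0)
       = (if h = k then int k * u v else 0)"
  proof (cases "h = k")
    case eq: True
    \<comment> \<open>Each surviving term is \<open>u v\<close>, and there are k of them because v
      takes each of the values 0, ..., k - 1 exactly once.\<close>
    have "v ` {j\<in>{..<N}. v j < int k} = {0..<int k}"
    proof (intro equalityI subsetI)
      fix z assume z: "z \<in> {0..<int k}"
      then obtain i where "i < N" "z = v i" using range[of z] by auto
      then show "z \<in> v ` {j\<in>{..<N}. v j < int k}" using z by auto
    qed (use True in \<open>auto simp: nonneg_def\<close>)
    moreover have "inj_on v {j\<in>{..<N}. v j < int k}"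
      using True by (auto intro: inj_on_subset)
    ultimately have "card {j\<in>{..<N}. v j < int k} = k"
      using card_image[of v "{j\<in>{..<N}. v j < int k}"] by simp
    then show ?thesis using eq
      by (simp add: add_at_def sum.If_cases Int_def)
  next
    case False
    \<comment> \<open>The new entry lies below k, so it is negative or equal to another entry of v;
      in both cases u vanishes there.\<close>
    have "(if v j < int h then u (add_at j (int k - int h) v) else 0) = 0" if j: "j < N" for j
    proof (cases "v j < int h \<and> 0 \<le> v j + (int k - int h)")
      case c: True
      then obtain i where i: "i < N" "v i = v j + (int k - int h)"
        using range[of "v j + (int k - int h)"] by auto
      then have "\<not> inj_on (add_at j (int k - int h) v) {..<N}"
        using False j inj_onD[of "add_at j (int k - int h) v" "{..<N}" i j]
        by (cases "i = j") (auto simp: add_at_def)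
      then show ?thesis using alternating_not_inj[OF u(1)] by simp
    next
      case c: False
      then have "\<not> nonneg (add_at j (int k - int h) v)" if "v j < int h"
        using that j by (intro not_nonnegI[of j]) (auto simp: add_at_def)
      then show ?thesis using u(2) by auto
    qed
    then show ?thesis using False by simp
  qed
  finally show ?thesis .
qed

section \<open>Scalar products of Frobenius characters\<close>

definition configs :: "nat \<Rightarrow> (nat \<Rightarrow> int) set" where
  "configs m = {v. (\<forall>i\<ge>N. v i = 0) \<and> nonneg v \<and> (\<Sum>i<N. v i) = degree0 + int m}"

text \<open>For \<mu> and \<nu> of size m at most N this is N! times the Hall scalar product of the
  power sums p_\<mu> and p_\<nu>.\<close>

definition gram :: "nat \<Rightarrow> nat multiset \<Rightarrow> nat multiset \<Rightarrow> int" where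
  "gram m \<mu> \<nu> = (\<Sum>v\<in>configs m. frob_char \<mu> v * frob_char \<nu> v)"

lemma finite_configs: "finite (configs m)"
proof (rule finite_subset)
  show "configs m \<subseteq> {v. \<forall>i. (i \<in> {..<N} \<longrightarrow> v i \<in> {0..degree0 + int m}) \<and> (i \<notin> {..<N} \<longrightarrow> v i = 0)}"
  proof
    fix v assume v: "v \<in> configs m"
    have "v i \<le> degree0 + int m" if "i < N" for i
      using member_le_sum[of i "{..<N}" v] v that by (auto simp: configs_def nonneg_def)
    then show "v \<in> {v. \<forall>i. (i \<in> {..<N} \<longrightarrow> v i \<in> {0..degree0 + int m}) \<and> (i \<notin> {..<N} \<longrightarrow> v i = 0)}"
      using v by (auto simp: configs_def nonneg_def)
  qed
qed (intro finite_set_of_finite_funs; simp)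

text \<open>For each i substitute v + k e_i for v. The vectors of \<open>configs (m + k)\<close>
  missed by this shift contribute nothing, since u vanishes off the nonnegative vectors.\<close>

lemma lower_adjoint:
  assumes u: "\<And>v. u v \<noteq> 0 \<Longrightarrow> nonneg v"
  shows "(\<Sum>v\<in>configs (m + k). lower (int k) u v * u' v)
       = (\<Sum>v\<in>configs m. u v * raise (int k) u' v)"
proof -
  have "(\<Sum>v\<in>configs (m + k). u (add_at i (- int k) v) * u' v)
      = (\<Sum>v\<in>configs m. u v * u' (add_at i (int k) v))" if i: "i < N" for i
  proof (rule sum.reindex_bij_witness_not_neutral[of
      "{v\<in>configs (m + k). \<not> nonneg (add_at i (- int k) v)}" "{}" _ "add_at i (int k)" "add_at i (- int k)"])
    show "finite {v\<in>configs (m + k). \<not> nonneg (add_at i (- int k) v)}"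
      by (simp add: finite_configs)
    show "add_at i (- int k) v \<in> configs m - {}"
      if "v \<in> configs (m + k) - {v\<in>configs (m + k). \<not> nonneg (add_at i (- int k) v)}" for v
      using that i sum_add_at[OF i, of "- int k" v] by (auto simp: configs_def add_at_def)
    show "add_at i (int k) v \<in> configs (m + k) - {v\<in>configs (m + k). \<not> nonneg (add_at i (- int k) v)}"
      if "v \<in> configs m - {}" for v
    proof -
      have "add_at i (- int k) (add_at i (int k) v) = v" by (simp add: add_at_def)
      then show ?thesis
        using that i sum_add_at[OF i, of "int k" v]
        by (auto simp: configs_def) (auto simp: nonneg_def add_at_def)
    qed
  qed (use u in \<open>auto simp: add_at_def\<close>)
  then have "(\<Sum>i<N. \<Sum>v\<in>configs (m + k). u (add_at i (- int k) v) * u' v)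
      = (\<Sum>i<N. \<Sum>v\<in>configs m. u v * u' (add_at i (int k) v))"
    by simp
  moreover have "raise (int k) u' v = (\<Sum>i<N. u' (add_at i (int k) v))" if "v \<in> configs m" for v
    using that by (simp add: raise_def lower_def configs_def)
  ultimately show ?thesis
    by (simp add: lower_def sum_distrib_left sum_distrib_right sum.swap[of _ "{..<N}"])
qed

text \<open>A nonzero value would make v an injective nonnegative vector of degree
  \<open>degree0 - k\<close>, below the minimum.\<close>

lemma raise_vacuum:
  assumes "k > 0" shows "raise (int k) vacuum v = 0"
proof (rule ccontr)
  assume nz: "raise (int k) vacuum v \<noteq> 0"
  then have v: "nonneg v" "inj_on v {..<N}"
    using alternating_not_inj[OF alternating_raise[OF alternating_vacuum], of v "int k"]
    by (auto simp: raise_def split: if_splits)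
  from nz v obtain i where "i < N" "vacuum (add_at i (int k) v) \<noteq> 0"
    by (auto simp: raise_def lower_def elim: sum.not_neutral_contains_not_neutral)
  then show False
    using vacuum_degree[of "add_at i (int k) v"] degree0_le_sum[OF v] assms by (simp add: sum_add_at)
qed

text \<open>By the Heisenberg relation the adjoint of p_k acts as the derivation k d/dp_k, and it
  kills the vacuum.\<close>

lemma raise_frob_char:
  assumes "k > 0" "0 \<notin># \<nu>" "(\<Sum>i<N. v i) \<le> degree0 + int N - int k"
  shows "raise (int k) (frob_char \<nu>) v = int k * int (count \<nu> k) * frob_char (\<nu> - {#k#}) v"
  using assms(2,3)
proof (induction \<nu> arbitrary: v)
  case empty
  then show ?case using assms(1) by (simp add: raise_vacuum)
next
  case (add h \<nu>)
  have "raise (int k) (frob_char (add_mset h \<nu>)) v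
      = lower (int h) (raise (int k) (frob_char \<nu>)) v + (if h = k then int k * frob_char \<nu> v else 0)"
    using add.prems assms(1) unfolding frob_char_add
    by (intro raise_lower alternating_frob_char frob_char_nonneg) auto
  also have "lower (int h) (raise (int k) (frob_char \<nu>)) v
      = (\<Sum>i<N. int k * int (count \<nu> k) * frob_char (\<nu> - {#k#}) (add_at i (- int h) v))"
    unfolding lower_def
  proof (intro sum.cong refl add.IH)
    fix i assume "i \<in> {..<N}"
    then show "sum (add_at i (- int h) v) {..<N} \<le> degree0 + int N - int k"
      using add.prems(2) sum_add_at[of i "- int h" v] by simp
  qed (use add.prems in auto)
  also have "\<dots> = int k * int (count \<nu> k) * frob_char (add_mset h (\<nu> - {#k#})) v"
    by (simp add: lower_def sum_distrib_left)
  finally have eq: "raise (int k) (frob_char (add_mset h \<nu>)) v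
      = int k * int (count \<nu> k) * frob_char (add_mset h (\<nu> - {#k#})) v
        + (if h = k then int k * frob_char \<nu> v else 0)" .
  show ?case
  proof (cases "h = k")
    case True
    then show ?thesis
      using eq by (cases "k \<in># \<nu>") (auto simp: algebra_simps not_in_iff simp del: frob_char_add)
  qed (use eq in \<open>simp add: diff_add_mset_swap\<close>)
qed

text \<open>Move the factor p_k to the other side by adjointness. The bound
  \<open>m + k \<le> N\<close> keeps the degree in the range of the Heisenberg relation.\<close>

lemma gram_add:
  assumes "k > 0" "0 \<notin># \<nu>" "m + k \<le> N"
  shows "gram (m + k) (add_mset k \<mu>) \<nu> = int k * int (count \<nu> k) * gram m \<mu> (\<nu> - {#k#})"
proof -
  have "gram (m + k) (add_mset k \<mu>) \<nu> = (\<Sum>v\<in>configs m. frob_char \<mu> v * raise (int k) (frob_char \<nu>) v)"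
    unfolding gram_def frob_char_add by (rule lower_adjoint) (rule frob_char_nonneg)
  also have "\<dots> = (\<Sum>v\<in>configs m. int k * int (count \<nu> k) * (frob_char \<mu> v * frob_char (\<nu> - {#k#}) v))"
    using assms by (intro sum.cong refl) (auto simp: raise_frob_char configs_def)
  finally show ?thesis by (simp add: gram_def sum_distrib_left)
qed

text \<open>The vacuum is a sign on each of the N! arrangements of 0, ..., N - 1 and zero on the
  other vectors.\<close>

lemma gram_empty: "gram 0 {#} {#} = fact N"
proof -
  define to_v :: "(nat \<Rightarrow> nat) \<Rightarrow> nat \<Rightarrow> int" where "to_v w = (\<lambda>i. if i < N then int (w i) else 0)" for w
  define to_w :: "(nat \<Rightarrow> int) \<Rightarrow> nat \<Rightarrow> nat" where "to_w v = (\<lambda>i. if i < N then nat (v i) else i)" for v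
  have to_v: "vacuum (to_v w) = sign w" "to_v w \<in> configs 0" "to_w (to_v w) = w"
    if w: "w permutes {..<N}" for w
  proof -
    show "vacuum (to_v w) = sign w" by (rule vacuum_perm[OF w]) (simp add: to_v_def)
    show "to_v w \<in> configs 0"
      using w sum_perm_int[of w] by (auto simp: configs_def nonneg_def to_v_def)
    show "to_w (to_v w) = w"
      using w by (auto simp: fun_eq_iff permutes_def to_v_def to_w_def)
  qed
  have to_w: "to_w v permutes {..<N}" "to_v (to_w v) = v"
    if v: "v \<in> configs 0" "vacuum v \<noteq> 0" for v
  proof -
    obtain w where w: "w permutes {..<N}" "\<And>i. i < N \<Longrightarrow> v i = int (w i)"
      using vacuum_nonzeroD[OF v(2)] by blast
    then have "to_w v = w" by (auto simp: fun_eq_iff permutes_def to_w_def)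
    then show "to_w v permutes {..<N}" using w by simp
    show "to_v (to_w v) = v"
      using v(1) w by (auto simp: fun_eq_iff configs_def to_v_def to_w_def)
  qed
  have "(\<Sum>w | w permutes {..<N}. 1 :: int) = (\<Sum>v\<in>configs 0. vacuum v * vacuum v)"
    by (rule sum.reindex_bij_witness_not_neutral[of "{}" "{v\<in>configs 0. vacuum v = 0}" _ to_w to_v])
       (use to_v to_w in \<open>auto simp: finite_configs sign_idempotent\<close>)
  then show ?thesis by (simp add: gram_def card_permutations)
qed

text \<open>The trace of a Jucys--Murphy element: the diagonal operator of contents has first commutator
  \<open>\<Sum>\<^sub>i (v\<^sub>i - N) u (v - e\<^sub>i)\<close> and second commutator \<open>lower 2\<close> with \<open>lower 1\<close>.\<close>

lemma weighted_lower:
  "(\<Sum>i<N. (v i - c) * lower 1 u (add_at i (-1) v))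
   = lower 1 (\<lambda>v. \<Sum>i<N. (v i - c) * u (add_at i (-1) v)) v + lower 2 u v"
proof -
  have "(\<Sum>i<N. (add_at j (-1) v i - c) * u (add_at i (-1) (add_at j (-1) v)))
      = (\<Sum>i<N. (v i - c) * u (add_at i (-1) (add_at j (-1) v))) - u (add_at j (-2) v)"
    if "j < N" for j
    using that by (simp add: sum.remove[of "{..<N}" j] add_at_add algebra_simps)
       (simp add: add_at_def algebra_simps)
  then have "lower 1 (\<lambda>v. \<Sum>i<N. (v i - c) * u (add_at i (-1) v)) v
      = (\<Sum>j<N. \<Sum>i<N. (v i - c) * u (add_at i (-1) (add_at j (-1) v))) - lower 2 u v"
    by (simp add: lower_def sum_subtractf)
  moreover have "(\<Sum>i<N. (v i - c) * lower 1 u (add_at i (-1) v))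
      = (\<Sum>j<N. \<Sum>i<N. (v i - c) * u (add_at i (-1) (add_at j (-1) v)))"
  proof -
    have "(\<Sum>i<N. (v i - c) * lower 1 u (add_at i (-1) v))
        = (\<Sum>i<N. \<Sum>j<N. (v i - c) * u (add_at j (-1) (add_at i (-1) v)))"
      by (simp add: lower_def sum_distrib_left)
    also have "\<dots> = (\<Sum>i<N. \<Sum>j<N. (v i - c) * u (add_at i (-1) (add_at j (-1) v)))"
      by (intro sum.cong refl arg_cong2[where f = "(*)"] arg_cong[where f = u] add_at_commute)
    also have "\<dots> = (\<Sum>j<N. \<Sum>i<N. (v i - c) * u (add_at i (-1) (add_at j (-1) v)))"
      by (rule sum.swap)
    finally show ?thesis .
  qed
  ultimately show ?thesis by simp
qed

text \<open>Increasing one entry of an arrangement of 0, ..., N - 1 creates either a repetition or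
  the entry N. The weight is chosen to vanish at N.\<close>

lemma weighted_vacuum: "(\<Sum>i<N. (v i - int N) * vacuum (add_at i (-1) v)) = 0"
proof (cases "inj_on v {..<N}")
  case False
  then show ?thesis
    using alternating_not_inj[OF alternating_weighted[OF alternating_vacuum, of "\<lambda>x. x - int N" "-1"]]
    by simp
next
  case True
  have "(v i - int N) * vacuum (add_at i (-1) v) = 0" if i: "i < N" for i
  proof (rule ccontr)
    assume nz: "(v i - int N) * vacuum (add_at i (-1) v) \<noteq> 0"
    then obtain w where w: "w permutes {..<N}" "\<And>j. j < N \<Longrightarrow> add_at i (-1) v j = int (w j)"
      by (auto elim: vacuum_nonzeroD)
    have vi: "v i = int (Suc (w i))" using w(2)[OF i] by (simp add: add_at_def)
    have "Suc (w i) < N"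
      using nz vi permutes_in_image[OF w(1), of i] i by (cases "Suc (w i) = N") auto
    then obtain j where j: "j < N" "w j = Suc (w i)"
      using permutes_image[OF w(1)] by (metis imageE lessThan_iff)
    then have "j \<noteq> i" by auto
    then have "v j = v i" using w(2)[OF j(1)] j vi by (simp add: add_at_def)
    then show False using True i j \<open>j \<noteq> i\<close> by (auto dest: inj_onD)
  qed
  then show ?thesis by (intro sum.neutral) auto
qed

definition ones_char :: "nat \<Rightarrow> (nat \<Rightarrow> int) \<Rightarrow> int" where
  "ones_char m = frob_char (replicate_mset m 1)"

lemma ones_char_0: "ones_char 0 = vacuum"
  and ones_char_Suc: "ones_char (Suc m) = lower 1 (ones_char m)"
  by (simp_all add: ones_char_def)

lemma lower_scale: "lower k (\<lambda>v. c * u v) v = c * lower k u v"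
  by (simp add: lower_def sum_distrib_left)

text \<open>Commuting the weighted operator past m factors p_1 leaves one p_2 for each of them,
  until the vacuum is reached. For m = 0 the truncated \<open>m - 1\<close> is harmless because of
  the factor m.\<close>

lemma weighted_ones:
  "(\<Sum>i<N. (v i - int N) * ones_char m (add_at i (-1) v)) = int m * lower 2 (ones_char (m - 1)) v"
proof (induction m arbitrary: v)
  case 0
  then show ?case by (simp add: weighted_vacuum ones_char_0)
next
  case (Suc m)
  have "(\<Sum>i<N. (v i - int N) * ones_char (Suc m) (add_at i (-1) v))
      = int m * lower 1 (lower 2 (ones_char (m - 1))) v + lower 2 (ones_char m) v"
    unfolding ones_char_Suc weighted_lower Suc.IH lower_scale ..
  also have "int m * lower 1 (lower 2 (ones_char (m - 1))) v = int m * lower 2 (ones_char m) v"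
    by (cases m) (simp_all add: ones_char_Suc lower_commute[of 1 2])
  finally show ?case by (simp add: algebra_simps)
qed

text \<open>Twice the content sum of the partition with beads v, normalised to 0 at the vacuum.
  Moving a bead from x - 1 to x adds a box of content x - N, and x(x+1) - 2Nx increases by 2(x -
  N).\<close>

definition content2 :: "(nat \<Rightarrow> int) \<Rightarrow> int" where
  "content2 v = (\<Sum>i<N. v i * (v i + 1) - 2 * int N * v i) - (\<Sum>i<N. int i * (int i + 1) - 2 * int N * int i)"

lemma content2_add_at:
  "i < N \<Longrightarrow> content2 (add_at i (-1) v) = content2 v - 2 * (v i - int N)"
  by (simp add: content2_def sum.remove[of "{..<N}" i]) (simp add: add_at_def algebra_simps)

lemma content2_vacuum: "content2 v * vacuum v = 0"
proof (cases "vacuum v = 0")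
  case False
  then obtain w where w: "w permutes {..<N}" "\<And>i. i < N \<Longrightarrow> v i = int (w i)"
    by (auto elim: vacuum_nonzeroD)
  have "(\<Sum>i<N. v i * (v i + 1) - 2 * int N * v i)
      = (\<Sum>i<N. int (w i) * (int (w i) + 1) - 2 * int N * int (w i))"
    using w by simp
  also have "\<dots> = (\<Sum>i<N. int i * (int i + 1) - 2 * int N * int i)"
    using sum.permute[OF w(1), of "\<lambda>i. int i * (int i + 1) - 2 * int N * int i"] by (simp add: o_def)
  finally show ?thesis by (simp add: content2_def)
qed simp

text \<open>The sum of all transpositions acts on an irreducible module by the content sum.
  Inductively, the commutator of \<open>content2\<close> with p_1 is twice the weighted operator,
  and m(m-1) + 2m = (m+1)m.\<close>

lemma content2_ones:
  "content2 v * ones_char m v = int m * (int m - 1) * lower 2 (ones_char (m - 2)) v"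
proof (induction m arbitrary: v)
  case 0
  then show ?case by (simp add: content2_vacuum ones_char_0)
next
  case (Suc m)
  have "content2 v * ones_char (Suc m) v = (\<Sum>i<N. content2 v * ones_char m (add_at i (-1) v))"
    by (simp add: ones_char_Suc lower_def sum_distrib_left)
  also have "\<dots> = (\<Sum>i<N. content2 (add_at i (-1) v) * ones_char m (add_at i (-1) v)
       + 2 * ((v i - int N) * ones_char m (add_at i (-1) v)))"
    by (intro sum.cong refl) (simp add: content2_add_at algebra_simps)
  also have "\<dots> = int m * (int m - 1) * lower 1 (lower 2 (ones_char (m - 2))) v
      + 2 * (\<Sum>i<N. (v i - int N) * ones_char m (add_at i (-1) v))"
    unfolding Suc.IH sum.distrib by (simp add: lower_def[of 1] sum_distrib_left)
  also have "int m * (int m - 1) * lower 1 (lower 2 (ones_char (m - 2))) v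
      = int m * (int m - 1) * lower 2 (ones_char (m - 1)) v"
  proof (cases "m \<le> 1")
    case False
    then have "m - 1 = Suc (m - 2)" by simp
    then show ?thesis by (simp only: ones_char_Suc lower_commute[of 1 2])
  qed (auto simp: le_Suc_eq)
  finally show ?case unfolding weighted_ones by (simp add: algebra_simps)
qed

text \<open>The value counts standard Young tableaux: every nonzero term removes one box and leaves
  an increasing vector, so no cancellation occurs. It remains to find one removable box.\<close>

lemma ones_char_pos:
  assumes "strict_mono_on {..<N} v" "nonneg v" "(\<Sum>i<N. v i) = degree0 + int m"
  shows "ones_char m v > 0"
  using assms
proof (induction m arbitrary: v)
  case (0 v)
  have ge: "int i \<le> v i" if "i < N" for i
    using that
  proof (induction i)
    case (Suc i)
    then have "v i < v (Suc i)" using 0 by (auto intro: strict_mono_onD)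
    then show ?case using Suc by simp
  qed (use 0 in \<open>auto simp: nonneg_def\<close>)
  have "v i = int i" if "i < N" for i
    using sum_mono_inv[of int "{..<N}" v i] 0 ge that by (simp add: degree0_def)
  then have "vacuum v = 1" using vacuum_perm[of id v] by (simp add: permutes_id)
  then show ?case by (simp add: ones_char_0)
next
  case (Suc m v)
  have pos: "ones_char m (add_at i (-1) v) > 0" if i: "i < N" and v': "inj_on (add_at i (-1) v) {..<N}" "nonneg (add_at i (-1) v)" for i
  proof (rule Suc.IH)
    show "strict_mono_on {..<N} (add_at i (-1) v)"
    proof (rule strict_mono_onI)
      fix a b assume ab: "a \<in> {..<N}" "b \<in> {..<N}" "a < b"
      then have "v a < v b" using Suc.prems(1) by (auto intro: strict_mono_onD)
      moreover have "add_at i (-1) v a \<noteq> add_at i (-1) v b" using v'(1) ab by (auto dest: inj_onD)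
      ultimately show "add_at i (-1) v a < add_at i (-1) v b"
        using ab(3) by (auto simp: add_at_def split: if_splits)
    qed
  qed (use Suc.prems i v' in \<open>auto simp: sum_add_at\<close>)
  have nn: "0 \<le> ones_char m (add_at i (-1) v)" if "i < N" for i
  proof (cases "ones_char m (add_at i (-1) v) = 0")
    case False
    then have "nonneg (add_at i (-1) v)" "inj_on (add_at i (-1) v) {..<N}"
      using frob_char_nonneg[of "replicate_mset m 1" "add_at i (-1) v"]
        alternating_not_inj[OF alternating_frob_char[of "replicate_mset m 1"], of "add_at i (-1) v"]
      by (auto simp: ones_char_def)
    then show ?thesis using pos[OF that] by simp
  qed simp
  have "\<exists>i<N. v i \<noteq> int i"
  proof (rule ccontr)
    assume "\<not> ?thesis"
    then have "(\<Sum>i<N. v i) = degree0" by (simp add: degree0_def)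
    then show False using Suc.prems(3) by simp
  qed
  \<comment> \<open>The first bead out of its ground position lies above that position, so the place
    just below it is free.\<close>
  then obtain i where i: "i < N" "v i \<noteq> int i" and least: "\<forall>j<i. \<not> (j < N \<and> v j \<noteq> int j)"
    using exists_least_iff[of "\<lambda>i. i < N \<and> v i \<noteq> int i"] by auto
  have below: "v j = int j" if "j < i" for j using least i(1) that by auto
  have "int i < v i"
  proof (cases i)
    case (Suc j)
    then have "v j < v i" using Suc.prems(1) i(1) by (auto intro: strict_mono_onD)
    then show ?thesis using below[of j] i(2) Suc by simp
  next
    case 0
    then have "0 \<le> v i" using i(1) Suc.prems(2) by (simp add: nonneg_def)
    then show ?thesis using 0 i(2) by simp
  qed
  have "strict_mono_on {..<N} (add_at i (-1) v)"
  proof (rule strict_mono_onI)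
    fix a b assume ab: "a \<in> {..<N}" "b \<in> {..<N}" "a < b"
    then have "v a < v b" using Suc.prems(1) by (auto intro: strict_mono_onD)
    then show "add_at i (-1) v a < add_at i (-1) v b"
      using ab(3) below[of a] \<open>int i < v i\<close> by (auto simp: add_at_def)
  qed
  then have "inj_on (add_at i (-1) v) {..<N}" by (rule strict_mono_on_imp_inj_on)
  moreover have "nonneg (add_at i (-1) v)"
    using Suc.prems(2) \<open>int i < v i\<close> by (auto simp: nonneg_def add_at_def)
  ultimately have "0 < ones_char m (add_at i (-1) v)" using pos i by blast
  also have "\<dots> \<le> (\<Sum>i<N. ones_char m (add_at i (-1) v))"
    using nn i(1) by (intro member_le_sum) auto
  finally show ?case by (simp add: ones_char_Suc lower_def)
qed

lemma ex_perm_strict_mono: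
  assumes "inj_on v {..<N}" "nonneg v"
  obtains w where "w permutes {..<N}" "strict_mono_on {..<N} (v \<circ> w)"
proof -
  let ?V = "\<lambda>i. nat (v i)"
  have inj: "inj_on ?V {..<N}" using assms by (auto simp: inj_on_def nonneg_def eq_nat_nat_iff)
  then obtain h where h: "bij_betw h {..<N} (?V ` {..<N})" "strict_mono_on {..<N} h"
    using ex_bij_betw_strict_mono_card[of "?V ` {..<N}"] by (auto simp: card_image)
  define w where "w i = (if i < N then inv_into {..<N} ?V (h i) else i)" for i
  have "bij_betw (inv_into {..<N} ?V \<circ> h) {..<N} {..<N}"
    using h(1) inj by (intro bij_betw_trans[OF h(1)] bij_betw_inv_into) (simp add: inj_on_imp_bij_betw)
  then have "bij_betw w {..<N} {..<N}" by (rule bij_betw_cong[THEN iffD1, rotated]) (simp add: w_def)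
  then have w: "w permutes {..<N}" by (rule bij_imp_permutes) (simp add: w_def)
  have "h i = ?V (w i)" if "i < N" for i
    using that bij_betwE[OF h(1)] f_inv_into_f[of "h i" ?V "{..<N}"] by (simp add: w_def)
  moreover have "0 \<le> v (w i)" if "i < N" for i
    using assms(2) permutes_in_image[OF w, of i] that by (simp add: nonneg_def)
  ultimately have "v (w i) = int (h i)" if "i < N" for i using that by simp
  then have "strict_mono_on {..<N} (v \<circ> w)"
    using h(2) by (auto simp: monotone_on_def)
  with w show ?thesis by (rule that)
qed

lemma ones_char_nonzero:
  assumes "inj_on v {..<N}" "nonneg v" "(\<Sum>i<N. v i) = degree0 + int m"
  shows "ones_char m v \<noteq> 0"
proof -
  obtain w where w: "w permutes {..<N}" "strict_mono_on {..<N} (v \<circ> w)"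
    using ex_perm_strict_mono[OF assms(1,2)] by blast
  have "ones_char m (v \<circ> w) > 0"
    using w assms sum.permute[OF w(1), of v] by (intro ones_char_pos) (auto simp: nonneg_perm)
  then show ?thesis
    using alternating_perm[OF alternating_frob_char w(1)] by (auto simp: ones_char_def)
qed

text \<open>The combinatorial core of the Murnaghan-Nakayama rule: a bead can move down neither
  below 0 nor onto another bead.\<close>

lemma lower_only:
  assumes u: "alternating u" "\<And>v. u v \<noteq> 0 \<Longrightarrow> nonneg v" and "J \<subseteq> {..<N}"
    and blocked: "\<And>j. j < N \<Longrightarrow> j \<notin> J \<Longrightarrow> v j < k \<or> (\<exists>i<N. i \<noteq> j \<and> v i = v j - k)"
  shows "lower k u v = (\<Sum>j\<in>J. u (add_at j (-k) v))"
  unfolding lower_def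
proof (rule sum.mono_neutral_right)
  show "\<forall>j\<in>{..<N} - J. u (add_at j (-k) v) = 0"
  proof
    fix j assume j: "j \<in> {..<N} - J"
    then consider "v j < k" | i where "i < N" "i \<noteq> j" "v i = v j - k" using blocked[of j] by auto
    then show "u (add_at j (-k) v) = 0"
    proof cases
      case 1
      then have "\<not> nonneg (add_at j (-k) v)" using j by (intro not_nonnegI[of j]) (auto simp: add_at_def)
      then show ?thesis using u(2) by blast
    next
      case 2
      then have "\<not> inj_on (add_at j (-k) v) {..<N}"
        using j inj_onD[of "add_at j (-k) v" "{..<N}" i j] by (auto simp: add_at_def)
      then show ?thesis by (rule alternating_not_inj[OF u(1)])
    qed
  qed
qed (use assms in auto)

end

section \<open>Conjugacy and cycle types\<close>

text \<open>Cycle type relative to a subset, so that single orbits can be split off in inductions;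
  on {1..n} it agrees with \<open>cycle_type n\<close>.\<close>

definition orbit_type :: "('a \<Rightarrow> 'a) \<Rightarrow> 'a set \<Rightarrow> nat multiset" where
  "orbit_type p A = image_mset card (mset_set (orbit p ` A))"

definition stable :: "('a \<Rightarrow> 'a) \<Rightarrow> 'a set \<Rightarrow> bool" where
  "stable p A \<longleftrightarrow> permutation p \<and> finite A \<and> p ` A \<subseteq> A"

lemma stable_orbit:
  assumes "stable p A" "a \<in> A"
  shows "orbit p a \<subseteq> A" "a \<in> orbit p a" "stable p (A - orbit p a)" "finite (orbit p a)"
    "card (orbit p a) > 0" "stable p (orbit p a)"
proof -
  have p: "permutation p" "finite A" "p ` A \<subseteq> A" using assms by (auto simp: stable_def)
  show sub: "orbit p a \<subseteq> A"
  proof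
    fix z assume "z \<in> orbit p a"
    then show "z \<in> A" by induction (use p assms in auto)
  qed
  show self: "a \<in> orbit p a" by (rule permutation_self_in_orbit[OF p(1)])
  show "finite (orbit p a)" using sub p(2) finite_subset by blast
  then show "card (orbit p a) > 0" using self by (auto simp: card_gt_0_iff)
  have step: "p z \<in> orbit p a \<longleftrightarrow> z \<in> orbit p a" for z
  proof
    assume "p z \<in> orbit p a"
    moreover have "z \<in> orbit p (p z)"
      using permutation_self_in_orbit[OF p(1), of z] permutation_orbit_step[OF p(1)] by simp
    ultimately show "z \<in> orbit p a" by (rule orbit_trans[rotated])
  qed (rule orbit.step)
  then show "stable p (A - orbit p a)" using p by (auto simp: stable_def)
  show "stable p (orbit p a)" using p step sub finite_subset[OF sub] by (auto simp: stable_def)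
qed

lemma orbit_eq:
  assumes "permutation p" "b \<in> orbit p a"
  shows "orbit p b = orbit p a"
  using orbit_cyclic_eq3[OF cyclic_on_orbit'[OF assms(1)] assms(2)] .

lemma orbit_type_remove:
  assumes "stable p A" "a \<in> A"
  shows "orbit_type p A = add_mset (card (orbit p a)) (orbit_type p (A - orbit p a))"
proof -
  have p: "permutation p" "finite A" using assms by (auto simp: stable_def)
  have "orbit p ` A = insert (orbit p a) (orbit p ` (A - orbit p a))"
    using assms(2) orbit_eq[OF p(1)] by auto
  moreover have "orbit p a \<notin> orbit p ` (A - orbit p a)"
    using permutation_self_in_orbit[OF p(1)] by auto
  ultimately show ?thesis using p by (simp add: orbit_type_def)
qed

lemma zero_notin_orbit_type: "stable p A \<Longrightarrow> 0 \<notin># orbit_type p A"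
  using stable_orbit(5)[of p A] by (force simp: orbit_type_def stable_def)

lemma stable_induct [consumes 1, case_names empty orbit]:
  assumes "stable p A"
    and "P {}"
    and "\<And>A a. stable p A \<Longrightarrow> a \<in> A \<Longrightarrow> P (A - orbit p a) \<Longrightarrow> P A"
  shows "P A"
  using assms(1)
proof (induction "card A" arbitrary: A rule: less_induct)
  case less
  show ?case
  proof (cases "A = {}")
    case False
    then obtain a where a: "a \<in> A" by blast
    have "card (A - orbit p a) < card A"
      using less.prems a stable_orbit(2)[OF less.prems a]
      by (intro psubset_card_mono) (auto simp: stable_def)
    then show ?thesis
      using less.hyps stable_orbit(3)[OF less.prems a] assms(3)[OF less.prems a] by blast
  qed (use assms(2) in simp)
qed

text \<open>Identifies the factor in \<open>gram_add\<close> with the number of possible images of a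
  point that lies on a k-cycle.\<close>

lemma card_orbit_size:
  assumes "stable p A"
  shows "card {a\<in>A. card (orbit p a) = k} = k * count (orbit_type p A) k"
  using assms
proof (induction rule: stable_induct)
  case (orbit A a)
  note sub = stable_orbit[OF orbit(1,2)]
  have p: "permutation p" "finite A" using orbit by (auto simp: stable_def)
  have "{z\<in>A. card (orbit p z) = k} = {z\<in>A - orbit p a. card (orbit p z) = k}
      \<union> (if card (orbit p a) = k then orbit p a else {})"
    using orbit_eq[OF p(1)] sub(1) by auto
  then have "card {z\<in>A. card (orbit p z) = k} = card {z\<in>A - orbit p a. card (orbit p z) = k}
      + card (if card (orbit p a) = k then orbit p a else {})"
    using p sub(4) by (simp add: card_Un_disjoint) (subst card_Un_disjoint; auto)
  then show ?case using orbit by (simp add: orbit_type_remove)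
qed (simp add: orbit_type_def)

text \<open>Send p^i a to q^i b; since the cycles have equal length, the two enumerations close up
  at the same time.\<close>

lemma orbit_iso:
  assumes "stable p A" "a \<in> A" "stable q B" "b \<in> B" "card (orbit p a) = card (orbit q b)"
  obtains e where "bij_betw e (orbit p a) (orbit q b)" "e a = b" "\<And>z. z \<in> orbit p a \<Longrightarrow> e (p z) = q (e z)"
proof -
  let ?k = "card (orbit p a)"
  have *: "bij_betw (\<lambda>i. (r ^^ i) c) {..<card (orbit r c)} (orbit r c)" "(r ^^ card (orbit r c)) c = c"
    if "c \<in> orbit r c" for r and c :: 'c
  proof -
    have "inj_on (\<lambda>i. (r ^^ i) c) {0..<funpow_dist1 r c c}" by (rule inj_on_funpow_dist1[OF that])
    moreover have eq: "orbit r c = (\<lambda>i. (r ^^ i) c) ` {0..<funpow_dist1 r c c}"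
      by (rule orbit_conv_funpow_dist1[OF that])
    ultimately have "card (orbit r c) = funpow_dist1 r c c" by (simp add: card_image)
    with eq \<open>inj_on _ _\<close> show "bij_betw (\<lambda>i. (r ^^ i) c) {..<card (orbit r c)} (orbit r c)"
      "(r ^^ card (orbit r c)) c = c"
      using funpow_dist1_prop[OF that] by (simp_all add: bij_betw_def atLeast0LessThan)
  qed
  note P = *[OF stable_orbit(2)[OF assms(1,2)]] and Q = *[OF stable_orbit(2)[OF assms(3,4)]]
  define e where "e z = (q ^^ inv_into {..<?k} (\<lambda>i. (p ^^ i) a) z) b" for z
  have e: "e ((p ^^ i) a) = (q ^^ i) b" if "i < ?k" for i
    using inv_into_f_f[OF bij_betw_imp_inj_on[OF P(1)], of i] that by (simp add: e_def)
  show ?thesis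
  proof (rule that)
    show "e a = b" using e[of 0] stable_orbit(5)[OF assms(1,2)] by simp
    show "bij_betw e (orbit p a) (orbit q b)"
      using bij_betw_trans[OF bij_betw_inv_into[OF P(1)] Q(1)[folded assms(5)]]
      by (simp add: e_def[abs_def] o_def)
    fix z assume "z \<in> orbit p a"
    then obtain i where i: "i < ?k" "z = (p ^^ i) a" using P(1) by (auto simp: bij_betw_def)
    show "e (p z) = q (e z)"
    proof (cases "Suc i < ?k")
      case True
      then show ?thesis using e[of i] e[of "Suc i"] i by simp
    next
      case False
      then have "Suc i = ?k" using i by simp
      then have "p z = a" "q ((q ^^ i) b) = b"
        using P(2) Q(2) i(2) assms(5) by (metis comp_apply funpow.simps(2))+
      then show ?thesis using e[OF i(1)] \<open>e a = b\<close> i(2) by simp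
    qed
  qed
qed

section \<open>Scalar products as numbers of conjugating permutations\<close>

definition equivariant_bij :: "('a \<Rightarrow> 'a) \<Rightarrow> 'a set \<Rightarrow> ('b \<Rightarrow> 'b) \<Rightarrow> 'b set \<Rightarrow> ('a \<Rightarrow> 'b) set" where
  "equivariant_bij p A q B = {x \<in> A \<rightarrow>\<^sub>E B. bij_betw x A B \<and> (\<forall>a\<in>A. x (p a) = q (x a))}"

lemma equivariant_image_orbit:
  assumes "stable p A" "a \<in> A" "\<forall>z\<in>A. x (p z) = q (x z)"
  shows "x ` orbit p a = orbit q (x a)"
proof -
  have sub: "orbit p a \<subseteq> A" using stable_orbit[OF assms(1,2)] by simp
  have "x z \<in> orbit q (x a)" if "z \<in> orbit p a" for z
    using that
  proof induction
    case base
    then show ?case using assms by (auto intro: orbit.base)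
  next
    case (step y)
    then have "x (p y) = q (x y)" using assms(3) sub by blast
    then show ?case using step by (simp add: orbit.step)
  qed
  moreover have "y \<in> x ` orbit p a" if "y \<in> orbit q (x a)" for y
    using that
  proof induction
    case base
    then show ?case using assms by (auto intro!: image_eqI[of _ _ "p a"] orbit.base)
  next
    case (step y)
    then obtain z where "z \<in> orbit p a" "y = x z" by auto
    then show ?case using assms sub by (auto intro!: image_eqI[of _ _ "p z"] orbit.step)
  qed
  ultimately show ?thesis by auto
qed

lemma equivariant_unique:
  assumes "stable p A" "a \<in> A" "\<And>z. z \<in> orbit p a \<Longrightarrow> x (p z) = q (x z)"
    "\<And>z. z \<in> orbit p a \<Longrightarrow> y (p z) = q (y z)" "x a = y a" "z \<in> orbit p a"
  shows "x z = y z"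
  using assms(6)
proof induction
  case base
  then show ?case using assms(3-5) stable_orbit(2)[OF assms(1,2)] by simp
qed (use assms(3,4) in simp)

text \<open>The image b of a determines the map on the whole orbit of a, and b may be any point on a
  cycle of the same length. What is left is an arbitrary equivariant bijection between the
  complements.\<close>

lemma card_equivariant_bij:
  assumes A: "stable p A" "a \<in> A" and B: "stable q B"
  shows "card (equivariant_bij p A q B) = (\<Sum>b | b \<in> B \<and> card (orbit q b) = card (orbit p a).
      card (equivariant_bij p (A - orbit p a) q (B - orbit q b)))"
proof -
  let ?O = "orbit p a" and ?J = "\<lambda>b. equivariant_bij p (A - orbit p a) q (B - orbit q b)"
  let ?T = "{b \<in> B. card (orbit q b) = card ?O}"
  note O = stable_orbit[OF A]
  have fin: "finite A" "finite B" using A B by (auto simp: stable_def)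
  have "\<forall>b\<in>?T. \<exists>e. bij_betw e ?O (orbit q b) \<and> e a = b \<and> (\<forall>z\<in>?O. e (p z) = q (e z))"
  proof
    fix b assume "b \<in> ?T"
    then have b: "b \<in> B" "card ?O = card (orbit q b)" by simp_all
    show "\<exists>e. bij_betw e ?O (orbit q b) \<and> e a = b \<and> (\<forall>z\<in>?O. e (p z) = q (e z))"
      by (rule orbit_iso[OF A B b]) blast
  qed
  from bchoice[OF this] obtain e where e': "\<forall>b\<in>?T. bij_betw (e b) ?O (orbit q b) \<and> e b a = b
      \<and> (\<forall>z\<in>?O. e b (p z) = q (e b z))" ..
  have e: "bij_betw (e b) ?O (orbit q b)" "e b a = b" "z \<in> ?O \<Longrightarrow> e b (p z) = q (e b z)"
    if "b \<in> ?T" for b z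
    using bspec[OF e' that] by simp_all
  have pO: "p z \<in> ?O" if "z \<in> ?O" for z using that by (rule orbit.step)
  have pA: "p z \<in> A - ?O" if "z \<in> A - ?O" for z using that O(3) by (auto simp: stable_def)
  define glue where "glue = (\<lambda>(b, y) z. if z \<in> ?O then e b z else y z)"
  have down: "x ` ?O = orbit q (x a)" "x a \<in> ?T" "restrict x (A - ?O) \<in> ?J (x a)"
    if x: "x \<in> equivariant_bij p A q B" for x
  proof -
    have x': "x \<in> A \<rightarrow>\<^sub>E B" "bij_betw x A B" "\<forall>z\<in>A. x (p z) = q (x z)"
      using x by (auto simp: equivariant_bij_def)
    show im: "x ` ?O = orbit q (x a)" by (rule equivariant_image_orbit[OF A x'(3)])
    have inj: "inj_on x A" "x ` A = B" using x'(2) by (auto simp: bij_betw_def)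
    have "card (orbit q (x a)) = card ?O"
      unfolding im[symmetric] by (rule card_image[OF inj_on_subset[OF inj(1) O(1)]])
    then show "x a \<in> ?T" using A(2) inj(2) by auto
    have "x ` (A - ?O) = B - orbit q (x a)"
      using inj_on_image_set_diff[OF inj(1), of A ?O] O(1) im inj(2) by auto
    then have "bij_betw x (A - ?O) (B - orbit q (x a))"
      using inj_on_subset[OF inj(1), of "A - ?O"] by (auto simp: bij_betw_def)
    then show "restrict x (A - ?O) \<in> ?J (x a)"
      using x'(3) pA bij_betwE[of x "A - ?O" "B - orbit q (x a)"]
      by (auto simp: equivariant_bij_def bij_betw_restrict_eq)
  qed
  have "bij_betw (\<lambda>x. (x a, restrict x (A - ?O))) (equivariant_bij p A q B) (Sigma ?T ?J)"
  proof (rule bij_betw_byWitness[where f' = glue])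
    show "\<forall>x\<in>equivariant_bij p A q B. glue (x a, restrict x (A - ?O)) = x"
    proof (intro ballI ext)
      fix x z assume x: "x \<in> equivariant_bij p A q B"
      show "glue (x a, restrict x (A - ?O)) z = x z"
      proof (cases "z \<in> ?O")
        case True
        have "x (p z) = q (x z)" if "z \<in> ?O" for z
          using x that O(1) by (auto simp: equivariant_bij_def)
        then have "e (x a) z = x z"
          using equivariant_unique[OF A, of "e (x a)" q x z] e(2,3)[OF down(2)[OF x]] True by simp
        then show ?thesis using True by (simp add: glue_def)
      next
        case False
        moreover have "x \<in> A \<rightarrow>\<^sub>E B" using x by (simp add: equivariant_bij_def)
        ultimately show ?thesis
          using False PiE_arb[of x A "\<lambda>_. B" z] by (simp add: glue_def restrict_def)
      qed
    qed
    show "(\<lambda>x. (x a, restrict x (A - ?O))) ` equivariant_bij p A q B \<subseteq> Sigma ?T ?J"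
      using down(2,3) by auto
    have glue: "glue (b, y) \<in> equivariant_bij p A q B" "glue (b, y) a = b" "restrict (glue (b, y)) (A - ?O) = y"
      if b: "b \<in> ?T" and y: "y \<in> ?J b" for b y
    proof -
      have bO: "orbit q b \<subseteq> B" using stable_orbit(1)[OF B] b by simp
      have "bij_betw (glue (b, y)) ?O (orbit q b)"
        using e(1)[OF b] by (rule bij_betw_cong[THEN iffD1, rotated]) (simp add: glue_def)
      moreover have "bij_betw y (A - ?O) (B - orbit q b)" using y by (simp add: equivariant_bij_def)
      then have "bij_betw (glue (b, y)) (A - ?O) (B - orbit q b)"
        by (rule bij_betw_cong[THEN iffD1, rotated]) (simp add: glue_def)
      ultimately have "bij_betw (glue (b, y)) (?O \<union> (A - ?O)) (orbit q b \<union> (B - orbit q b))"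
        by (rule bij_betw_combine) auto
      then have bij: "bij_betw (glue (b, y)) A B" using O(1) bO by (simp add: Un_absorb1)
      moreover have "glue (b, y) (p z) = q (glue (b, y) z)" if "z \<in> A" for z
        using that pO pA e(3)[OF b] y by (cases "z \<in> ?O") (auto simp: glue_def equivariant_bij_def)
      moreover have "glue (b, y) \<in> A \<rightarrow>\<^sub>E B"
        using bij_betwE[OF bij] y O(1) by (auto simp: glue_def equivariant_bij_def PiE_iff extensional_def)
      ultimately show "glue (b, y) \<in> equivariant_bij p A q B" by (auto simp: equivariant_bij_def)
      show "glue (b, y) a = b" using e(2)[OF b] O(2) by (simp add: glue_def)
      show "restrict (glue (b, y)) (A - ?O) = y"
      proof
        fix z
        have "y \<in> (A - ?O) \<rightarrow>\<^sub>E (B - orbit q b)" using y by (simp add: equivariant_bij_def)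
        then show "restrict (glue (b, y)) (A - ?O) z = y z"
          by (simp add: glue_def PiE_arb[of y "A - ?O" "\<lambda>_. B - orbit q b"] restrict_def)
      qed
    qed
    show "\<forall>by\<in>Sigma ?T ?J. (glue by a, restrict (glue by) (A - ?O)) = by"
      using glue by auto
    show "glue ` Sigma ?T ?J \<subseteq> equivariant_bij p A q B" using glue by auto
  qed
  then have "card (equivariant_bij p A q B) = card (Sigma ?T ?J)" by (rule bij_betw_same_card)
  also have "\<dots> = (\<Sum>b\<in>?T. card (?J b))"
  proof (rule card_SigmaI)
    show "\<forall>b\<in>?T. finite (?J b)"
      using fin by (auto simp: equivariant_bij_def intro!: finite_subset[OF _ finite_PiE[of "A - ?O" "\<lambda>_. B"]])
  qed (use fin in simp)
  finally show ?thesis .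
qed

text \<open>Both sides satisfy the same recursion when an orbit is removed: the choices for the
  image of one point match the factor in \<open>gram_add\<close>.\<close>

lemma gram_orbit_type:
  assumes "stable p A" "stable q B" "card A = card B" "card A \<le> N"
  shows "gram N (card A) (orbit_type p A) (orbit_type q B) = fact N * int (card (equivariant_bij p A q B))"
  using assms
proof (induction arbitrary: B rule: stable_induct)
  case empty
  then have "B = {}" by (simp add: stable_def)
  then show ?case by (simp add: orbit_type_def gram_empty equivariant_bij_def bij_betw_def)
next
  case (orbit A a)
  note O = stable_orbit[OF orbit(1,2)]
  let ?O = "orbit p a" and ?k = "card (orbit p a)"
  have fin: "finite A" "finite B" using orbit by (auto simp: stable_def)
  have card: "card A = card (A - ?O) + ?k"
    using card_Diff_subset[OF O(4,1)] card_mono[OF fin(1) O(1)] by simp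
  let ?T = "{b. b \<in> B \<and> card (orbit q b) = ?k}"
  have IH: "gram N (card (A - ?O)) (orbit_type p (A - ?O)) (orbit_type q B - {#?k#})
      = fact N * int (card (equivariant_bij p (A - ?O) q (B - orbit q b)))" if b: "b \<in> ?T" for b
  proof -
    have b': "b \<in> B" "card (orbit q b) = ?k" using b by auto
    note O' = stable_orbit[OF orbit.prems(1) b'(1)]
    have "card (B - orbit q b) = card (A - ?O)"
      using card_Diff_subset[OF O'(4,1)] card b' orbit.prems by simp
    moreover have "orbit_type q B - {#?k#} = orbit_type q (B - orbit q b)"
      using orbit_type_remove[OF orbit.prems(1) b'(1)] b'(2) by simp
    ultimately show ?thesis
      using orbit.IH[OF O'(3)] card orbit.prems(3) by simp
  qed
  have "gram N (card A) (orbit_type p A) (orbit_type q B)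
      = int ?k * int (count (orbit_type q B) ?k)
        * gram N (card (A - ?O)) (orbit_type p (A - ?O)) (orbit_type q B - {#?k#})"
    unfolding orbit_type_remove[OF orbit(1,2)] card
    using card orbit.prems O(5) zero_notin_orbit_type[OF orbit.prems(1)] by (intro gram_add) auto
  also have "\<dots> = (\<Sum>b\<in>?T. gram N (card (A - ?O)) (orbit_type p (A - ?O)) (orbit_type q B - {#?k#}))"
    using card_orbit_size[OF orbit.prems(1), of ?k] by simp
  also have "\<dots> = (\<Sum>b\<in>?T. fact N * int (card (equivariant_bij p (A - ?O) q (B - orbit q b))))"
    by (intro sum.cong refl IH)
  also have "\<dots> = fact N * int (card (equivariant_bij p A q B))"
    by (simp add: card_equivariant_bij[OF orbit(1,2) orbit.prems(1)] sum_distrib_left)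
  finally show ?case .
qed

lemma stable_permutes: "p permutes S \<Longrightarrow> finite S \<Longrightarrow> stable p S"
  by (auto simp: stable_def permutes_imp_permutation permutes_image)

lemma card_conjugators:
  assumes p: "p permutes S" and q: "q permutes S"
  shows "card {x. x permutes S \<and> x \<circ> p = q \<circ> x} = card (equivariant_bij p S q S)"
proof (rule bij_betw_same_card)
  show "bij_betw (\<lambda>x. restrict x S) {x. x permutes S \<and> x \<circ> p = q \<circ> x} (equivariant_bij p S q S)"
  proof (rule bij_betw_byWitness[where f' = "\<lambda>y z. if z \<in> S then y z else z"])
    show "\<forall>x\<in>{x. x permutes S \<and> x \<circ> p = q \<circ> x}. (\<lambda>z. if z \<in> S then restrict x S z else z) = x"
      by (auto simp: permutes_def fun_eq_iff)
    show "\<forall>y\<in>equivariant_bij p S q S. restrict (\<lambda>z. if z \<in> S then y z else z) S = y"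
    proof
      fix y assume "y \<in> equivariant_bij p S q S"
      then have "y \<in> extensional S" by (simp add: equivariant_bij_def PiE_def)
      then show "restrict (\<lambda>z. if z \<in> S then y z else z) S = y"
        by (simp add: fun_eq_iff restrict_def extensional_def)
    qed
    show "(\<lambda>x. restrict x S) ` {x. x permutes S \<and> x \<circ> p = q \<circ> x} \<subseteq> equivariant_bij p S q S"
    proof (intro image_subsetI)
      fix x assume x: "x \<in> {x. x permutes S \<and> x \<circ> p = q \<circ> x}"
      then have "x (p z) = q (x z)" for z by (simp add: fun_eq_iff)
      moreover have "bij_betw x S S" using x by (simp add: permutes_imp_bij)
      ultimately show "restrict x S \<in> equivariant_bij p S q S"
        using permutes_in_image[OF p] bij_betwE[of x S S]
        by (simp add: equivariant_bij_def bij_betw_restrict_eq)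
    qed
    show "(\<lambda>y z. if z \<in> S then y z else z) ` equivariant_bij p S q S \<subseteq> {x. x permutes S \<and> x \<circ> p = q \<circ> x}"
    proof (intro image_subsetI)
      fix y assume y: "y \<in> equivariant_bij p S q S"
      let ?x = "\<lambda>z. if z \<in> S then y z else z"
      have "bij_betw y S S" using y by (simp add: equivariant_bij_def)
      then have "bij_betw ?x S S" by (rule bij_betw_cong[THEN iffD1, rotated]) simp
      then have "?x permutes S" by (rule bij_imp_permutes) simp
      moreover have "?x (p z) = q (?x z)" for z
        using y permutes_in_image[OF p] permutes_not_in[OF p] permutes_not_in[OF q]
        by (cases "z \<in> S") (simp_all add: equivariant_bij_def)
      ultimately show "?x \<in> {x. x permutes S \<and> x \<circ> p = q \<circ> x}" by (simp add: fun_eq_iff)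
    qed
  qed
qed

lemma gram_conjugators:
  assumes "p permutes S" "q permutes S" "finite S" "card S \<le> N"
  shows "gram N (card S) (orbit_type p S) (orbit_type q S)
       = fact N * int (card {x. x permutes S \<and> x \<circ> p = q \<circ> x})"
  using assms by (simp add: card_conjugators gram_orbit_type stable_permutes)

text \<open>By \<open>gram_conjugators\<close> the number of conjugating x depends only on the orbit
  types. For q = p it is the order of the centraliser, which contains \<open>id\<close>.\<close>

lemma same_type_conjugate:
  assumes p: "p permutes S" and q: "q permutes S" and S: "finite S"
    and eq: "orbit_type p S = orbit_type q S"
  obtains x where "x permutes S" "x \<circ> p = q \<circ> x"
proof -
  have "fact (card S) * int (card {x. x permutes S \<and> x \<circ> p = q \<circ> x})
      = fact (card S) * int (card {x. x permutes S \<and> x \<circ> p = p \<circ> x})"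
    using gram_conjugators[OF p q S order_refl] gram_conjugators[OF p p S order_refl] eq by simp
  moreover have "card {x. x permutes S \<and> x \<circ> p = p \<circ> x} > 0"
    using S permutes_id[of S] by (subst card_gt_0_iff) (auto simp: finite_permutations intro!: exI[of _ id])
  ultimately have "card {x. x permutes S \<and> x \<circ> p = q \<circ> x} \<noteq> 0" by auto
  then have "{x. x permutes S \<and> x \<circ> p = q \<circ> x} \<noteq> {}" by (intro notI) simp
  then show ?thesis using that by blast
qed

text \<open>Take the cyclic shift along an enumeration of A.\<close>

lemma ex_single_orbit:
  assumes "finite A" "A \<noteq> {}"
  obtains p where "p permutes A" "\<And>a. a \<in> A \<Longrightarrow> orbit p a = A"
proof -
  let ?k = "card A"
  have k: "?k > 0" using assms by (simp add: card_gt_0_iff)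
  obtain f where f: "bij_betw f {0..<?k} A" using ex_bij_betw_nat_finite[OF assms(1)] by blast
  let ?g = "inv_into {0..<?k} f"
  have fA: "f i \<in> A" if "i < ?k" for i using bij_betwE[OF f] that by simp
  have ex: "\<exists>i<?k. z = f i" if "z \<in> A" for z
  proof -
    have "z \<in> f ` {0..<?k}" using that bij_betw_imp_surj_on[OF f] by simp
    then show ?thesis by (elim imageE) auto
  qed
  define c where "c z = (if z \<in> A then f (Suc (?g z) mod ?k) else z)" for z
  have g: "?g (f i) = i" if "i < ?k" for i
    using f that by (simp add: bij_betw_inv_into_left)
  have cf: "c (f i) = f (Suc i mod ?k)" if "i < ?k" for i
    using g[OF that] bij_betwE[OF f] that by (simp add: c_def)
  have pow: "(c ^^ j) (f i) = f ((i + j) mod ?k)" if "i < ?k" for i j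
    using that k by (induction j) (simp_all add: cf mod_Suc_eq)
  have surj: "A \<subseteq> c ` A"
  proof
    fix z assume "z \<in> A"
    then obtain i where i: "i < ?k" "z = f i" using ex by blast
    have "c (f ((i + (?k - 1)) mod ?k)) = f ((i + ?k) mod ?k)"
      using k by (simp add: cf mod_Suc_eq)
    also have "\<dots> = z" using i by simp
    finally have "z = c (f ((i + (?k - 1)) mod ?k))" ..
    then show "z \<in> c ` A" by (rule image_eqI) (use fA k in simp)
  qed
  have "c ` A \<subseteq> A"
  proof
    fix y assume "y \<in> c ` A"
    then obtain i where "i < ?k" "y = c (f i)" using ex by blast
    then show "y \<in> A" using fA k by (simp add: cf)
  qed
  then have "bij_betw c A A" using surj assms(1) by (simp add: bij_betw_def eq_card_imp_inj_on subset_antisym)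
  then have "c permutes A" by (rule bij_imp_permutes) (simp add: c_def)
  moreover have "orbit c a = A" if a: "a \<in> A" for a
  proof -
    obtain i where i: "i < ?k" "a = f i" using a ex by blast
    have "z \<in> orbit c a" if z: "z \<in> A" for z
    proof -
      obtain j where j: "j < ?k" "z = f j" using ex[OF z] by blast
      \<comment> \<open>The exponent includes a passage through the end of the enumeration, so it is
        positive even for \<open>j \<le> i\<close>; an orbit consists of positive iterates.\<close>
      have "z = (c ^^ (?k - i + j)) a" using i j pow[OF i(1)] by simp
      moreover have "0 < ?k - i + j" using i by simp
      ultimately show ?thesis unfolding orbit_altdef by blast
    qed
    then show ?thesis using permutes_orbit_subset[OF \<open>c permutes A\<close> a] by blast
  qed
  ultimately show ?thesis using that by blast
qed

lemma ex_orbit_type: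
  assumes "finite A" "0 \<notin># \<nu>" "sum_mset \<nu> = card A"
  shows "\<exists>p. p permutes A \<and> orbit_type p A = \<nu>"
  using assms
proof (induction \<nu> arbitrary: A)
  case empty
  then show ?case by (auto simp: orbit_type_def intro: permutes_id)
next
  case (add k \<nu>)
  then obtain O' where O': "O' \<subseteq> A" "card O' = k" "finite O'"
    using obtain_subset_with_card_n[of k A] by auto
  have ne: "O' \<noteq> {}" using add.prems(2) O' by auto
  have "card (A - O') = sum_mset \<nu>" using add.prems O' by (simp add: card_Diff_subset)
  then obtain p where p: "p permutes (A - O')" "orbit_type p (A - O') = \<nu>"
    using add.IH[of "A - O'"] add.prems by auto
  obtain c where c: "c permutes O'" "\<And>a. a \<in> O' \<Longrightarrow> orbit c a = O'"
    using ex_single_orbit[OF O'(3) ne] by blast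
  have perm: "c \<circ> p permutes A"
    using permutes_subset[OF c(1) O'(1)] permutes_subset[OF p(1), of A] by (intro permutes_compose) auto
  have orbO: "orbit (c \<circ> p) a = O'" if "a \<in> O'" for a
  proof -
    have "orbit (c \<circ> p) a = orbit c a"
      using c(2)[OF that] that permutes_not_in[OF p(1)] by (intro orbit_cong) auto
    then show ?thesis using c(2)[OF that] by simp
  qed
  have orbA: "orbit (c \<circ> p) a = orbit p a" if a: "a \<in> A - O'" for a
  proof (rule orbit_cong)
    have "finite (A - O')" using add.prems by simp
    then show "a \<in> orbit p a"
      using p(1) by (intro permutation_self_in_orbit) (rule permutes_imp_permutation)
    fix s assume "s \<in> orbit p a"
    then have "s \<in> A - O'" using permutes_orbit_subset[OF p(1) a] by blast
    then have "p s \<in> A - O'" using permutes_in_image[OF p(1)] by simp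
    then show "(c \<circ> p) s = p s" using permutes_not_in[OF c(1)] by simp
  qed
  obtain a where a: "a \<in> O'" using ne by blast
  have "orbit_type (c \<circ> p) A = add_mset k (orbit_type (c \<circ> p) (A - O'))"
    using orbit_type_remove[OF stable_permutes[OF perm add.prems(1)], of a] a O' orbO[OF a] by auto
  also have "orbit_type (c \<circ> p) (A - O') = orbit_type p (A - O')"
  proof -
    have "orbit (c \<circ> p) ` (A - O') = orbit p ` (A - O')" using orbA by (intro image_cong refl)
    then show ?thesis by (simp add: orbit_type_def)
  qed
  finally show ?case using perm p(2) by blast
qed

section \<open>Frobenius characters through words fixed by a permutation\<close>

definition words :: "nat \<Rightarrow> ('a \<Rightarrow> 'a) \<Rightarrow> 'a set \<Rightarrow> ('a \<Rightarrow> nat) set" where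
  "words N p A = {F \<in> A \<rightarrow>\<^sub>E {..<N}. \<forall>a\<in>A. F (p a) = F a}"

text \<open>The exponent vector of x^v after division by the monomial of the word F.\<close>

definition take_off :: "('a \<Rightarrow> nat) \<Rightarrow> 'a set \<Rightarrow> (nat \<Rightarrow> int) \<Rightarrow> nat \<Rightarrow> int" where
  "take_off F A v = (\<lambda>i. v i - int (card {a\<in>A. F a = i}))"

text \<open>Expand the product of power sums: choosing x_i^k from the factor of a k-cycle means
  giving the letter i to all points of that cycle.\<close>

lemma frob_char_words:
  assumes "stable p A"
  shows "frob_char N (orbit_type p A) v = (\<Sum>F\<in>words N p A. vacuum N (take_off F A v))"
  using assms
proof (induction arbitrary: v rule: stable_induct)
  case empty
  have "words N p {} = {\<lambda>_. undefined}" by (auto simp: words_def)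
  then show ?case by (simp add: orbit_type_def take_off_def)
next
  case (orbit A a)
  let ?O = "orbit p a"
  note O = stable_orbit[OF orbit(1,2)]
  have fin: "finite A" using orbit by (simp add: stable_def)
  have pA: "p z \<in> A - ?O" if "z \<in> A - ?O" for z using that O(3) by (auto simp: stable_def)
  have const: "F z = F a" if "F \<in> words N p A" "z \<in> ?O" for F z
    using that(2) by induction (use that(1) O(1) orbit(2) in \<open>auto simp: words_def\<close>)
  define up where "up = (\<lambda>(i, F) z. if z \<in> ?O then i else F z :: nat)"
  define down where "down F = (F a :: nat, restrict F (A - ?O))" for F
  have "(\<Sum>F\<in>words N p A. vacuum N (take_off F A v))
      = (\<Sum>(i, F)\<in>{..<N} \<times> words N p (A - ?O). vacuum N (take_off F (A - ?O) (add_at i (- int (card ?O)) v)))"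
  proof (rule sum.reindex_bij_witness[of _ up down])
    fix F assume F: "F \<in> words N p A"
    then have F': "F \<in> A \<rightarrow>\<^sub>E {..<N}" "\<forall>z\<in>A. F (p z) = F z" by (simp_all add: words_def)
    show "up (down F) = F"
    proof
      fix z
      show "up (down F) z = F z"
        using const[OF F] PiE_arb[OF F'(1), of z] by (auto simp: up_def down_def restrict_def)
    qed
    show "down F \<in> {..<N} \<times> words N p (A - ?O)"
      using F' pA orbit(2) by (auto simp: down_def words_def PiE_iff)
    have "{z\<in>A. F z = i} = {z\<in>A - ?O. F z = i} \<union> (if i = F a then ?O else {})" for i
      using const[OF F] O(1) by auto
    then have "card {z\<in>A. F z = i} = card {z\<in>A - ?O. F z = i} + card (if i = F a then ?O else {})" for i
      using fin O(4) by (subst card_Un_disjoint[symmetric]) auto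
    moreover have "{z\<in>A - ?O. restrict F (A - ?O) z = i} = {z\<in>A - ?O. F z = i}" for i by auto
    ultimately have "take_off (restrict F (A - ?O)) (A - ?O) (add_at (F a) (- int (card ?O)) v) = take_off F A v"
      by (auto simp: take_off_def add_at_def fun_eq_iff)
    then show "(case down F of (i, F) \<Rightarrow> vacuum N (take_off F (A - ?O) (add_at i (- int (card ?O)) v)))
        = vacuum N (take_off F A v)" by (simp add: down_def)
  next
    fix x assume "x \<in> {..<N} \<times> words N p (A - ?O)"
    then obtain i F where x: "x = (i, F)" "i < N" "F \<in> A - ?O \<rightarrow>\<^sub>E {..<N}" "\<forall>z\<in>A - ?O. F (p z) = F z"
      by (auto simp: words_def)
    have "restrict (up x) (A - ?O) z = F z" for z
      using PiE_arb[OF x(3), of z] by (auto simp: up_def x(1) restrict_def)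
    then show "down (up x) = x"
      using O(2) by (simp add: down_def x(1) fun_eq_iff) (simp add: up_def)
    have "up x (p z) = up x z" if "z \<in> A" for z
      using x pA[of z] that by (cases "z \<in> ?O") (auto simp: up_def intro: orbit.step)
    moreover have "up x \<in> A \<rightarrow>\<^sub>E {..<N}"
      using x O(1) by (auto simp: up_def PiE_iff extensional_def)
    ultimately show "up x \<in> words N p A" by (simp add: words_def)
  qed
  also have "\<dots> = (\<Sum>i<N. frob_char N (orbit_type p (A - ?O)) (add_at i (- int (card ?O)) v))"
    by (simp add: sum.cartesian_product[symmetric] orbit.IH)
  also have "\<dots> = frob_char N (orbit_type p A) v"
    by (simp add: orbit_type_remove[OF orbit(1,2)] lower_def)
  finally show ?case ..
qed

section \<open>Schur's lemma and integrality of traces\<close>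

lemma index_mult_mat_square:
  assumes "A \<in> carrier_mat d d" "B \<in> carrier_mat d d" "i < d" "j < d"
  shows "(A * B) $$ (i, j) = (\<Sum>k<d. A $$ (i, k) * B $$ (k, j))"
  using assms by (simp add: scalar_prod_def atLeast0LessThan)

lemma mat_trace_mult_commute:
  fixes A B :: "complex mat"
  assumes "A \<in> carrier_mat d d" "B \<in> carrier_mat d d"
  shows "mat_trace (A * B) = mat_trace (B * A)"
proof -
  have "mat_trace (A * B) = (\<Sum>i<d. \<Sum>k<d. A $$ (i, k) * B $$ (k, i))"
    using assms by (simp add: mat_trace_def index_mult_mat_square del: index_mult_mat(1))
  also have "\<dots> = (\<Sum>k<d. \<Sum>i<d. B $$ (k, i) * A $$ (i, k))"
    by (subst sum.swap) (simp add: mult.commute)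
  also have "\<dots> = mat_trace (B * A)"
    using assms by (simp add: mat_trace_def index_mult_mat_square del: index_mult_mat(1))
  finally show ?thesis .
qed

lemma mat_trace_similar:
  fixes A B :: "complex mat"
  assumes "similar_mat A B"
  shows "mat_trace A = mat_trace B"
proof -
  obtain n P Q where *: "{A, B, P, Q} \<subseteq> carrier_mat n n" "P * Q = 1\<^sub>m n" "Q * P = 1\<^sub>m n" "A = P * B * Q"
    using similar_matD[OF assms] by blast
  then have c: "A \<in> carrier_mat n n" "B \<in> carrier_mat n n" "P \<in> carrier_mat n n" "Q \<in> carrier_mat n n" by auto
  have "mat_trace A = mat_trace (Q * (P * B))"
    using c *(4) mat_trace_mult_commute[of "P * B" n Q] by simp
  also have "Q * (P * B) = (Q * P) * B" using c by (simp add: assoc_mult_mat)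
  finally show ?thesis using c *(3) by simp
qed

text \<open>After triangularisation every diagonal entry x satisfies x^2 = x.\<close>

lemma mat_trace_idempotent:
  fixes A :: "complex mat"
  assumes A: "A \<in> carrier_mat n n" and idem: "A * A = A"
  shows "mat_trace A \<in> \<int>"
proof -
  obtain as where "char_poly A = (\<Prod>a\<leftarrow>as. [:- a, 1:])" using char_poly_factorized[OF A] by blast
  then obtain B where B: "B \<in> carrier_mat n n" "upper_triangular B" "similar_mat A B"
    using schur_decomposition_exists[OF A] by blast
  obtain m P Q where *: "{A, B, P, Q} \<subseteq> carrier_mat m m" "P * Q = 1\<^sub>m m" "Q * P = 1\<^sub>m m" "A = P * B * Q"
    using similar_matD[OF B(3)] by blast
  have "m = n" using * A by auto
  with * have c: "P \<in> carrier_mat n n" "Q \<in> carrier_mat n n" "Q * P = 1\<^sub>m n" by auto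
  note asc = assoc_mult_mat[of _ n n _ n _ n] mult_carrier_mat[of _ n n _ n]
  have QAP: "Q * A * P = B"
  proof -
    have "Q * A * P = Q * (P * B * Q) * P" using *(4) by simp
    also have "\<dots> = (Q * P) * B * (Q * P)" using c(1,2) B(1) by (simp add: asc)
    finally show ?thesis using c B(1) by simp
  qed
  have "B * B = Q * A * P * (Q * A * P)" using QAP by simp
  also have "\<dots> = Q * A * (P * Q) * (A * P)" using c(1,2) A by (simp add: asc)
  also have "\<dots> = Q * (A * A) * P" using c(1,2) A *(2) \<open>m = n\<close> by (simp add: asc)
  also have "\<dots> = B" using idem QAP by simp
  finally have BB: "B * B = B" .
  have diag: "B $$ (i, i) \<in> \<int>" if i: "i < n" for i
  proof -
    have "B $$ (i, k) * B $$ (k, i) = (if k = i then B $$ (i, i) * B $$ (i, i) else 0)" if "k < n" for k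
      using B(1,2) i that by (cases "k < i"; cases "i < k") (auto simp: upper_triangular_def)
    then have "(B * B) $$ (i, i) = (\<Sum>k<n. if k = i then B $$ (i, i) * B $$ (i, i) else 0)"
      by (simp add: index_mult_mat_square[OF B(1) B(1) i i] del: index_mult_mat(1))
    then have "B $$ (i, i) * (B $$ (i, i) - 1) = 0"
      using i BB by (simp add: algebra_simps)
    then show ?thesis by auto
  qed
  have "mat_trace A = (\<Sum>i<n. B $$ (i, i))"
    using mat_trace_similar[OF B(3)] B(1) by (simp add: mat_trace_def)
  then show ?thesis using diag by (auto intro: Ints_sum)
qed

section \<open>Averages of a representation over subgroups\<close>

context
  fixes n d :: nat and \<rho> :: "(nat \<Rightarrow> nat) \<Rightarrow> complex mat"
  assumes rep: "representation n d \<rho>"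
begin

lemma rep_carrier: "p permutes {1..n} \<Longrightarrow> \<rho> p \<in> carrier_mat d d"
  and rep_mult: "p permutes {1..n} \<Longrightarrow> q permutes {1..n} \<Longrightarrow> \<rho> (p \<circ> q) = \<rho> p * \<rho> q"
proof -
  have h: "\<rho> \<in> hom (sym_group n) (units_of (ring_mat TYPE(complex) d ()))"
    using rep by (simp add: representation_def)
  show "\<rho> p \<in> carrier_mat d d" if "p permutes {1..n}"
    using h that unfolding hom_def
    by (auto simp: sym_group_carrier units_of_carrier Units_def ring_mat_simps)
  show "\<rho> (p \<circ> q) = \<rho> p * \<rho> q" if "p permutes {1..n}" "q permutes {1..n}"
    using h that unfolding hom_def
    by (simp add: sym_group_carrier sym_group_mult units_of_mult ring_mat_simps)
qed

lemma rep_id: "\<rho> id = 1\<^sub>m d"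
proof -
  have h: "\<rho> \<in> hom (sym_group n) (units_of (ring_mat TYPE(complex) d ()))"
    using rep by (simp add: representation_def)
  have "\<rho> id \<in> Units (ring_mat TYPE(complex) d ())"
    using h unfolding hom_def by (auto simp: sym_group_carrier units_of_carrier permutes_id)
  then obtain M where M: "M \<in> carrier_mat d d" "M * \<rho> id = 1\<^sub>m d"
    by (auto simp: Units_def ring_mat_simps)
  have c: "\<rho> id \<in> carrier_mat d d" by (intro rep_carrier permutes_id)
  have "\<rho> id = M * \<rho> id * \<rho> id" using M c by simp
  also have "\<dots> = M * \<rho> (id \<circ> id)"
    unfolding rep_mult[OF permutes_id permutes_id] using assoc_mult_mat[OF M(1) c c] by simp
  finally show ?thesis using M by simp
qed

lemma rep_inv:
  assumes "p permutes {1..n}"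
  shows "\<rho> p * \<rho> (inv' p) = 1\<^sub>m d" "\<rho> (inv' p) * \<rho> p = 1\<^sub>m d"
  using rep_mult[OF assms permutes_inv[OF assms]] rep_mult[OF permutes_inv[OF assms] assms]
  by (simp_all add: permutes_inv_o[OF assms] rep_id)

lemma trace_conjugate:
  assumes "p permutes {1..n}" "q permutes {1..n}" "x permutes {1..n}" "x \<circ> p = q \<circ> x"
  shows "mat_trace (\<rho> p) = mat_trace (\<rho> q)"
proof -
  note c = rep_carrier[OF assms(1)] rep_carrier[OF assms(2)] rep_carrier[OF assms(3)]
    rep_carrier[OF permutes_inv[OF assms(3)]]
  have "\<rho> q = \<rho> q * (\<rho> x * \<rho> (inv' x))" using c rep_inv[OF assms(3)] by simp
  also have "\<dots> = \<rho> x * \<rho> p * \<rho> (inv' x)"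
    using assoc_mult_mat[OF c(2,3,4)] rep_mult[OF assms(2,3)] rep_mult[OF assms(3,1)] assms(4) by simp
  finally have "mat_trace (\<rho> q) = mat_trace (\<rho> (inv' x) * (\<rho> x * \<rho> p))"
    using c mat_trace_mult_commute[of "\<rho> x * \<rho> p" d "\<rho> (inv' x)"] by simp
  also have "\<rho> (inv' x) * (\<rho> x * \<rho> p) = \<rho> p"
    using assoc_mult_mat[OF c(4,3,1)] rep_inv(2)[OF assms(3)] c by simp
  finally show ?thesis ..
qed

text \<open>A nonempty finite set closed under composition is a subgroup. The average of \<rho> over
  it is idempotent, being the projection onto the fixed vectors.\<close>

lemma sum_trace_subgroup:
  assumes sub: "H \<subseteq> {p. p permutes {1..n}}" and ne: "H \<noteq> {}"
    and closed: "\<And>p q. p \<in> H \<Longrightarrow> q \<in> H \<Longrightarrow> p \<circ> q \<in> H"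
  shows "(\<Sum>p\<in>H. mat_trace (\<rho> p)) / of_nat (card H) \<in> \<int>"
proof -
  have fin: "finite H" by (rule finite_subset[OF sub]) (simp add: finite_permutations)
  then have card: "(of_nat (card H) :: complex) \<noteq> 0" using ne by simp
  define A where "A = mat d d (\<lambda>ij. (\<Sum>p\<in>H. \<rho> p $$ ij) / of_nat (card H))"
  have A: "A \<in> carrier_mat d d" by (simp add: A_def)
  have shift: "(\<Sum>q\<in>H. f (p \<circ> q)) = (\<Sum>q\<in>H. f q)" if p: "p \<in> H" for p and f :: "(nat \<Rightarrow> nat) \<Rightarrow> complex"
  proof -
    have "inj p" using sub p permutes_inj by blast
    then have inj: "inj_on (\<lambda>q. p \<circ> q) H" by (auto intro!: inj_onI simp: fun_eq_iff inj_eq)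
    then have "(\<lambda>q. p \<circ> q) ` H = H"
      using closed[OF p] fin by (intro card_subset_eq) (auto simp: card_image)
    then show ?thesis using sum.reindex[OF inj, of f] by (simp add: o_def)
  qed
  have "A * A = A"
  proof (rule eq_matI)
    fix i j assume "i < dim_row A" "j < dim_col A"
    then have ij: "i < d" "j < d" using A by auto
    have "(A * A) $$ (i, j) = (\<Sum>k<d. (\<Sum>p\<in>H. \<rho> p $$ (i, k)) * (\<Sum>q\<in>H. \<rho> q $$ (k, j))) / (of_nat (card H) * of_nat (card H))"
      unfolding index_mult_mat_square[OF A A ij] sum_divide_distrib
      by (intro sum.cong refl) (simp add: A_def ij)
    also have "(\<Sum>k<d. (\<Sum>p\<in>H. \<rho> p $$ (i, k)) * (\<Sum>q\<in>H. \<rho> q $$ (k, j)))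
        = (\<Sum>p\<in>H. \<Sum>q\<in>H. \<Sum>k<d. \<rho> p $$ (i, k) * \<rho> q $$ (k, j))"
      by (simp add: sum_product sum.swap[of _ "{..<d}"])
    also have "\<dots> = (\<Sum>p\<in>H. \<Sum>q\<in>H. \<rho> (p \<circ> q) $$ (i, j))"
    proof (intro sum.cong refl)
      fix p q assume "p \<in> H" "q \<in> H"
      then have pq: "p permutes {1..n}" "q permutes {1..n}" using sub by auto
      show "(\<Sum>k<d. \<rho> p $$ (i, k) * \<rho> q $$ (k, j)) = \<rho> (p \<circ> q) $$ (i, j)"
        unfolding rep_mult[OF pq] index_mult_mat_square[OF rep_carrier[OF pq(1)] rep_carrier[OF pq(2)] ij] ..
    qed
    also have "\<dots> = of_nat (card H) * (\<Sum>q\<in>H. \<rho> q $$ (i, j))"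
      using shift[of _ "\<lambda>q. \<rho> q $$ (i, j)"] by simp
    finally show "(A * A) $$ (i, j) = A $$ (i, j)" using ij card by (simp add: A_def)
  qed (use A in auto)
  then have "mat_trace A \<in> \<int>" by (rule mat_trace_idempotent[OF A])
  moreover have "mat_trace A = (\<Sum>i<d. \<Sum>p\<in>H. \<rho> p $$ (i, i)) / of_nat (card H)"
    by (simp add: mat_trace_def A_def sum_divide_distrib)
  moreover have "(\<Sum>i<d. \<Sum>p\<in>H. \<rho> p $$ (i, i)) = (\<Sum>p\<in>H. mat_trace (\<rho> p))"
  proof (subst sum.swap, intro sum.cong refl)
    fix p assume "p \<in> H"
    then have "\<rho> p \<in> carrier_mat d d" using sub rep_carrier by auto
    then show "(\<Sum>i<d. \<rho> p $$ (i, i)) = mat_trace (\<rho> p)" by (simp add: mat_trace_def)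
  qed
  ultimately show ?thesis by simp
qed

end

section \<open>Schur's lemma and orthogonality\<close>

context
  fixes n d :: nat and \<rho> :: "(nat \<Rightarrow> nat) \<Rightarrow> complex mat"
  assumes irr: "irreducible_representation n d \<rho>"
begin

lemma irr_rep: "representation n d \<rho>" and irr_dim: "d > 0"
  using irr by (auto simp: irreducible_representation_def)

text \<open>An eigenspace of M is nonzero and invariant, so it is the whole space.\<close>

lemma schur:
  assumes M: "M \<in> carrier_mat d d"
    and comm: "\<And>p. p permutes {1..n} \<Longrightarrow> \<rho> p * M = M * \<rho> p"
  obtains c where "M = c \<cdot>\<^sub>m 1\<^sub>m d"
proof -
  obtain c v where v: "v \<in> carrier_vec d" "v \<noteq> 0\<^sub>v d" "M *\<^sub>v v = c \<cdot>\<^sub>v v"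
    using spectrum_non_empty[OF M irr_dim] M by (auto simp: spectrum_def eigenvalue_def eigenvector_def)
  define W where "W = {w \<in> carrier_vec d. M *\<^sub>v w = c \<cdot>\<^sub>v w}"
  have "VectorSpace.subspace class_ring W (module_vec TYPE(complex) d)"
  proof (rule VectorSpace.subspace.intro[OF vec_vs], rule submodule.intro[OF vec_module])
    show "W \<subseteq> carrier (module_vec TYPE(complex) d)" by (auto simp: W_def module_vec_simps)
    show "\<zero>\<^bsub>module_vec TYPE(complex) d\<^esub> \<in> W" using M by (auto simp: W_def module_vec_simps)
    show "v \<oplus>\<^bsub>module_vec TYPE(complex) d\<^esub> w \<in> W" if "v \<in> W" "w \<in> W" for v w
      using that M by (auto simp: W_def module_vec_simps mult_add_distrib_mat_vec smult_add_distrib_vec)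
    show "k \<odot>\<^bsub>module_vec TYPE(complex) d\<^esub> w \<in> W" if "k \<in> carrier class_ring" "w \<in> W" for k w
      using that M by (auto simp: W_def module_vec_simps mult_mat_vec smult_smult_assoc mult.commute)
  qed
  moreover have "\<rho> p *\<^sub>v w \<in> W" if p: "p \<in> carrier (sym_group n)" and w: "w \<in> W" for p w
  proof -
    have p': "p permutes {1..n}" using p by (simp add: sym_group_carrier)
    note c = rep_carrier[OF irr_rep p']
    have w': "w \<in> carrier_vec d" "M *\<^sub>v w = c \<cdot>\<^sub>v w" using w by (auto simp: W_def)
    have "M *\<^sub>v (\<rho> p *\<^sub>v w) = (M * \<rho> p) *\<^sub>v w" using assoc_mult_mat_vec[OF M c w'(1)] by simp
    also have "\<dots> = \<rho> p *\<^sub>v (M *\<^sub>v w)" using assoc_mult_mat_vec[OF c M w'(1)] comm[OF p'] by simp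
    also have "\<dots> = c \<cdot>\<^sub>v (\<rho> p *\<^sub>v w)" using w' mult_mat_vec[OF c w'(1)] by simp
    finally show ?thesis using mult_mat_vec_carrier[OF c w'(1)] by (simp add: W_def)
  qed
  ultimately have "invariant_subspace n d \<rho> W" by (simp add: invariant_subspace_def)
  then have "W = {0\<^sub>v d} \<or> W = carrier_vec d" using irr by (simp add: irreducible_representation_def)
  moreover have "v \<in> W" using v by (simp add: W_def)
  ultimately have W: "W = carrier_vec d" using v(2) by auto
  have "M = c \<cdot>\<^sub>m 1\<^sub>m d"
  proof (rule eq_matI)
    fix i j assume "i < dim_row (c \<cdot>\<^sub>m 1\<^sub>m d)" "j < dim_col (c \<cdot>\<^sub>m 1\<^sub>m d)"
    then have ij: "i < d" "j < d" by auto
    have "unit_vec d j \<in> W" using W by simp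
    then have "(M *\<^sub>v unit_vec d j) $ i = (c \<cdot>\<^sub>v unit_vec d j) $ i" by (simp add: W_def)
    then show "M $$ (i, j) = (c \<cdot>\<^sub>m 1\<^sub>m d) $$ (i, j)"
      using M ij scalar_prod_right_unit[OF ij(2), of "row M i"] by (auto simp: index_unit_vec)
  qed (use M in auto)
  then show ?thesis by (rule that)
qed

text \<open>The left-hand sides are the entries of the sum of the conjugates \<rho>(p) E
  \<rho>(p)^-1, where E is the matrix unit at (i, j). This matrix commutes with the representation,
  so it is scalar, and its trace is n! times the trace of E.\<close>

lemma schur_orthogonality:
  assumes "i < d" "j < d" "a < d" "b < d"
  shows "(\<Sum>p | p permutes {1..n}. \<rho> p $$ (a, i) * \<rho> (inv' p) $$ (j, b))
       = (if a = b \<and> i = j then fact n / of_nat d else 0)"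
proof -
  let ?G = "{p. p permutes {1..n}}"
  note car = rep_carrier[OF irr_rep] and mul = rep_mult[OF irr_rep]
  define M where "M = mat d d (\<lambda>(a, b). \<Sum>p\<in>?G. \<rho> p $$ (a, i) * \<rho> (inv' p) $$ (j, b))"
  have M: "M \<in> carrier_mat d d" by (simp add: M_def)
  have "\<rho> h * M = M * \<rho> h" if h: "h permutes {1..n}" for h
  proof (rule eq_matI)
    fix a b assume "a < dim_row (M * \<rho> h)" "b < dim_col (M * \<rho> h)"
    then have ab: "a < d" "b < d" using M car[OF h] by auto
    have "(\<rho> h * M) $$ (a, b) = (\<Sum>k<d. \<Sum>p\<in>?G. \<rho> h $$ (a, k) * \<rho> p $$ (k, i) * \<rho> (inv' p) $$ (j, b))"
      unfolding index_mult_mat_square[OF car[OF h] M ab]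
      by (intro sum.cong refl) (simp add: M_def ab sum_distrib_left mult.assoc)
    also have "\<dots> = (\<Sum>p\<in>?G. \<rho> (h \<circ> p) $$ (a, i) * \<rho> (inv' p) $$ (j, b))"
    proof (subst sum.swap, intro sum.cong refl)
      fix p assume "p \<in> ?G"
      then have p: "p permutes {1..n}" by simp
      show "(\<Sum>k<d. \<rho> h $$ (a, k) * \<rho> p $$ (k, i) * \<rho> (inv' p) $$ (j, b))
          = \<rho> (h \<circ> p) $$ (a, i) * \<rho> (inv' p) $$ (j, b)"
        unfolding mul[OF h p] index_mult_mat_square[OF car[OF h] car[OF p] ab(1) assms(1)]
        by (simp add: sum_distrib_right)
    qed
    also have "\<dots> = (\<Sum>p\<in>?G. \<rho> p $$ (a, i) * \<rho> (inv' p \<circ> h) $$ (j, b))"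
    proof (rule sum.reindex_bij_witness[of _ "\<lambda>p. inv' h \<circ> p" "\<lambda>p. h \<circ> p"])
      fix p assume "p \<in> ?G"
      then have p: "p permutes {1..n}" by simp
      have "inv' (h \<circ> p) \<circ> h = inv' p"
        using permutes_inv_o[OF h] by (simp add: o_inv_distrib permutes_bij[OF h] permutes_bij[OF p] comp_assoc)
      then show "\<rho> (h \<circ> p) $$ (a, i) * \<rho> (inv' (h \<circ> p) \<circ> h) $$ (j, b) = \<rho> (h \<circ> p) $$ (a, i) * \<rho> (inv' p) $$ (j, b)"
        by simp
    qed (use permutes_inv_o[OF h] permutes_compose[OF _ h] permutes_compose[OF _ permutes_inv[OF h]]
      in \<open>simp_all add: comp_assoc[symmetric]\<close>)
    also have "\<dots> = (\<Sum>p\<in>?G. \<Sum>k<d. \<rho> p $$ (a, i) * \<rho> (inv' p) $$ (j, k) * \<rho> h $$ (k, b))"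
    proof (intro sum.cong refl)
      fix p assume "p \<in> ?G"
      then have p: "inv' p permutes {1..n}" by (simp add: permutes_inv)
      show "\<rho> p $$ (a, i) * \<rho> (inv' p \<circ> h) $$ (j, b)
          = (\<Sum>k<d. \<rho> p $$ (a, i) * \<rho> (inv' p) $$ (j, k) * \<rho> h $$ (k, b))"
        unfolding mul[OF p h] index_mult_mat_square[OF car[OF p] car[OF h] assms(2) ab(2)]
        by (simp add: sum_distrib_left mult.assoc)
    qed
    also have "\<dots> = (M * \<rho> h) $$ (a, b)"
      unfolding index_mult_mat_square[OF M car[OF h] ab]
      by (subst sum.swap, intro sum.cong refl) (simp add: M_def ab sum_distrib_right)
    finally show "(\<rho> h * M) $$ (a, b) = (M * \<rho> h) $$ (a, b)" .
  qed (use M car[OF h] in auto)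
  then obtain c where c: "M = c \<cdot>\<^sub>m 1\<^sub>m d" using schur[OF M] by blast
  have "of_nat d * c = (\<Sum>a<d. M $$ (a, a))" by (simp add: c)
  also have "\<dots> = (\<Sum>p\<in>?G. \<Sum>a<d. \<rho> (inv' p) $$ (j, a) * \<rho> p $$ (a, i))"
    by (subst sum.swap) (simp add: M_def mult.commute)
  also have "\<dots> = (\<Sum>p\<in>?G. (1\<^sub>m d :: complex mat) $$ (j, i))"
  proof (intro sum.cong refl)
    fix p assume "p \<in> ?G"
    then have p: "p permutes {1..n}" by simp
    show "(\<Sum>a<d. \<rho> (inv' p) $$ (j, a) * \<rho> p $$ (a, i)) = (1\<^sub>m d :: complex mat) $$ (j, i)"
      unfolding rep_inv(2)[OF irr_rep p, symmetric]
        index_mult_mat_square[OF car[OF permutes_inv[OF p]] car[OF p] assms(2,1)] ..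
  qed
  also have "\<dots> = (if i = j then fact n else 0)"
    using assms card_permutations[of "{1..n}" n] by simp
  finally have "c = (if i = j then fact n / of_nat d else 0)"
    using irr_dim by (simp add: field_simps split: if_splits)
  moreover have "M $$ (a, b) = (if a = b then c else 0)"
    unfolding c using assms(3,4) by (simp add: index_smult_mat)
  ultimately show ?thesis using assms by (simp add: M_def)
qed

lemma irreducible_norm:
  "(\<Sum>p | p permutes {1..n}. mat_trace (\<rho> p) * mat_trace (\<rho> (inv' p))) = fact n"
proof -
  let ?G = "{p. p permutes {1..n}}"
  note car = rep_carrier[OF irr_rep]
  have "(\<Sum>p\<in>?G. mat_trace (\<rho> p) * mat_trace (\<rho> (inv' p)))
      = (\<Sum>p\<in>?G. \<Sum>a<d. \<Sum>b<d. \<rho> p $$ (a, a) * \<rho> (inv' p) $$ (b, b))"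
  proof (intro sum.cong refl)
    fix p assume "p \<in> ?G"
    then have p: "p permutes {1..n}" by simp
    show "mat_trace (\<rho> p) * mat_trace (\<rho> (inv' p)) = (\<Sum>a<d. \<Sum>b<d. \<rho> p $$ (a, a) * \<rho> (inv' p) $$ (b, b))"
      using car[OF p] car[OF permutes_inv[OF p]] by (simp add: mat_trace_def sum_product)
  qed
  also have "\<dots> = (\<Sum>a<d. \<Sum>p\<in>?G. \<Sum>b<d. \<rho> p $$ (a, a) * \<rho> (inv' p) $$ (b, b))"
    by (rule sum.swap)
  also have "\<dots> = (\<Sum>a<d. \<Sum>b<d. \<Sum>p\<in>?G. \<rho> p $$ (a, a) * \<rho> (inv' p) $$ (b, b))"
    by (intro sum.cong refl sum.swap)
  also have "\<dots> = (\<Sum>a<d. \<Sum>b<d. if a = b then fact n / of_nat d else 0)"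
    by (intro sum.cong refl) (simp add: schur_orthogonality del: One_nat_def)
  also have "\<dots> = fact n" using irr_dim by simp
  finally show ?thesis .
qed

end

section \<open>Irreducible characters are given by Frobenius' formula\<close>

text \<open>By the orbit-stabiliser theorem each F carries the weight 1 / (orbit size), so every
  orbit contributes its common value of \<psi> once.\<close>

lemma orbit_sum_Ints:
  fixes \<psi> :: "('a \<Rightarrow> 'b) \<Rightarrow> complex"
  assumes S: "finite S" and E: "finite E"
    and act: "\<And>F g. F \<in> E \<Longrightarrow> g permutes S \<Longrightarrow> F \<circ> g \<in> E"
    and inv: "\<And>F g. F \<in> E \<Longrightarrow> g permutes S \<Longrightarrow> \<psi> (F \<circ> g) = \<psi> F"
    and int: "\<And>F. F \<in> E \<Longrightarrow> \<psi> F \<in> \<int>"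
  shows "(\<Sum>F\<in>E. \<psi> F * of_nat (card {g. g permutes S \<and> F \<circ> g = F})) / fact (card S) \<in> \<int>"
proof -
  let ?G = "{g. g permutes S}" and ?stab = "\<lambda>F. {g. g permutes S \<and> F \<circ> g = F}"
  define orb where "orb F = (\<lambda>g. F \<circ> g) ` ?G" for F :: "'a \<Rightarrow> 'b"
  have finG: "finite ?G" using S by (rule finite_permutations)
  have self: "F \<in> orb F" for F
    unfolding orb_def by (rule image_eqI[of _ _ id]) (auto simp: permutes_id)
  have orb_eq: "orb F' = orb F" if F': "F' \<in> orb F" for F F'
  proof -
    obtain h where h: "h permutes S" "F' = F \<circ> h" using F' by (auto simp: orb_def)
    have "F \<circ> g \<in> orb F'" if "g permutes S" for g
      using h that permutes_inv_o(1)[OF h(1)] unfolding orb_def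
      by (intro image_eqI[of _ _ "inv' h \<circ> g"]) (auto simp: permutes_compose permutes_inv comp_assoc[symmetric] rewriteR_comp_comp)
    moreover have "F' \<circ> g \<in> orb F" if "g permutes S" for g
      using h that unfolding orb_def by (intro image_eqI[of _ _ "h \<circ> g"]) (auto simp: permutes_compose comp_assoc)
    ultimately show ?thesis unfolding orb_def by blast
  qed
  have orb_stab: "card (orb F) * card (?stab F) = fact (card S)" for F
  proof -
    \<comment> \<open>The fibre over F' = F o h is the coset of the stabiliser through h.\<close>
    have "card {g \<in> ?G. F \<circ> g = F'} = card (?stab F)" if F': "F' \<in> orb F" for F'
    proof -
      obtain h where h: "h permutes S" "F' = F \<circ> h" using F' by (auto simp: orb_def)
      have inv: "h \<circ> inv' h = id" "inv' h \<circ> h = id" by (simp_all add: permutes_inv_o[OF h(1)])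
      show ?thesis
      proof (rule bij_betw_same_card[of "\<lambda>g. g \<circ> inv' h"], rule bij_betw_byWitness[where f' = "\<lambda>g. g \<circ> h"])
        show "(\<lambda>g. g \<circ> inv' h) ` {g \<in> ?G. F \<circ> g = F'} \<subseteq> ?stab F"
        proof safe
          fix g assume g: "g permutes S" "F' = F \<circ> g"
          show "g \<circ> inv' h permutes S" by (intro permutes_compose permutes_inv h g)
          have eq: "F \<circ> g = F \<circ> h" using g(2) h(2) by simp
          have "F \<circ> (g \<circ> inv' h) = F \<circ> g \<circ> inv' h" by (simp add: comp_assoc)
          also have "\<dots> = F \<circ> (h \<circ> inv' h)" unfolding eq by (simp add: comp_assoc)
          finally show "F \<circ> (g \<circ> inv' h) = F" using inv by simp
        qed
        show "(\<lambda>g. g \<circ> h) ` ?stab F \<subseteq> {g \<in> ?G. F \<circ> g = F'}"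
        proof safe
          fix g assume g: "g permutes S" "F \<circ> g = F"
          show "g \<circ> h permutes S" by (intro permutes_compose h g)
          have "F \<circ> (g \<circ> h) = F \<circ> g \<circ> h" by (simp add: comp_assoc)
          then show "F \<circ> (g \<circ> h) = F'" using g h by simp
        qed
      qed (simp_all add: comp_assoc inv)
    qed
    then have "(\<Sum>F'\<in>orb F. card {g \<in> ?G. F \<circ> g = F'}) = card (orb F) * card (?stab F)" by simp
    moreover have "(\<Sum>F'\<in>orb F. card {g \<in> ?G. F \<circ> g = F'}) = card ?G"
      using sum.group[OF finG, of "orb F" "\<lambda>g. F \<circ> g" "\<lambda>_. 1::nat"] finG by (simp add: orb_def)
    ultimately show ?thesis using S by (simp add: card_permutations)
  qed
  let ?f = "\<lambda>F. \<psi> F * of_nat (card (?stab F)) / fact (card S)"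
  have "(\<Sum>F\<in>E. ?f F) = (\<Sum>O'\<in>orb ` E. \<Sum>F\<in>{F \<in> E. orb F = O'}. ?f F)"
    using E by (intro sum.group[symmetric]) auto
  also have "\<dots> \<in> \<int>"
  proof (rule Ints_sum)
    fix O' assume "O' \<in> orb ` E"
    then obtain F where F: "F \<in> E" "O' = orb F" by blast
    have "{F \<in> E. orb F = O'} = orb F"
    proof (intro equalityI subsetI)
      fix F' assume "F' \<in> orb F"
      then show "F' \<in> {F \<in> E. orb F = O'}"
        using orb_eq[of F' F] F act[OF F(1)] by (auto simp: orb_def)
    qed (use F self in auto)
    moreover have "?f F' = \<psi> F / of_nat (card (orb F))" if "F' \<in> orb F" for F'
    proof -
      have "\<psi> F' = \<psi> F" using that inv[OF F(1)] by (auto simp: orb_def)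
      moreover have "fact (card S) = (of_nat (card (orb F)) * of_nat (card (?stab F')) :: complex)"
        using orb_stab[of F'] orb_eq[OF that] by (metis of_nat_fact of_nat_mult)
      moreover have "(fact (card S) :: complex) \<noteq> 0" by simp
      ultimately show ?thesis by (simp add: divide_simps)
    qed
    moreover have "card (orb F) \<noteq> 0" using orb_stab[of F] by (metis fact_nonzero mult_is_0)
    ultimately show "(\<Sum>F\<in>{F \<in> E. orb F = O'}. ?f F) \<in> \<int>" using int[OF F(1)] by simp
  qed
  finally show ?thesis by (simp add: sum_divide_distrib)
qed

lemma take_off_perm:
  assumes "g permutes S"
  shows "take_off (F \<circ> g) S v = take_off F S v"
proof -
  have "card {a \<in> S. F (g a) = i} = card {a \<in> S. F a = i}" for i
  proof (rule bij_betw_same_card[of g])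
    show "bij_betw g {a \<in> S. F (g a) = i} {a \<in> S. F a = i}"
      by (rule bij_betw_byWitness[where f' = "inv' g"])
        (use permutes_in_image[OF assms] permutes_in_image[OF permutes_inv[OF assms]] permutes_inverses[OF assms] in auto)
  qed
  then show ?thesis by (simp add: take_off_def)
qed

section \<open>Multiplicities of Frobenius characters in an irreducible one\<close>

context
  fixes n d :: nat and \<rho> :: "(nat \<Rightarrow> nat) \<Rightarrow> complex mat"
  assumes irr: "irreducible_representation n d \<rho>"
begin

text \<open>The scalar product m_v of the trace with X_v. No complex conjugation occurs because X_v
  is integer valued.\<close>

definition frob_mult :: "(nat \<Rightarrow> int) \<Rightarrow> complex" where
  "frob_mult v = (\<Sum>p | p permutes {1..n}.
     mat_trace (\<rho> p) * of_int (frob_char n (orbit_type p {1..n}) v)) / fact n"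

text \<open>Exchange the sums over p and over words. For a fixed word the trace is summed over its
  stabiliser, a Young subgroup, where the average is an integer. The stabiliser order that remains
  is absorbed into the division by n! orbit by orbit.\<close>

lemma frob_mult_Ints: "frob_mult v \<in> \<int>"
proof -
  let ?S = "{1..n}" and ?E = "{1..n} \<rightarrow>\<^sub>E {..<n}"
  let ?stab = "\<lambda>F. {g. g permutes {1..n} \<and> F \<circ> g = F}"
  have finE: "finite ?E" by (intro finite_PiE) simp_all
  have words: "words n p ?S = {F \<in> ?E. F \<circ> p = F}" if p: "p permutes ?S" for p
  proof -
    have "F \<circ> p = F \<longleftrightarrow> (\<forall>a\<in>?S. F (p a) = F a)" for F :: "nat \<Rightarrow> nat"
      using permutes_not_in[OF p] by (auto simp: fun_eq_iff)
    then show ?thesis by (simp add: words_def)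
  qed
  let ?\<psi> = "\<lambda>F. of_int (vacuum n (take_off F ?S v)) * ((\<Sum>p\<in>?stab F. mat_trace (\<rho> p)) / of_nat (card (?stab F)))"
  have stab: "finite (?stab F)" "id \<in> ?stab F" for F :: "nat \<Rightarrow> nat"
    by (auto simp: finite_permutations permutes_id)
  have "frob_mult v = (\<Sum>p | p permutes ?S. \<Sum>F\<in>?E. if F \<circ> p = F
      then mat_trace (\<rho> p) * of_int (vacuum n (take_off F ?S v)) else 0) / fact n"
    unfolding frob_mult_def
  proof (intro arg_cong2[where f = "(/)"] sum.cong refl)
    fix p assume "p \<in> {p. p permutes ?S}"
    then have p: "p permutes ?S" by simp
    show "mat_trace (\<rho> p) * of_int (frob_char n (orbit_type p ?S) v) = (\<Sum>F\<in>?E. if F \<circ> p = F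
      then mat_trace (\<rho> p) * of_int (vacuum n (take_off F ?S v)) else 0)"
      unfolding frob_char_words[OF stable_permutes[OF p finite_atLeastAtMost]] words[OF p]
      by (subst sum.inter_filter[OF finE, symmetric]) (simp add: sum_distrib_left)
  qed
  also have "\<dots> = (\<Sum>F\<in>?E. \<Sum>p | p permutes ?S. if F \<circ> p = F
      then mat_trace (\<rho> p) * of_int (vacuum n (take_off F ?S v)) else 0) / fact n"
    by (subst sum.swap) (rule refl)
  also have "\<dots> = (\<Sum>F\<in>?E. ?\<psi> F * of_nat (card (?stab F))) / fact n"
  proof (intro arg_cong2[where f = "(/)"] sum.cong refl)
    fix F :: "nat \<Rightarrow> nat"
    have "card (?stab F) \<noteq> 0" using stab[of F] by (metis card_eq_0_iff empty_iff)
    moreover have "(\<Sum>p | p permutes ?S. if F \<circ> p = F then mat_trace (\<rho> p) * of_int (vacuum n (take_off F ?S v)) else 0)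
        = (\<Sum>p\<in>?stab F. mat_trace (\<rho> p) * of_int (vacuum n (take_off F ?S v)))"
      by (subst sum.inter_filter[symmetric]) (auto simp: finite_permutations)
    ultimately show "(\<Sum>p | p permutes ?S. if F \<circ> p = F then mat_trace (\<rho> p) * of_int (vacuum n (take_off F ?S v)) else 0)
        = ?\<psi> F * of_nat (card (?stab F))"
      by (simp add: sum_distrib_right[symmetric] mult.commute)
  qed
  also have "\<dots> \<in> \<int>"
  proof -
    have "(\<Sum>F\<in>?E. ?\<psi> F * of_nat (card (?stab F))) / fact (card ?S) \<in> \<int>"
    proof (rule orbit_sum_Ints)
      fix F g assume F: "F \<in> ?E" and g: "g permutes ?S"
      show "F \<circ> g \<in> ?E"
        using F permutes_in_image[OF g] permutes_not_in[OF g] by (auto simp: PiE_iff extensional_def)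
      define gi where "gi = inv' g"
      have gi: "gi permutes ?S" "g \<circ> gi = id" "gi \<circ> g = id"
        using g by (simp_all add: gi_def permutes_inv permutes_inv_o del: One_nat_def)
      \<comment> \<open>Words in one orbit have conjugate stabilisers, and conjugation does not
        change traces.\<close>
      have "bij_betw (\<lambda>p. g \<circ> p \<circ> gi) (?stab (F \<circ> g)) (?stab F)"
      proof (rule bij_betw_byWitness[where f' = "\<lambda>p. gi \<circ> p \<circ> g"])
        have a: "gi \<circ> (g \<circ> p \<circ> gi) \<circ> g = p" "g \<circ> (gi \<circ> p \<circ> g) \<circ> gi = p" for p :: "nat \<Rightarrow> nat"
          using gi(2,3) by (simp_all add: fun_eq_iff)
        show "\<forall>p\<in>?stab (F \<circ> g). gi \<circ> (g \<circ> p \<circ> gi) \<circ> g = p" "\<forall>p\<in>?stab F. g \<circ> (gi \<circ> p \<circ> g) \<circ> gi = p"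
          using a by auto
        show "(\<lambda>p. g \<circ> p \<circ> gi) ` ?stab (F \<circ> g) \<subseteq> ?stab F"
        proof (intro image_subsetI CollectI conjI)
          fix p assume p: "p \<in> ?stab (F \<circ> g)"
          show "g \<circ> p \<circ> gi permutes ?S" using p g gi(1) by (auto intro!: permutes_compose)
          have "F \<circ> (g \<circ> p \<circ> gi) = (F \<circ> g \<circ> p) \<circ> gi" by (simp add: comp_assoc)
          also have "\<dots> = F \<circ> (g \<circ> gi)" using p by (simp add: comp_assoc)
          finally show "F \<circ> (g \<circ> p \<circ> gi) = F" using gi(2) by simp
        qed
        show "(\<lambda>p. gi \<circ> p \<circ> g) ` ?stab F \<subseteq> ?stab (F \<circ> g)"
        proof (intro image_subsetI CollectI conjI)
          fix p assume p: "p \<in> ?stab F"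
          show "gi \<circ> p \<circ> g permutes ?S" using p g gi(1) by (auto intro!: permutes_compose)
          have "F \<circ> g \<circ> (gi \<circ> p \<circ> g) = F \<circ> (g \<circ> gi) \<circ> p \<circ> g" by (simp add: comp_assoc)
          also have "\<dots> = F \<circ> g" using p gi(2) by simp
          finally show "F \<circ> g \<circ> (gi \<circ> p \<circ> g) = F \<circ> g" .
        qed
      qed
      then have card: "card (?stab (F \<circ> g)) = card (?stab F)"
        and sum: "(\<Sum>p\<in>?stab (F \<circ> g). mat_trace (\<rho> (g \<circ> p \<circ> gi))) = (\<Sum>p\<in>?stab F. mat_trace (\<rho> p))"
        by (rule bij_betw_same_card, rule sum.reindex_bij_betw)
      have "mat_trace (\<rho> (g \<circ> p \<circ> gi)) = mat_trace (\<rho> p)" if p: "p \<in> ?stab (F \<circ> g)" for p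
      proof (rule trace_conjugate[OF irr_rep[OF irr], of _ _ gi])
        show "g \<circ> p \<circ> gi permutes ?S" using p g gi(1) by (auto intro!: permutes_compose)
        show "gi \<circ> (g \<circ> p \<circ> gi) = p \<circ> gi" using gi(3) by (simp add: fun_eq_iff)
      qed (use p gi in auto)
      then show "?\<psi> (F \<circ> g) = ?\<psi> F"
        using card sum by (simp add: take_off_perm[OF g] del: One_nat_def)
    next
      fix F assume "F \<in> ?E"
      show "?\<psi> F \<in> \<int>"
      proof (intro Ints_mult sum_trace_subgroup[OF irr_rep[OF irr]])
        show "?stab F \<noteq> {}" using stab(2) by blast
        show "p \<circ> q \<in> ?stab F" if "p \<in> ?stab F" "q \<in> ?stab F" for p q
          using that by (auto simp: permutes_compose comp_assoc[symmetric])
      qed auto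
    qed (use finE in simp_all)
    then show ?thesis by simp
  qed
  finally show ?thesis .
qed

text \<open>Each x admits exactly one p, namely x^-1 q x, and its trace is that of q.\<close>

lemma sum_conjugates:
  assumes q: "q permutes {1..n}"
  shows "(\<Sum>p | p permutes {1..n}. mat_trace (\<rho> p) * of_nat (card {x. x permutes {1..n} \<and> x \<circ> p = q \<circ> x}))
       = fact n * mat_trace (\<rho> q)"
proof -
  let ?G = "{p. p permutes {1..n}}"
  have fin: "finite ?G" by (simp add: finite_permutations)
  have "(\<Sum>p\<in>?G. mat_trace (\<rho> p) * of_nat (card {x. x permutes {1..n} \<and> x \<circ> p = q \<circ> x}))
      = (\<Sum>p\<in>?G. \<Sum>x\<in>?G. if x \<circ> p = q \<circ> x then mat_trace (\<rho> p) else 0)"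
  proof (intro sum.cong refl)
    fix p
    have "{x. x permutes {1..n} \<and> x \<circ> p = q \<circ> x} = {x \<in> ?G. x \<circ> p = q \<circ> x}" by simp
    then show "mat_trace (\<rho> p) * of_nat (card {x. x permutes {1..n} \<and> x \<circ> p = q \<circ> x})
      = (\<Sum>x\<in>?G. if x \<circ> p = q \<circ> x then mat_trace (\<rho> p) else 0)"
      using fin by (simp add: sum.inter_filter[symmetric] mult.commute del: One_nat_def)
  qed
  also have "\<dots> = (\<Sum>x\<in>?G. \<Sum>p\<in>?G. if x \<circ> p = q \<circ> x then mat_trace (\<rho> p) else 0)" by (rule sum.swap)
  also have "\<dots> = (\<Sum>x\<in>?G. mat_trace (\<rho> q))"
  proof (intro sum.cong refl)
    fix x assume "x \<in> ?G"
    then have x: "x permutes {1..n}" by simp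
    let ?r = "inv' x \<circ> (q \<circ> x)"
    have r: "?r permutes {1..n}" by (intro permutes_compose permutes_inv x q)
    have xr: "x \<circ> ?r = q \<circ> x" using permutes_inv_o(1)[OF x] by (simp add: comp_assoc[symmetric])
    have "x \<circ> p = q \<circ> x \<longleftrightarrow> p = ?r" for p
    proof
      assume "x \<circ> p = q \<circ> x"
      then have "?r = (inv' x \<circ> x) \<circ> p" by (simp add: comp_assoc)
      then show "p = ?r" using permutes_inv_o(2)[OF x] by simp
    qed (use xr in simp)
    then have "(\<Sum>p\<in>?G. if x \<circ> p = q \<circ> x then mat_trace (\<rho> p) else 0)
        = (\<Sum>p\<in>?G. if p = ?r then mat_trace (\<rho> p) else 0)" by simp
    also have "\<dots> = mat_trace (\<rho> ?r)" using fin r by simp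
    also have "\<dots> = mat_trace (\<rho> q)" by (rule trace_conjugate[OF irr_rep[OF irr] r q x xr])
    finally show "(\<Sum>p\<in>?G. if x \<circ> p = q \<circ> x then mat_trace (\<rho> p) else 0) = mat_trace (\<rho> q)" .
  qed
  also have "\<dots> = fact n * mat_trace (\<rho> q)" using card_permutations[of "{1..n}" n] by simp
  finally show ?thesis .
qed

text \<open>Summing over v first turns the products of Frobenius characters into numbers of
  conjugating permutations.\<close>

lemma sum_frob_mult_frob_char:
  assumes q: "q permutes {1..n}"
  shows "(\<Sum>v\<in>configs n n. frob_mult v * of_int (frob_char n (orbit_type q {1..n}) v)) = fact n * mat_trace (\<rho> q)"
proof -
  let ?G = "{p. p permutes {1..n}}" and ?T = "\<lambda>p. orbit_type p {1..n}"
  have "(\<Sum>v\<in>configs n n. frob_mult v * of_int (frob_char n (?T q) v))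
      = (\<Sum>v\<in>configs n n. \<Sum>p\<in>?G. mat_trace (\<rho> p) * of_int (frob_char n (?T p) v * frob_char n (?T q) v)) / fact n"
    by (simp add: frob_mult_def sum_distrib_right sum_divide_distrib mult.assoc)
  also have "\<dots> = (\<Sum>p\<in>?G. \<Sum>v\<in>configs n n. mat_trace (\<rho> p) * of_int (frob_char n (?T p) v * frob_char n (?T q) v)) / fact n"
    by (subst sum.swap) (rule refl)
  also have "\<dots> = (\<Sum>p\<in>?G. mat_trace (\<rho> p) * of_int (gram n n (?T p) (?T q))) / fact n"
    by (simp add: gram_def sum_distrib_left)
  also have "\<dots> = (\<Sum>p\<in>?G. mat_trace (\<rho> p) * of_nat (card {x. x permutes {1..n} \<and> x \<circ> p = q \<circ> x}))"
    unfolding sum_divide_distrib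
  proof (intro sum.cong refl)
    fix p assume "p \<in> ?G"
    then have p: "p permutes {1..n}" by simp
    have "gram n n (?T p) (?T q) = fact n * int (card {x. x permutes {1..n} \<and> x \<circ> p = q \<circ> x})"
      using gram_conjugators[OF p q finite_atLeastAtMost, of n] by simp
    then show "mat_trace (\<rho> p) * of_int (gram n n (?T p) (?T q)) / fact n
      = mat_trace (\<rho> p) * of_nat (card {x. x permutes {1..n} \<and> x \<circ> p = q \<circ> x})"
      by (simp del: One_nat_def)
  qed
  finally show ?thesis by (simp only: sum_conjugates[OF q])
qed

text \<open>Expand one factor by its definition and apply the inversion formula to the other. This
  yields the trace at p twice, whereas orthogonality pairs p with its inverse. These two are
  conjugate, having the same orbits.\<close>

lemma sum_frob_mult_square: "(\<Sum>v\<in>configs n n. frob_mult v * frob_mult v) = fact n"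
proof -
  let ?G = "{p. p permutes {1..n}}" and ?T = "\<lambda>p. orbit_type p {1..n}"
  have "(\<Sum>v\<in>configs n n. frob_mult v * frob_mult v)
      = (\<Sum>v\<in>configs n n. \<Sum>p\<in>?G. mat_trace (\<rho> p) * (frob_mult v * of_int (frob_char n (?T p) v))) / fact n"
    by (simp add: frob_mult_def[of "_ :: nat \<Rightarrow> int"] sum_distrib_left sum_divide_distrib mult_ac)
  also have "\<dots> = (\<Sum>p\<in>?G. \<Sum>v\<in>configs n n. mat_trace (\<rho> p) * (frob_mult v * of_int (frob_char n (?T p) v))) / fact n"
    by (subst sum.swap) (rule refl)
  also have "\<dots> = (\<Sum>p\<in>?G. mat_trace (\<rho> p) * mat_trace (\<rho> (inv' p)))"
  proof (subst sum_divide_distrib, intro sum.cong refl)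
    fix p assume "p \<in> ?G"
    then have p: "p permutes {1..n}" by simp
    have "orbit (inv' p) = orbit p"
      using orbit_inv_eq[OF permutes_imp_permutation[OF _ p]] by auto
    then have "?T p = ?T (inv' p)" by (simp add: orbit_type_def)
    then obtain x where "x permutes {1..n}" "x \<circ> p = inv' p \<circ> x"
      using same_type_conjugate[OF p permutes_inv[OF p] finite_atLeastAtMost] by blast
    then have "mat_trace (\<rho> p) = mat_trace (\<rho> (inv' p))"
      by (rule trace_conjugate[OF irr_rep[OF irr] p permutes_inv[OF p]])
    then show "(\<Sum>v\<in>configs n n. mat_trace (\<rho> p) * (frob_mult v * of_int (frob_char n (?T p) v))) / fact n
      = mat_trace (\<rho> p) * mat_trace (\<rho> (inv' p))"
      unfolding sum_distrib_left[symmetric] sum_frob_mult_frob_char[OF p] by simp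
  qed
  finally show ?thesis using irreducible_norm[OF irr] by simp
qed

lemma frob_mult_perm:
  assumes "w permutes {..<n}" shows "frob_mult (v \<circ> w) = of_int (sign w) * frob_mult v"
  by (simp add: frob_mult_def alternating_perm[OF alternating_frob_char assms] sum_distrib_left mult_ac)

text \<open>A nonzero integer m_v contributes at least 1 at each of the n! arrangements of v. This
  exhausts the total n!, so m vanishes elsewhere, and the inversion formula reduces to one orbit
  with \<epsilon> = m_v.\<close>

theorem irreducible_frob_char:
  obtains v \<epsilon> where "v \<in> configs n n" "inj_on v {..<n}" "\<epsilon> \<noteq> 0"
    "\<And>p. p permutes {1..n} \<Longrightarrow> mat_trace (\<rho> p) = \<epsilon> * of_int (frob_char n (orbit_type p {1..n}) v)"
proof -
  have "\<forall>v. \<exists>k. frob_mult v = of_int k" using frob_mult_Ints by (auto simp: Ints_def)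
  then obtain m where m: "\<And>v. frob_mult v = of_int (m v)" by metis
  have "(of_int (\<Sum>v\<in>configs n n. m v * m v) :: complex) = of_int (fact n)"
    using sum_frob_mult_square by (simp add: m)
  then have sq: "(\<Sum>v\<in>configs n n. m v * m v) = fact n" by (simp only: of_int_eq_iff)
  then obtain v where v: "v \<in> configs n n" "m v \<noteq> 0"
    by (metis (no_types, lifting) fact_nonzero mult_zero_left sum.neutral)
  have m_perm: "m (u \<circ> w) = sign w * m u" if "w permutes {..<n}" for u w
    using frob_mult_perm[OF that, of u] unfolding m of_int_mult[symmetric] of_int_eq_iff .
  then have alt: "alternating n m" by (auto simp: alternating_def)
  have inj: "inj_on v {..<n}" using v(2) alternating_not_inj[OF alt] by blast
  let ?W = "{w. w permutes {..<n}}"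
  have injW: "inj_on (\<lambda>w. v \<circ> w) ?W"
  proof (rule inj_onI)
    fix w w' assume w: "w \<in> ?W" "w' \<in> ?W" and eq: "v \<circ> w = v \<circ> w'"
    show "w = w'"
    proof
      fix i
      show "w i = w' i"
      proof (cases "i < n")
        case True
        then have "w i < n" "w' i < n" using w by (metis lessThan_iff mem_Collect_eq permutes_in_image)+
        then show ?thesis using inj fun_cong[OF eq, of i] by (simp add: inj_on_def)
      qed (use w in \<open>auto simp: permutes_def\<close>)
    qed
  qed
  let ?O = "(\<lambda>w. v \<circ> w) ` ?W"
  have sub: "?O \<subseteq> configs n n"
  proof (intro image_subsetI)
    fix w assume "w \<in> ?W"
    then have w: "w permutes {..<n}" by simp
    show "v \<circ> w \<in> configs n n"
      using v(1) sum.permute[OF w, of v] nonneg_perm[OF w, of v] permutes_not_in[OF w]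
      by (auto simp: configs_def o_def)
  qed
  have sign2: "sign w * sign w = 1" for w :: "nat \<Rightarrow> nat" by (simp add: sign_def)
  \<comment> \<open>Two alternating factors have a product that is constant on the arrangements of
    v.\<close>
  have orbit_sum: "(\<Sum>u\<in>?O. m u * f u) = fact n * (m v * f v)"
    if f: "\<And>w. w permutes {..<n} \<Longrightarrow> f (v \<circ> w) = sign w * f v" for f :: "(nat \<Rightarrow> int) \<Rightarrow> int"
  proof -
    have "(\<Sum>u\<in>?O. m u * f u) = (\<Sum>w\<in>?W. m (v \<circ> w) * f (v \<circ> w))"
      by (simp add: sum.reindex[OF injW])
    also have "\<dots> = (\<Sum>w\<in>?W. (sign w * sign w) * (m v * f v))"
      by (intro sum.cong refl) (simp add: m_perm f mult_ac)
    also have "\<dots> = fact n * (m v * f v)" by (simp add: sign2 card_permutations)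
    finally show ?thesis .
  qed
  have split: "fact n = fact n * (m v * m v) + (\<Sum>u\<in>configs n n - ?O. m u * m u)"
    using sq sum.subset_diff[OF sub finite_configs, of "\<lambda>u. m u * m u"] orbit_sum[OF m_perm] by simp
  moreover have "1 \<le> m v * m v" using v(2) by (metis int_one_le_iff_zero_less not_square_less_zero linorder_cases mult_eq_0_iff)
  then have "fact n \<le> fact n * (m v * m v)" by simp
  moreover have nn: "0 \<le> (\<Sum>u\<in>configs n n - ?O. m u * m u)" by (intro sum_nonneg) simp
  ultimately have rest: "(\<Sum>u\<in>configs n n - ?O. m u * m u) = 0" by linarith
  have zero: "m u = 0" if "u \<in> configs n n - ?O" for u
    using rest that sum_nonneg_eq_0_iff[of "configs n n - ?O" "\<lambda>u. m u * m u"] finite_configs by auto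
  show ?thesis
  proof (rule that[of v "of_int (m v)"])
    fix p assume p: "p permutes {1..n}"
    let ?X = "frob_char n (orbit_type p {1..n})"
    have "fact n * mat_trace (\<rho> p) = of_int (\<Sum>u\<in>configs n n. m u * ?X u)"
      using sum_frob_mult_frob_char[OF p] by (simp add: m)
    also have "(\<Sum>u\<in>configs n n. m u * ?X u) = (\<Sum>u\<in>?O. m u * ?X u)"
      using zero by (intro sum.mono_neutral_right finite_configs sub) auto
    also have "\<dots> = fact n * (m v * ?X v)"
      by (rule orbit_sum) (rule alternating_perm[OF alternating_frob_char])
    finally show "mat_trace (\<rho> p) = of_int (m v) * of_int (?X v)" by simp
  qed (use v inj in auto)
qed

end

section \<open>Maya diagrams and principal hooks\<close>

definition hooks :: "nat list \<Rightarrow> nat list \<Rightarrow> nat list" where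
  "hooks as bs = map2 (\<lambda>a b. a + b + 1) as bs"

lemma hooks_simps [simp]:
  "hooks [] [] = []" "hooks (a # as) (b # bs) = (a + b + 1) # hooks as bs"
  by (simp_all add: hooks_def)

lemma length_hooks [simp]: "length as = length bs \<Longrightarrow> length (hooks as bs) = length as"
  by (simp add: hooks_def)

lemma zero_notin_hooks: "0 \<notin> set (hooks as bs)"
  by (auto simp: hooks_def)

text \<open>The Maya diagram: \<open>v\<close> takes all the values \<open>0, \<dots>, N - 1\<close> except the \<open>N - 1 - b\<close>, and the
  values \<open>N + a\<close>.\<close>

definition frob_coords :: "nat \<Rightarrow> (nat \<Rightarrow> int) \<Rightarrow> nat list \<Rightarrow> nat list \<Rightarrow> bool" where
  "frob_coords N v as bs \<longleftrightarrow> nonneg N v \<and> inj_on v {..<N} \<and> length as = length bs \<and>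
     sorted_wrt (>) as \<and> sorted_wrt (>) bs \<and> (\<forall>b\<in>set bs. b < N) \<and>
     (\<forall>x. int x \<in> v ` {..<N} \<longleftrightarrow> (if x < N then N - 1 - x \<notin> set bs else x - N \<in> set as))"

text \<open>As there are N beads in all, the beads from N upwards are as many as the gaps below
  N.\<close>

lemma frob_coords_exist:
  assumes nn: "nonneg N v" and inj: "inj_on v {..<N}"
  obtains as bs where "frob_coords N v as bs"
proof -
  define A where "A = {a. int (N + a) \<in> v ` {..<N}}"
  define B where "B = {b. b < N \<and> int (N - 1 - b) \<notin> v ` {..<N}}"
  have finB: "finite B" by (simp add: B_def)
  have "inj_on (\<lambda>a. int (N + a)) A" by (auto simp: inj_on_def)
  moreover have "(\<lambda>a. int (N + a)) ` A \<subseteq> v ` {..<N}" by (auto simp: A_def)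
  ultimately have finA: "finite A" by (meson finite_imageD finite_imageI finite_lessThan finite_subset)
  let ?C = "(\<lambda>b. N - 1 - b) ` B"
  have injC: "inj_on (\<lambda>b. N - 1 - b) B" by (auto simp: inj_on_def B_def)
  have subC: "?C \<subseteq> {..<N}" by (auto simp: B_def)
  have range: "v ` {..<N} = int ` ({..<N} - ?C) \<union> (\<lambda>a. int (N + a)) ` A"
  proof (intro equalityI subsetI)
    fix z assume z: "z \<in> v ` {..<N}"
    then have "0 \<le> z" using nn by (auto simp: nonneg_def)
    then obtain x where x: "z = int x" using zero_le_imp_eq_int by blast
    show "z \<in> int ` ({..<N} - ?C) \<union> (\<lambda>a. int (N + a)) ` A"
    proof (cases "x < N")
      case True
      have "x \<notin> ?C" using z x by (auto simp: B_def)
      then show ?thesis using True x by auto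
    next
      case False
      then have "x - N \<in> A" "z = int (N + (x - N))" using z x by (auto simp: A_def)
      then show ?thesis by blast
    qed
  next
    fix z assume "z \<in> int ` ({..<N} - ?C) \<union> (\<lambda>a. int (N + a)) ` A"
    then show "z \<in> v ` {..<N}"
    proof
      assume "z \<in> int ` ({..<N} - ?C)"
      then obtain x where x: "z = int x" "x < N" "x \<notin> ?C" by auto
      have "x = N - 1 - (N - 1 - x)" using x by simp
      then have "N - 1 - x \<notin> B" using x(3) by blast
      then show ?thesis using x by (auto simp: B_def)
    qed (auto simp: A_def)
  qed
  have "N = card (v ` {..<N})" using inj by (simp add: card_image)
  also have "\<dots> = card (int ` ({..<N} - ?C)) + card ((\<lambda>a. int (N + a)) ` A)"
    unfolding range using finA by (intro card_Un_disjoint) auto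
  also have "\<dots> = (N - card B) + card A"
    using card_Diff_subset[OF finite_subset[OF subC] subC] injC
    by (simp add: card_image inj_on_def)
  finally have "card A = card B" using card_mono[OF _ subC] injC by (simp add: card_image)
  have "frob_coords N v (rev (sorted_list_of_set A)) (rev (sorted_list_of_set B))"
    unfolding frob_coords_def
  proof (intro conjI allI)
    fix x
    show "int x \<in> v ` {..<N} \<longleftrightarrow> (if x < N then N - 1 - x \<notin> set (rev (sorted_list_of_set B))
        else x - N \<in> set (rev (sorted_list_of_set A)))"
      using finA finB by (auto simp: A_def B_def)
  qed (use nn inj finA finB \<open>card A = card B\<close> in
      \<open>auto simp: sorted_wrt_rev B_def[symmetric] strict_sorted_list_of_set[simplified]\<close>,
      auto simp: B_def)
  then show ?thesis by (rule that)
qed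

text \<open>Moving the highest bead into the lowest gap strips the outermost principal hook.\<close>

lemma frob_coords_Cons:
  assumes fc: "frob_coords N v (a # as) (b # bs)"
  obtains i where "i < N" "v i = int (N + a)" "frob_coords N (v(i := int (N - 1 - b))) as bs"
proof -
  have b: "b < N" "b \<notin> set bs" "a \<notin> set as" using fc by (auto simp: frob_coords_def)
  have mem: "int x \<in> v ` {..<N} \<longleftrightarrow> (if x < N then N - 1 - x \<notin> insert b (set bs) else x - N \<in> insert a (set as))" for x
    using fc by (auto simp: frob_coords_def)
  have "int (N + a) \<in> v ` {..<N}" using mem[of "N + a"] by (simp del: of_nat_add)
  then obtain i where i: "i < N" "v i = int (N + a)" by (metis imageE lessThan_iff)
  have inj: "inj_on v {..<N}" using fc by (simp add: frob_coords_def)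
  have nv: "int (N - 1 - b) \<notin> v ` {..<N}" using mem[of "N - 1 - b"] b(1) by (simp del: of_nat_diff)
  let ?v = "v(i := int (N - 1 - b))"
  have "inj_on ?v {..<N}" using inj nv by (intro inj_on_fun_updI) auto
  moreover have "nonneg N ?v" using fc by (auto simp: frob_coords_def nonneg_def)
  moreover have "int x \<in> ?v ` {..<N} \<longleftrightarrow> (if x < N then N - 1 - x \<notin> set bs else x - N \<in> set as)" for x
  proof -
    have "?v ` {..<N} = insert (int (N - 1 - b)) (v ` {..<N} - {v i})"
      using i(1) inj by (auto simp: inj_on_def)
    then have "int x \<in> ?v ` {..<N} \<longleftrightarrow> x = N - 1 - b \<or> (int x \<in> v ` {..<N} \<and> x \<noteq> N + a)"
      unfolding i(2) by auto
    also have "\<dots> \<longleftrightarrow> (if x < N then N - 1 - x \<notin> set bs else x - N \<in> set as)"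
      using fc b by (auto simp: frob_coords_def)
    finally show ?thesis .
  qed
  ultimately have "frob_coords N ?v as bs" using fc by (auto simp: frob_coords_def)
  with i show ?thesis by (rule that)
qed

text \<open>Relative to the ground state, beads at N - 1 - b are replaced by beads at N + a. The
  identity function will give the size, the quadratic one in \<open>content2\<close> the content
  sum.\<close>

lemma frob_coords_sum:
  assumes "frob_coords N v as bs"
  shows "(\<Sum>i<N. f (v i)) + (\<Sum>b\<leftarrow>bs. f (int N - 1 - int b))
       = (\<Sum>i<N. f (int i)) + (\<Sum>a\<leftarrow>as. f (int N + int a) :: int)"
proof -
  have "length as = length bs" using assms by (simp add: frob_coords_def)
  then show ?thesis
    using assms
  proof (induction as bs arbitrary: v rule: list_induct2)
    case Nil
    have inj: "inj_on v {..<N}" and nn: "nonneg N v"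
      and mem: "\<And>x. int x \<in> v ` {..<N} \<longleftrightarrow> x < N" using Nil by (auto simp: frob_coords_def)
    have "v ` {..<N} = int ` {..<N}"
    proof (intro equalityI subsetI)
      fix z assume z: "z \<in> v ` {..<N}"
      then have "0 \<le> z" using nn by (auto simp: nonneg_def)
      then obtain x where x: "z = int x" using zero_le_imp_eq_int by blast
      then show "z \<in> int ` {..<N}" using z mem by auto
    qed (use mem in auto)
    then have "(\<Sum>i<N. f (v i)) = (\<Sum>i<N. f (int i))"
      using sum.reindex[OF inj, of f] sum.reindex[of int "{..<N}" f] by (simp add: o_def)
    then show ?case by simp
  next
    case (Cons a as b bs)
    have "b < N" using Cons.prems by (simp add: frob_coords_def)
    obtain i where i: "i < N" "v i = int (N + a)" "frob_coords N (v(i := int (N - 1 - b))) as bs"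
      using frob_coords_Cons[OF Cons.prems] by blast
    have "(\<Sum>j<N. f (v j)) = f (int (N + a)) + (\<Sum>j\<in>{..<N} - {i}. f (v j))"
      using i by (simp add: sum.remove[of "{..<N}" i])
    moreover have "(\<Sum>j<N. f ((v(i := y)) j)) = f y + (\<Sum>j\<in>{..<N} - {i}. f (v j))" for y
      using i(1) by (simp add: sum.remove[of "{..<N}" i])
    moreover have "int (N - 1 - b) = int N - 1 - int b" using \<open>b < N\<close> by simp
    ultimately show ?case using Cons.IH[OF i(3)] by simp
  qed
qed

lemma sum_list_hooks:
  "length as = length bs \<Longrightarrow> int (sum_list (hooks as bs)) = (\<Sum>a\<leftarrow>as. int a + 1) + (\<Sum>b\<leftarrow>bs. int b)"
  by (induction as bs rule: list_induct2) simp_all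

lemma frob_coords_degree:
  assumes "frob_coords N v as bs"
  shows "(\<Sum>i<N. v i) = degree0 N + int (sum_list (hooks as bs))"
proof -
  have len: "length as = length bs" using assms by (simp add: frob_coords_def)
  have "(\<Sum>b\<leftarrow>bs. int N - 1 - int b) + (\<Sum>b\<leftarrow>bs. int b) = int (length bs) * (int N - 1)"
    by (induction bs) (simp_all add: algebra_simps)
  moreover have "(\<Sum>a\<leftarrow>as. int N + int a) = int (length as) * (int N - 1) + (\<Sum>a\<leftarrow>as. int a + 1)"
    by (induction as) (simp_all add: algebra_simps)
  ultimately show ?thesis
    using frob_coords_sum[OF assms, of "\<lambda>x. x"] sum_list_hooks[OF len] len by (simp add: degree0_def)
qed

text \<open>A hook with arm a and leg b has the contents a, ..., 0, ..., -b, with sum (a(a+1) -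
  b(b+1)) / 2.\<close>

fun content_sum2 :: "nat list \<Rightarrow> nat list \<Rightarrow> int" where
  "content_sum2 (a # as) (b # bs) = int a * (int a + 1) - int b * (int b + 1) + content_sum2 as bs"
| "content_sum2 _ _ = 0"

lemma frob_coords_content2:
  assumes "frob_coords N v as bs"
  shows "content2 N v = content_sum2 as bs"
proof -
  have len: "length as = length bs" using assms by (simp add: frob_coords_def)
  let ?f = "\<lambda>x. x * (x + 1) - 2 * int N * x"
  have "(\<Sum>a\<leftarrow>as. ?f (int N + int a)) - (\<Sum>b\<leftarrow>bs. ?f (int N - 1 - int b)) = content_sum2 as bs"
    using len by (induction as bs rule: list_induct2) (simp_all add: algebra_simps)
  then show ?thesis using frob_coords_sum[OF assms, of ?f] by (simp add: content2_def)
qed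

text \<open>No bead lies above N + a, and all positions below the gap N - 1 - b are occupied. So no
  move is longer than a + b + 1, and the only one of this length takes the highest bead to the
  lowest gap. The bead keeps its index, so no sign appears.\<close>

lemma lower_first_hook:
  assumes fc: "frob_coords N v (a # as) (b # bs)"
    and u: "alternating N u" "\<And>v. u v \<noteq> 0 \<Longrightarrow> nonneg N v"
  shows "h > a + b + 1 \<Longrightarrow> lower N (int h) u v = 0"
    and "i < N \<Longrightarrow> v i = int (N + a) \<Longrightarrow> lower N (int (a + b + 1)) u v = u (v(i := int (N - 1 - b)))"
proof -
  have b: "b < N" and inj: "inj_on v {..<N}" and nn: "nonneg N v" using fc by (auto simp: frob_coords_def)
  have mem: "int x \<in> v ` {..<N} \<longleftrightarrow> (if x < N then N - 1 - x \<notin> insert b (set bs) else x - N \<in> insert a (set as))" for x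
    using fc by (auto simp: frob_coords_def)
  have maxa: "v j \<le> int (N + a)" if "j < N" for j
  proof -
    have "0 \<le> v j" using nn that by (simp add: nonneg_def)
    then obtain x where x: "v j = int x" using zero_le_imp_eq_int by blast
    then have "int x \<in> v ` {..<N}" using that by (metis imageI lessThan_iff)
    then have "x < N \<or> x - N \<in> insert a (set as)" using mem[of x] by (auto split: if_splits)
    then have "x \<le> N + a" using fc by (auto simp: frob_coords_def)
    then show ?thesis using x by simp
  qed
  have blocked: "v j < k \<or> (\<exists>i<N. i \<noteq> j \<and> v i = v j - k)"
    if k: "j < N" "v j - k < int (N - 1 - b)" "k > 0" for j k
  proof (cases "v j < k")
    case False
    then obtain y where y: "v j - k = int y" using zero_le_imp_eq_int[of "v j - k"] by auto
    then have "y < N - 1 - b" using k(2) by simp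
    then have "N - 1 - y > b" "y < N" by auto
    then have "int y \<in> v ` {..<N}" using mem[of y] fc by (auto simp: frob_coords_def)
    then obtain i where "i < N" "v i = v j - k" using y by (metis imageE lessThan_iff)
    then show ?thesis using k(3) by auto
  qed simp
  show "lower N (int h) u v = 0" if h: "h > a + b + 1"
  proof -
    have "lower N (int h) u v = (\<Sum>j\<in>{}. u (add_at j (- int h) v))"
    proof (rule lower_only[OF u])
      fix j assume "j < N"
      then show "v j < int h \<or> (\<exists>i<N. i \<noteq> j \<and> v i = v j - int h)"
        using maxa[of j] h b by (intro blocked) auto
    qed auto
    then show ?thesis by simp
  qed
  show "lower N (int (a + b + 1)) u v = u (v(i := int (N - 1 - b)))" if i: "i < N" "v i = int (N + a)"
  proof -
    have "lower N (int (a + b + 1)) u v = (\<Sum>j\<in>{i}. u (add_at j (- int (a + b + 1)) v))"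
    proof (rule lower_only[OF u])
      fix j assume j: "j < N" "j \<notin> {i}"
      then have "v j \<noteq> int (N + a)" using inj i by (auto simp: inj_on_def)
      then have "v j - int (a + b + 1) < int (N - 1 - b)" using maxa[OF j(1)] b by simp
      then show "v j < int (a + b + 1) \<or> (\<exists>i<N. i \<noteq> j \<and> v i = v j - int (a + b + 1))"
        using j by (intro blocked) auto
    qed (use i in auto)
    moreover have "add_at i (- int (a + b + 1)) v = v(i := int (N - 1 - b))"
      using i b by (auto simp: add_at_def)
    ultimately show ?thesis by simp
  qed
qed

lemma find_rev_upt:
  assumes "1 \<le> h" "h \<le> m" "P h" "\<And>k. h < k \<Longrightarrow> k \<le> m \<Longrightarrow> \<not> P k"
  shows "find P (rev [1..<Suc m]) = Some h"
  using assms(2,4)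
proof (induction m)
  case 0
  then show ?case using assms(1) by simp
next
  case (Suc m)
  have "find P (rev [1..<Suc (Suc m)]) = (if P (Suc m) then Some (Suc m) else find P (rev [1..<Suc m]))"
    by simp
  then show ?case using Suc assms(3) by (cases "h = Suc m") auto
qed

text \<open>These will be the c_i: content sums of the partitions left after stripping the preceding
  principal hooks.\<close>

fun contents :: "nat list \<Rightarrow> nat list \<Rightarrow> complex list" where
  "contents (a # as) (b # bs) = of_int (content_sum2 (a # as) (b # bs)) / 2 # contents as bs"
| "contents _ _ = []"

lemma length_contents: "length as = length bs \<Longrightarrow> length (contents as bs) = length as"
  by (induction as bs rule: list_induct2) simp_all

lemma nth_contents:
  assumes "length as = length bs" "i < length as"
  shows "contents as bs ! i = of_int (content_sum2 (drop i as) (drop i bs)) / 2"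
  using assms by (induction as bs arbitrary: i rule: list_induct2) (auto simp: nth_Cons split: nat.split)

lemma gchoose_two: "x gchoose 2 = x * (x - 1) / (2 :: complex)"
  by (simp add: numeral_2_eq_2 gbinomial_Suc prod.atLeast0_atMost_Suc)

text \<open>A hook of length h and arm a has content sum h(2a - h + 1)/2. With b' = h' - a' - 1 and
  t = h - h', the last three terms of the bracket add up to (b' + t + 1 choose 2). The bracket
  therefore compares the content sum of the hook with that of the hook of the same length h and arm
  a'; the difference is h(a - a').\<close>

lemma a_rec_hooks:
  "length as = length bs \<Longrightarrow> a_rec (map of_nat (hooks as bs)) (contents as bs) = map of_nat as"
proof (induction as bs rule: list_induct2)
  case (Cons a as b bs)
  define A B :: complex where "A = of_nat a" and "B = of_nat b"
  let ?h = "of_nat (a + b + 1) :: complex"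
  have h: "?h = A + B + 1" by (simp add: A_def B_def)
  have nz: "?h \<noteq> 0" by (simp only: of_nat_eq_0_iff)
  show ?case
  proof (cases as)
    case Nil
    then have "bs = []" using Cons.hyps by simp
    have id: "of_int (content_sum2 [a] [b]) / 2 + (?h gchoose 2) = ?h * A"
      by (simp add: h gchoose_two field_simps) (simp add: A_def B_def algebra_simps)
    have "a_rec (map of_nat (hooks [a] [b])) (contents [a] [b])
        = [1 / ?h * (of_int (content_sum2 [a] [b]) / 2 + (?h gchoose 2))]"
      by (simp del: content_sum2.simps)
    also have "\<dots> = [A]" unfolding id using nz by simp
    finally show ?thesis using Nil \<open>bs = []\<close> by (simp add: A_def)
  next
    case as: (Cons a' as')
    then obtain b' bs' where bs: "bs = b' # bs'" using Cons.hyps by (cases bs) auto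
    define A' B' :: complex where "A' = of_nat a'" and "B' = of_nat b'"
    let ?h' = "of_nat (a' + b' + 1) :: complex"
    let ?c = "of_int (content_sum2 (a # as) (b # bs)) / 2 :: complex"
      and ?c' = "of_int (content_sum2 as bs) / 2 :: complex"
    have h': "?h' = A' + B' + 1" by (simp add: A'_def B'_def)
    have c: "?c - ?c' = (A * (A + 1) - B * (B + 1)) / 2"
      by (simp add: A_def B_def field_simps)
    have id: "?c - ?c' - ((A' + 1) gchoose 2) + ((?h' - A') gchoose 2)
        + ((?h - ?h' + 1) gchoose 2) + (?h' - A' - 1) * (?h - ?h') = ?h * (A - A')"
      unfolding c h h' by (simp add: gchoose_two field_simps)
    have "a_rec (map of_nat (hooks (a # as) (b # bs))) (contents (a # as) (b # bs))
        = (let rest = a_rec (map of_nat (hooks as bs)) (contents as bs) in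
           (hd rest + 1 / ?h * (?c - ?c' - ((hd rest + 1) gchoose 2) + ((?h' - hd rest) gchoose 2)
             + ((?h - ?h' + 1) gchoose 2) + (?h' - hd rest - 1) * (?h - ?h'))) # rest)"
      by (simp only: as bs hooks_simps contents.simps list.map a_rec.simps Let_def)
    also have "\<dots> = (A' + 1 / ?h * (?c - ?c' - ((A' + 1) gchoose 2) + ((?h' - A') gchoose 2)
             + ((?h - ?h' + 1) gchoose 2) + (?h' - A' - 1) * (?h - ?h'))) # map of_nat as"
      by (simp only: Cons.IH Let_def) (simp only: as list.map list.sel A'_def)
    also have "\<dots> = A # map of_nat as" unfolding id using nz by simp
    finally show ?thesis by (simp add: A_def)
  qed
qed simp

lemma int_choose_two: "int m * (int m - 1) = 2 * int (m choose 2)"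
  by (induction m) (simp_all add: numeral_2_eq_2 algebra_simps)

section \<open>Reading off the symbol of the character\<close>

context
  fixes n :: nat and \<chi> :: "(nat \<Rightarrow> nat) \<Rightarrow> complex" and V :: "nat \<Rightarrow> int" and \<epsilon> :: complex
    and as bs :: "nat list"
  assumes n: "n \<ge> 1" and eps: "\<epsilon> \<noteq> 0"
    and V: "V \<in> configs n n" and coords: "frob_coords n V as bs"
    and chi: "\<And>p. p permutes {1..n} \<Longrightarrow> \<chi> p = \<epsilon> * of_int (frob_char n (orbit_type p {1..n}) V)"
begin

text \<open>A permutation of the required type exists by \<open>ex_orbit_type\<close>, so the choice
  in \<open>char_at\<close> is a proper one, and the value depends only on the type.\<close>

lemma char_at_frob_char:
  assumes "0 \<notin> set \<nu>" "sum_list \<nu> \<le> n"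
  shows "char_at n \<chi> \<nu> = \<epsilon> * of_int (frob_char n (mset \<nu> + replicate_mset (n - sum_list \<nu>) 1) V)"
proof -
  let ?T = "mset \<nu> + replicate_mset (n - sum_list \<nu>) 1"
  let ?P = "\<lambda>p. p \<in> carrier (sym_group n) \<and> cycle_type n p = ?T"
  have "\<exists>p. p permutes {1..n} \<and> orbit_type p {1..n} = ?T"
    using assms by (intro ex_orbit_type) (auto simp: sum_mset_sum_list)
  then have "\<exists>p. ?P p" by (simp add: sym_group_carrier cycle_type_def orbit_type_def)
  then have "?P (SOME p. ?P p)" by (rule someI_ex)
  then show ?thesis
    using chi[of "SOME p. ?P p"] by (simp add: char_at_def sym_group_carrier cycle_type_def orbit_type_def)
qed

text \<open>Stripping the hooks \<open>hs\<close> off \<open>V\<close> leaves \<open>v\<close>.\<close>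

definition stripped :: "nat list \<Rightarrow> (nat \<Rightarrow> int) \<Rightarrow> bool" where
  "stripped hs v \<longleftrightarrow> 0 \<notin> set hs \<and> (\<forall>\<mu>. frob_char n (mset hs + \<mu>) V = frob_char n \<mu> v)"

lemma stripped_char_at:
  assumes st: "stripped hs v" and "0 \<notin> set \<nu>" "sum_list hs + sum_list \<nu> \<le> n"
  shows "char_at n \<chi> (hs @ \<nu>)
    = \<epsilon> * of_int (frob_char n (mset \<nu> + replicate_mset (n - sum_list hs - sum_list \<nu>) 1) v)"
  using char_at_frob_char[of "hs @ \<nu>"] assms by (simp add: stripped_def add.assoc)

lemma stripped_Cons:
  assumes st: "stripped hs v" and fc: "frob_coords n v (a # as') (b # bs')"
  obtains v' where "stripped (hs @ [a + b + 1]) v'" "frob_coords n v' as' bs'"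
proof -
  obtain i where i: "i < n" "v i = int (n + a)" "frob_coords n (v(i := int (n - 1 - b))) as' bs'"
    using frob_coords_Cons[OF fc] by blast
  have "frob_char n (mset (hs @ [a + b + 1]) + \<mu>) V = frob_char n \<mu> (v(i := int (n - 1 - b)))" for \<mu>
  proof -
    have "mset (hs @ [a + b + 1]) + \<mu> = mset hs + add_mset (a + b + 1) \<mu>" by simp
    then have "frob_char n (mset (hs @ [a + b + 1]) + \<mu>) V = frob_char n (add_mset (a + b + 1) \<mu>) v"
      using st unfolding stripped_def by metis
    also have "\<dots> = frob_char n \<mu> (v(i := int (n - 1 - b)))"
      unfolding frob_char_add
      by (rule lower_first_hook(2)[OF fc alternating_frob_char frob_char_nonneg i(1,2)])
    finally show ?thesis .
  qed
  then show ?thesis using st i(3) by (intro that[of "v(i := int (n - 1 - b))"]) (auto simp: stripped_def)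
qed

text \<open>Up to the factor \<epsilon> and a sign, the values d_i are degrees of the remaining
  partitions. They are nonzero, which makes the search succeed and allows the division in
  c_i.\<close>

lemma stripped_ones:
  assumes "stripped hs v" "frob_coords n v as' bs'" "sum_list hs + sum_list (hooks as' bs') = n"
  shows "char_at n \<chi> hs = \<epsilon> * of_int (ones_char n (sum_list (hooks as' bs')) v)"
    and "ones_char n (sum_list (hooks as' bs')) v \<noteq> 0"
proof -
  show "char_at n \<chi> hs = \<epsilon> * of_int (ones_char n (sum_list (hooks as' bs')) v)"
  proof -
    have "sum_list hs \<le> n" "n - sum_list hs = sum_list (hooks as' bs')" using assms(3) by linarith+
    then show ?thesis using stripped_char_at[OF assms(1), of "[]"] by (simp add: ones_char_def)
  qed
  show "ones_char n (sum_list (hooks as' bs')) v \<noteq> 0"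
    using assms(2) frob_coords_degree[OF assms(2)]
    by (intro ones_char_nonzero) (auto simp: frob_coords_def)
qed

text \<open>The last hypothesis says that the next hook is within the search bound; it is preserved
  because arms and legs decrease strictly.\<close>

lemma h_from_stripped:
  assumes "stripped hs v" "frob_coords n v as' bs'" "sum_list hs + sum_list (hooks as' bs') = n"
    and "hs \<noteq> [] \<Longrightarrow> as' \<noteq> [] \<Longrightarrow> hd (hooks as' bs') + 2 \<le> last hs"
  shows "h_from n \<chi> hs = hs @ hooks as' bs'"
proof -
  have "length as' = length bs'" using assms by (simp add: frob_coords_def)
  then show ?thesis
    using assms
  proof (induction as' bs' arbitrary: hs v rule: list_induct2)
    case Nil
    then have "hs \<noteq> []" "sum_list hs = n" using n by auto
    then show ?case by (simp add: h_from.simps)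
  next
    case (Cons a as' b bs')
    let ?h = "a + b + 1" and ?m = "sum_list (hooks (a # as') (b # bs'))"
    have sum: "sum_list hs + ?m = n" by (rule Cons.prems(3))
    obtain v' where v': "stripped (hs @ [?h]) v'" "frob_coords n v' as' bs'"
      using stripped_Cons[OF Cons.prems(1,2)] by blast
    have sum': "sum_list (hs @ [?h]) + sum_list (hooks as' bs') = n" using sum by simp
    have "h_step n \<chi> hs = Some ?h"
      unfolding h_step_def
    proof (rule find_rev_upt)
      show "?h \<le> h_bound n hs" using Cons.prems(4) sum by (auto simp: h_bound_def)
      show "char_at n \<chi> (hs @ [?h]) \<noteq> 0"
        using stripped_ones[OF v' sum'] eps by simp
      \<comment> \<open>No cycle longer than the first remaining hook can be stripped, so all
        earlier candidates fail.\<close>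
      fix k assume k: "?h < k" "k \<le> h_bound n hs"
      have "sum_list hs + k \<le> n"
      proof (cases "hs = []")
        case False
        then show ?thesis using k sum by (auto simp: h_bound_def)
      qed (use k in \<open>simp add: h_bound_def\<close>)
      then have "char_at n \<chi> (hs @ [k])
          = \<epsilon> * of_int (frob_char n (mset [k] + replicate_mset (n - sum_list hs - k) 1) v)"
        using stripped_char_at[OF Cons.prems(1), of "[k]"] k by simp
      also have "frob_char n (mset [k] + replicate_mset (n - sum_list hs - k) 1) v = 0"
        using lower_first_hook(1)[OF Cons.prems(2) alternating_frob_char frob_char_nonneg k(1)] by simp
      finally show "\<not> char_at n \<chi> (hs @ [k]) \<noteq> 0" by simp
    qed simp
    \<comment> \<open>While a hook remains, it has length at least 1, so the last one found has
      length at least 3 and the search goes on.\<close>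
    moreover have "\<not> (hs \<noteq> [] \<and> (sum_list hs = n \<or> last hs \<le> 2))" using Cons.prems(4) sum by auto
    ultimately have "h_from n \<chi> hs = h_from n \<chi> (hs @ [?h])" by (subst h_from.simps) auto
    also have "\<dots> = (hs @ [?h]) @ hooks as' bs'"
    proof (rule Cons.IH[OF v' sum'])
      assume "as' \<noteq> []"
      then obtain a' as'' b' bs'' where eq: "as' = a' # as''" "bs' = b' # bs''"
        using Cons.hyps by (cases as'; cases bs') auto
      then have "a' < a" "b' < b" using Cons.prems(2) by (auto simp: frob_coords_def)
      then show "hd (hooks as' bs') + 2 \<le> last (hs @ [?h])" using eq by simp
    qed
    finally show ?case by simp
  qed
qed

lemma length_coords: "length as = length bs"
  using coords by (simp add: frob_coords_def)

lemma stripped_Nil: "stripped [] V"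
  by (simp add: stripped_def)

lemma sum_hooks: "sum_list (hooks as bs) = n"
  using frob_coords_degree[OF coords] V by (simp add: configs_def)

lemma h_seq_hooks: "h_seq n \<chi> = hooks as bs"
  using h_from_stripped[OF stripped_Nil coords] sum_hooks by (simp add: h_seq_def)

lemma drop_hooks: "length xs = length ys \<Longrightarrow> drop i (hooks xs ys) = hooks (drop i xs) (drop i ys)"
  by (simp add: hooks_def drop_map drop_zip)

lemma stripped_take:
  assumes "i \<le> length as"
  obtains v where "stripped (take i (hooks as bs)) v" "frob_coords n v (drop i as) (drop i bs)"
proof -
  have "\<exists>v. stripped (take i (hooks as bs)) v \<and> frob_coords n v (drop i as) (drop i bs)"
    using assms
  proof (induction i)
    case 0
    then show ?case using stripped_Nil coords by auto
  next
    case (Suc i)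
    then have i: "i < length as" "i < length bs" using length_coords by auto
    obtain v where v: "stripped (take i (hooks as bs)) v" "frob_coords n v (drop i as) (drop i bs)"
      using Suc by auto
    have "frob_coords n v (as ! i # drop (Suc i) as) (bs ! i # drop (Suc i) bs)"
      using v(2) i by (simp add: Cons_nth_drop_Suc)
    then obtain v' where v': "stripped (take i (hooks as bs) @ [as ! i + bs ! i + 1]) v'"
      "frob_coords n v' (drop (Suc i) as) (drop (Suc i) bs)"
      using stripped_Cons[OF v(1)] by blast
    moreover have "take (Suc i) (hooks as bs) = take i (hooks as bs) @ [as ! i + bs ! i + 1]"
      using i length_coords by (simp add: take_Suc_conv_app_nth hooks_def)
    ultimately have "stripped (take (Suc i) (hooks as bs)) v'" using v'(1) by simp
    then show ?case using v'(2) by blast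
  qed
  then show ?thesis using that by blast
qed

text \<open>This is \<open>content2_ones\<close> for the stripped vector, divided by the degree; the
  factor \<epsilon> cancels.\<close>

lemma c_seq_contents: "c_seq n \<chi> = contents as bs"
proof (rule nth_equalityI)
  show "length (c_seq n \<chi>) = length (contents as bs)"
    by (simp add: c_seq_def h_seq_hooks length_contents length_coords Let_def)
  fix i assume "i < length (c_seq n \<chi>)"
  then have i: "i < length as" "i < length (hooks as bs)"
    by (simp_all add: c_seq_def h_seq_hooks length_coords Let_def)
  let ?hs = "take i (hooks as bs)" and ?m = "sum_list (hooks (drop i as) (drop i bs))"
  obtain v where v: "stripped ?hs v" "frob_coords n v (drop i as) (drop i bs)"
    using stripped_take[of i] i by auto
  have sum: "sum_list ?hs + ?m = n"
    using sum_hooks by (metis append_take_drop_id drop_hooks length_coords sum_list_append)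
  have m: "n - sum_list ?hs = ?m" using sum by simp
  have cons: "drop i as = as ! i # drop (Suc i) as" "drop i bs = bs ! i # drop (Suc i) bs"
    using i length_coords by (simp_all add: Cons_nth_drop_Suc)
  have "c_seq n \<chi> ! i = (if Suc i = length as \<and> hooks as bs ! i = 1 then 0
      else of_nat (?m choose 2) * char_at n \<chi> (?hs @ [2]) / char_at n \<chi> ?hs)"
    using i length_coords by (simp add: c_seq_def h_seq_hooks d_seq_def m Let_def del: upt_Suc)
  also have "\<dots> = of_int (content_sum2 (drop i as) (drop i bs)) / 2"
  proof (cases "Suc i = length as \<and> hooks as bs ! i = 1")
    \<comment> \<open>A final hook of length 1 is a single box of content 0, in accordance with the
      convention.\<close>
    case True
    then have "as ! i = 0" "bs ! i = 0" using i length_coords by (auto simp: hooks_def)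
    then show ?thesis using True length_coords by (simp add: cons)
  next
    case False
    \<comment> \<open>A remainder of size 1 would be a final hook of length 1. With at least two
      points left, a 2-cycle can be appended.\<close>
    have "?m \<ge> 2"
    proof (rule ccontr)
      assume "\<not> ?m \<ge> 2"
      moreover have "?m = as ! i + bs ! i + 1 + sum_list (hooks (drop (Suc i) as) (drop (Suc i) bs))"
        unfolding cons by simp
      ultimately have *: "as ! i = 0" "bs ! i = 0" "sum_list (hooks (drop (Suc i) as) (drop (Suc i) bs)) = 0"
        by linarith+
      then have "hooks (drop (Suc i) as) (drop (Suc i) bs) = []"
        using zero_notin_hooks[of "drop (Suc i) as" "drop (Suc i) bs"]
        unfolding sum_list_eq_0_iff by (cases "hooks (drop (Suc i) as) (drop (Suc i) bs)") auto
      then have "length (drop (Suc i) as) = 0"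
        using length_hooks[of "drop (Suc i) as" "drop (Suc i) bs"] length_coords by simp
      then show False using False * i length_coords by (simp add: hooks_def)
    qed
    then have two: "char_at n \<chi> (?hs @ [2]) = \<epsilon> * of_int (lower n 2 (ones_char n (?m - 2)) v)"
      using stripped_char_at[OF v(1), of "[2]"] sum m by (simp add: ones_char_def)
    have "content_sum2 (drop i as) (drop i bs) * ones_char n ?m v
        = int ?m * (int ?m - 1) * lower n 2 (ones_char n (?m - 2)) v"
      using content2_ones[of n v ?m] frob_coords_content2[OF v(2)] by simp
    then have "content_sum2 (drop i as) (drop i bs) * ones_char n ?m v
        = 2 * int (?m choose 2) * lower n 2 (ones_char n (?m - 2)) v"
      by (simp only: int_choose_two)
    from arg_cong[OF this, of "of_int :: int \<Rightarrow> complex"]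
    have "(of_int (content_sum2 (drop i as) (drop i bs)) * of_int (ones_char n ?m v) :: complex)
        = 2 * of_nat (?m choose 2) * of_int (lower n 2 (ones_char n (?m - 2)) v)"
      by (simp only: of_int_mult of_int_numeral of_int_of_nat_eq)
    moreover have "(of_int (ones_char n ?m v) :: complex) \<noteq> 0" using stripped_ones(2)[OF v sum] by simp
    ultimately show ?thesis
      unfolding if_not_P[OF False] two stripped_ones(1)[OF v sum] using eps by (simp add: divide_simps mult_ac)
  qed
  also have "\<dots> = contents as bs ! i" using nth_contents[OF length_coords i(1)] by simp
  finally show "c_seq n \<chi> ! i = contents as bs ! i" .
qed

lemma a_seq_coords: "a_seq n \<chi> = map of_nat as"
  by (simp add: a_seq_def h_seq_hooks c_seq_contents a_rec_hooks length_coords)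

lemma b_seq_coords: "b_seq n \<chi> = map of_nat bs"
  using length_coords by (intro nth_equalityI) (simp_all add: b_seq_def h_seq_hooks a_seq_coords, simp add: hooks_def)

end

section \<open>The partition with given Frobenius coordinates\<close>

fun frob_partition :: "nat list \<Rightarrow> nat list \<Rightarrow> nat list" where
  "frob_partition (a # as) (b # bs) =
     (let \<mu> = frob_partition as bs in (a + 1) # map Suc \<mu> @ replicate (b - length \<mu>) 1)"
| "frob_partition _ _ = []"

lemma conjugate_part_filter: "conjugate_part \<mu> i = length (filter (\<lambda>x. i \<le> x) \<mu>)"
proof -
  have "{j. 1 \<le> j \<and> j \<le> length \<mu> \<and> i \<le> part \<mu> j} = Suc ` {j. j < length \<mu> \<and> i \<le> \<mu> ! j}"
  proof (intro equalityI subsetI)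
    fix j assume "j \<in> {j. 1 \<le> j \<and> j \<le> length \<mu> \<and> i \<le> part \<mu> j}"
    then show "j \<in> Suc ` {j. j < length \<mu> \<and> i \<le> \<mu> ! j}"
      by (intro image_eqI[of _ _ "j - 1"]) (auto simp: part_def)
  qed (auto simp: part_def)
  then show ?thesis by (simp add: conjugate_part_def length_filter_conv_card card_image)
qed

lemma sum_list_map_Suc: "sum_list (map Suc xs) = sum_list xs + length xs"
  by (induction xs) simp_all

text \<open>Each step puts a row on top and a column to the left of the inner partition. The length
  and the bound on the parts are carried along, since together with the strict decrease of the
  coordinates they show that the inner partition fits into this border.\<close>

lemma frob_partition_correct:
  assumes "length as = length bs" "sorted_wrt (>) as" "sorted_wrt (>) bs"
  shows "is_partition (frob_partition as bs) (sum_list (hooks as bs))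
    \<and> length (frob_partition as bs) = (case bs of [] \<Rightarrow> 0 | b # _ \<Rightarrow> b + 1)
    \<and> (\<forall>x\<in>set (frob_partition as bs). as \<noteq> [] \<and> x \<le> hd as + 1)
    \<and> (\<forall>i<length as. part (frob_partition as bs) (Suc i) = as ! i + Suc i
           \<and> conjugate_part (frob_partition as bs) (Suc i) = bs ! i + Suc i)"
  using assms
proof (induction as bs rule: list_induct2)
  case Nil
  then show ?case by (simp add: is_partition_def)
next
  case (Cons a as b bs)
  let ?\<mu> = "frob_partition as bs" and ?\<nu> = "frob_partition (a # as) (b # bs)"
  have IH: "is_partition ?\<mu> (sum_list (hooks as bs))" "length ?\<mu> = (case bs of [] \<Rightarrow> 0 | b # _ \<Rightarrow> b + 1)"
    "\<And>x. x \<in> set ?\<mu> \<Longrightarrow> as \<noteq> [] \<and> x \<le> hd as + 1"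
    "\<And>i. i < length as \<Longrightarrow> part ?\<mu> (Suc i) = as ! i + Suc i"
    "\<And>i. i < length as \<Longrightarrow> conjugate_part ?\<mu> (Suc i) = bs ! i + Suc i"
    using Cons.IH Cons.prems by auto
  have len: "length ?\<mu> \<le> b" using IH(2) Cons.prems by (cases bs) auto
  have le: "x \<le> a" if "x \<in> set ?\<mu>" for x
    using IH(3)[OF that] Cons.prems by (cases as) auto
  have \<nu>: "?\<nu> = (a + 1) # map Suc ?\<mu> @ replicate (b - length ?\<mu>) 1" by (simp add: Let_def)
  have len\<nu>: "length ?\<nu> = b + 1" unfolding \<nu> using len by simp
  have "sorted_wrt (\<ge>) ?\<nu>"
    using IH(1) le unfolding \<nu> is_partition_def
    by (auto simp: sorted_wrt_append sorted_wrt_map sorted_wrt_iff_nth_less[of _ "replicate _ _"])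
  then have part: "is_partition ?\<nu> (sum_list (hooks (a # as) (b # bs)))"
    using IH(1) len by (auto simp: is_partition_def \<nu> sum_list_map_Suc sum_list_replicate simp del: frob_partition.simps)
  have "part ?\<nu> (Suc i) = (a # as) ! i + Suc i \<and> conjugate_part ?\<nu> (Suc i) = (b # bs) ! i + Suc i"
    if i: "i < length (a # as)" for i
  proof (cases i)
    case 0
    have "Suc 0 \<le> x" if "x \<in> set ?\<nu>" for x
      using part that by (cases x) (auto simp: is_partition_def simp del: frob_partition.simps)
    then have "filter (\<lambda>x. Suc 0 \<le> x) ?\<nu> = ?\<nu>" by (simp add: filter_id_conv del: frob_partition.simps)
    then have "conjugate_part ?\<nu> (Suc i) = b + 1" using 0 len\<nu> by (simp add: conjugate_part_filter del: frob_partition.simps)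
    moreover have "part ?\<nu> (Suc i) = a + 1" using 0 by (simp add: part_def \<nu> del: frob_partition.simps)
    ultimately show ?thesis using 0 by simp
  next
    case (Suc j)
    then have j: "j < length as" using i by simp
    then have "part ?\<mu> (Suc j) > 0" using IH(4) by simp
    then have j\<mu>: "j < length ?\<mu>" by (auto simp: part_def split: if_splits)
    have \<mu>j: "?\<mu> ! j = as ! j + Suc j" using IH(4)[OF j] j\<mu> by (simp add: part_def)
    \<comment> \<open>The new first row thus reaches column \<open>Suc i\<close>, whereas the
      appended ones do not, this column being at least the second.\<close>
    then have "Suc j \<le> a" using le[OF nth_mem[OF j\<mu>]] by simp
    have "part ?\<nu> (Suc i) = Suc (?\<mu> ! j)"
      using Suc j\<mu> by (simp add: part_def \<nu> nth_append del: frob_partition.simps)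
    moreover have "conjugate_part ?\<nu> (Suc i) = Suc (conjugate_part ?\<mu> (Suc j))"
      using Suc \<open>Suc j \<le> a\<close> by (simp add: conjugate_part_filter \<nu> filter_map o_def del: frob_partition.simps)
    ultimately show ?thesis using Suc IH(5)[OF j] \<mu>j by simp
  qed
  moreover have "\<forall>x\<in>set ?\<nu>. x \<le> a + 1" unfolding \<nu> using le by auto
  ultimately show ?case using part len\<nu> by (auto simp del: frob_partition.simps)
qed

theorem corollary3p7:
  fixes n :: nat and \<chi> :: "(nat \<Rightarrow> nat) \<Rightarrow> complex"
  assumes "n \<ge> 1"
    and "is_character n \<chi>"
    and "\<exists>p \<in> carrier (sym_group n). \<chi> p \<noteq> 0"
    and "\<not> (\<exists>\<mu>. is_partition \<mu> n \<and> is_frobenius_symbol (a_seq n \<chi>) (b_seq n \<chi>) \<mu>)"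
  shows "\<not> irreducible_character n \<chi>"
proof
  assume "irreducible_character n \<chi>"
  then obtain d \<rho> where irr: "irreducible_representation n d \<rho>" and "affords n \<rho> \<chi>"
    by (auto simp: irreducible_character_def)
  then have trace: "\<chi> p = mat_trace (\<rho> p)" if "p permutes {1..n}" for p
    using that by (simp add: affords_def sym_group_carrier)
  obtain V \<epsilon> where V: "V \<in> configs n n" "inj_on V {..<n}" and eps: "\<epsilon> \<noteq> 0"
    and chi: "\<And>p. p permutes {1..n} \<Longrightarrow> mat_trace (\<rho> p) = \<epsilon> * of_int (frob_char n (orbit_type p {1..n}) V)"
    using irreducible_frob_char[OF irr] by blast
  obtain as bs where coords: "frob_coords n V as bs"
    using frob_coords_exist[of n V] V by (auto simp: configs_def)
  have symbol: "a_seq n \<chi> = map of_nat as" "b_seq n \<chi> = map of_nat bs" and size: "sum_list (hooks as bs) = n"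
    using a_seq_coords[OF assms(1) eps V(1) coords] b_seq_coords[OF assms(1) eps V(1) coords]
      sum_hooks[OF assms(1) eps V(1) coords] trace chi by simp_all
  have len: "length as = length bs" and sorted: "sorted_wrt (>) as" "sorted_wrt (>) bs"
    using coords by (auto simp: frob_coords_def)
  let ?\<mu> = "frob_partition as bs"
  have part: "is_partition ?\<mu> n" using frob_partition_correct[OF len sorted] size by simp
  have "sum_list (hooks as bs) = (\<Sum>i<length as. as ! i + bs ! i + 1)"
    using len by (simp add: sum_list_sum_nth hooks_def atLeast0LessThan)
  then have part': "is_partition ?\<mu> (\<Sum>i<length as. as ! i + bs ! i + 1)"
    using part size by simp
  have "part ?\<mu> i = as ! (i - 1) + i \<and> conjugate_part ?\<mu> i = bs ! (i - 1) + i"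
    if i: "i \<in> {1..length as}" for i
  proof -
    obtain j where j: "i = Suc j" "j < length as" using i by (cases i) auto
    then show ?thesis using frob_partition_correct[OF len sorted] by simp
  qed
  then have "is_frobenius_symbol (a_seq n \<chi>) (b_seq n \<chi>) ?\<mu>"
    unfolding is_frobenius_symbol_def using symbol len sorted part' by blast
  then show False using part assms(4) by blast
qed

end
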